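(* Let $K \ge 1$ be an integer and let $L_1, \dots, L_K > 0$. For any quantum graph with $K$ edges of lengths $L_1,\dots,L_K$, with spectral counting function $N$, the following bound holds for all $E \in \mathbb{R}$: $$\left| N(E) - \frac{\mathcal{L}}{\pi} E_+^{1/2} \right| \le 3K,$$ where $\mathcal{L} := \sum_{i=1}^K L_i$ and $E_+ := \max(E,0)$.
   Context: Given positive real numbers $L_1,\dots,L_K$ (the lengths), let $\mathcal{H} = \bigoplus_{i=1}^K L^2(0,L_i)$ and $\mathcal{D} = \bigoplus_{i=1}^K C_0^\infty(0,L_i)$ (smooth functions with compact support in the open intervals), and let $A$ be the symmetric operator with domain $\mathcal{D}$ defined by $A(u_1 \oplus \cdots \oplus u_K) = -(u_1'' \oplus \cdots \oplus u_K'')$. A quantum graph with $K$ edges of lengths $L_1,\dots,L_K$ is any self-adjoint extension of $A$ in $\mathcal{H}$. The spectral counting function is $N(E) = \operatorname{Card}\{n : \lambda_n \le E\}$, where $(\lambda_n)$ is the non-decreasing sequence of eigenvalues of the self-adjoint extension, repeated according to multiplicity. *)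

theory Defs
  imports "HOL-Analysis.Analysis"
begin

text \<open>
  A vector of \<open>L\<^sup>2(0, L 0) \<oplus> \<dots> \<oplus> L\<^sup>2(0, L (K - 1))\<close> is given by a representative, a family
  \<open>u :: nat \<Rightarrow> real \<Rightarrow> complex\<close>. Only the values \<open>u i x\<close> with \<open>i < K\<close> and \<open>0 < x < L i\<close>
  matter, and equality of vectors is the relation \<open>H_eq\<close> below.
\<close>

type_synonym family = "nat \<Rightarrow> real \<Rightarrow> complex"

definition L2_interval :: "real \<Rightarrow> (real \<Rightarrow> complex) set" where
  "L2_interval l = {f. f \<in> borel_measurable (lebesgue_on {0<..<l}) \<and>
                       integrable (lebesgue_on {0<..<l}) (\<lambda>x. (cmod (f x))\<^sup>2)}"

definition H_space :: "nat \<Rightarrow> (nat \<Rightarrow> real) \<Rightarrow> family set" where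
  "H_space K L = {u. \<forall>i<K. u i \<in> L2_interval (L i)}"

definition H_eq :: "nat \<Rightarrow> (nat \<Rightarrow> real) \<Rightarrow> family \<Rightarrow> family \<Rightarrow> bool" where
  "H_eq K L u v \<longleftrightarrow> (\<forall>i<K. AE x in lebesgue_on {0<..<L i}. u i x = v i x)"

definition H_inner :: "nat \<Rightarrow> (nat \<Rightarrow> real) \<Rightarrow> family \<Rightarrow> family \<Rightarrow> complex" where
  "H_inner K L u v = (\<Sum>i<K. LINT x|lebesgue_on {0<..<L i}. cnj (u i x) * v i x)"

definition H_norm :: "nat \<Rightarrow> (nat \<Rightarrow> real) \<Rightarrow> family \<Rightarrow> real" where
  "H_norm K L u = sqrt (Re (H_inner K L u u))"


text \<open>
  An unbounded operator is identified with its graph. Since the graph consists of pairs of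
  representatives, it has to be saturated under \<open>H_eq\<close>.
\<close>

definition linear_operator :: "nat \<Rightarrow> (nat \<Rightarrow> real) \<Rightarrow> (family \<times> family) set \<Rightarrow> bool" where
  "linear_operator K L T \<longleftrightarrow>
     T \<subseteq> H_space K L \<times> H_space K L \<and>
     (\<forall>u v u' v'. (u, v) \<in> T \<longrightarrow> u' \<in> H_space K L \<longrightarrow> v' \<in> H_space K L \<longrightarrow>
        H_eq K L u u' \<longrightarrow> H_eq K L v v' \<longrightarrow> (u', v') \<in> T) \<and>
     (\<forall>u v v'. (u, v) \<in> T \<longrightarrow> (u, v') \<in> T \<longrightarrow> H_eq K L v v') \<and>
     (\<lambda>i x. 0, \<lambda>i x. 0) \<in> T \<and>
     (\<forall>u v u' v'. (u, v) \<in> T \<longrightarrow> (u', v') \<in> T \<longrightarrow>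
        (\<lambda>i x. u i x + u' i x, \<lambda>i x. v i x + v' i x) \<in> T) \<and>
     (\<forall>c u v. (u, v) \<in> T \<longrightarrow> (\<lambda>i x. c * u i x, \<lambda>i x. c * v i x) \<in> T)"

definition densely_defined :: "nat \<Rightarrow> (nat \<Rightarrow> real) \<Rightarrow> (family \<times> family) set \<Rightarrow> bool" where
  "densely_defined K L T \<longleftrightarrow>
     (\<forall>u \<in> H_space K L. \<forall>\<epsilon>>0. \<exists>w \<in> Domain T. H_norm K L (\<lambda>i x. u i x - w i x) < \<epsilon>)"

definition adjoint_op ::
  "nat \<Rightarrow> (nat \<Rightarrow> real) \<Rightarrow> (family \<times> family) set \<Rightarrow> (family \<times> family) set" where
  "adjoint_op K L T = {(v, w). v \<in> H_space K L \<and> w \<in> H_space K L \<and>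
     (\<forall>(u, z) \<in> T. H_inner K L z v = H_inner K L u w)}"

definition self_adjoint :: "nat \<Rightarrow> (nat \<Rightarrow> real) \<Rightarrow> (family \<times> family) set \<Rightarrow> bool" where
  "self_adjoint K L T \<longleftrightarrow>
     linear_operator K L T \<and> densely_defined K L T \<and> adjoint_op K L T = T"


definition iter_deriv :: "nat \<Rightarrow> (real \<Rightarrow> complex) \<Rightarrow> real \<Rightarrow> complex" where
  "iter_deriv n f = ((\<lambda>g x. vector_derivative g (at x)) ^^ n) f"

definition smooth :: "(real \<Rightarrow> complex) \<Rightarrow> bool" where
  "smooth f \<longleftrightarrow> (\<forall>n x. iter_deriv n f differentiable (at x))"

text \<open>\<open>C\<^sub>0\<^sup>\<infinity>(0, l)\<close>, with its elements extended by zero to the whole line.\<close>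

definition test_functions :: "real \<Rightarrow> (real \<Rightarrow> complex) set" where
  "test_functions l = {f. smooth f \<and> compact (closure {x. f x \<noteq> 0}) \<and>
                          closure {x. f x \<noteq> 0} \<subseteq> {0<..<l}}"

definition minimal_laplacian :: "nat \<Rightarrow> (nat \<Rightarrow> real) \<Rightarrow> (family \<times> family) set" where
  "minimal_laplacian K L = {(u, v). u \<in> H_space K L \<and> v \<in> H_space K L \<and>
     (\<exists>\<phi>. (\<forall>i<K. \<phi> i \<in> test_functions (L i)) \<and> H_eq K L u \<phi> \<and>
          H_eq K L v (\<lambda>i x. - iter_deriv 2 (\<phi> i) x))}"

definition quantum_graph :: "nat \<Rightarrow> (nat \<Rightarrow> real) \<Rightarrow> (family \<times> family) set \<Rightarrow> bool" where
  "quantum_graph K L T \<longleftrightarrow> self_adjoint K L T \<and> minimal_laplacian K L \<subseteq> T"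


definition eigenspace ::
  "nat \<Rightarrow> (nat \<Rightarrow> real) \<Rightarrow> (family \<times> family) set \<Rightarrow> real \<Rightarrow> family set" where
  "eigenspace K L T \<mu> = {u. (u, \<lambda>i x. complex_of_real \<mu> * u i x) \<in> T}"

text \<open>\<open>S\<close> has complex dimension \<open>m\<close> (modulo \<open>H_eq\<close>): it has a basis with \<open>m\<close> elements.\<close>

definition has_dimension :: "nat \<Rightarrow> (nat \<Rightarrow> real) \<Rightarrow> family set \<Rightarrow> nat \<Rightarrow> bool" where
  "has_dimension K L S m \<longleftrightarrow> (\<exists>e :: nat \<Rightarrow> family.
     (\<forall>j<m. e j \<in> S) \<and>
     (\<forall>c. H_eq K L (\<lambda>i x. \<Sum>j<m. c j * e j i x) (\<lambda>i x. 0) \<longrightarrow> (\<forall>j<m. c j = 0)) \<and>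
     (\<forall>u \<in> S. \<exists>c. H_eq K L u (\<lambda>i x. \<Sum>j<m. c j * e j i x)))"

text \<open>
  \<open>ev\<close> lists the eigenvalues in non-decreasing order, each repeated according to multiplicity.
  A real \<open>\<mu>\<close> that is not an eigenvalue has a zero-dimensional eigenspace and does not occur.
\<close>

definition eigenvalue_sequence ::
  "nat \<Rightarrow> (nat \<Rightarrow> real) \<Rightarrow> (family \<times> family) set \<Rightarrow> (nat \<Rightarrow> real) \<Rightarrow> bool" where
  "eigenvalue_sequence K L T ev \<longleftrightarrow> incseq ev \<and>
     (\<forall>\<mu>. finite {n. ev n = \<mu>} \<and> has_dimension K L (eigenspace K L T \<mu>) (card {n. ev n = \<mu>}))"

text \<open>
  There is at most one eigenvalue sequence, as a non-decreasing sequence is determined by the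
  multiplicities of its values; that a quantum graph has one is part of what has to be proved
  in order to say anything about \<open>eigenvalues\<close>.
\<close>

definition eigenvalues ::
  "nat \<Rightarrow> (nat \<Rightarrow> real) \<Rightarrow> (family \<times> family) set \<Rightarrow> nat \<Rightarrow> real" where
  "eigenvalues K L T = (THE ev. eigenvalue_sequence K L T ev)"

definition spectral_count ::
  "nat \<Rightarrow> (nat \<Rightarrow> real) \<Rightarrow> (family \<times> family) set \<Rightarrow> real \<Rightarrow> nat" where
  "spectral_count K L T E = card {n. eigenvalues K L T n \<le> E}"

end

theory Submission
  imports Defs "HOL-Library.Function_Algebras" "HOL-Computational_Algebra.Polynomial" "HOL-Real_Asymp.Real_Asymp"
begin

text \<open>
  Write \<open>N E\<close> for the number of eigenvalues up to \<open>E\<close> and \<open>d E\<close> for the sum of the integer parts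
  of \<open>L i * sqrt E / pi\<close> (zero if \<open>E \<le> 0\<close>), which is the counting function of the disconnected edges with
  Dirichlet conditions. Each inequality is a variational argument that loses a number of linear
  conditions, two for each edge.

  Upper bound \<open>N E \<le> d E + 2 * K\<close> (\<open>eigenfunction_count_upper\<close>). A combination \<open>u\<close> of
  eigenfunctions with eigenvalues at most \<open>E\<close> satisfies \<open>\<langle>u, T u\<rangle> \<le> E * \<parallel>u\<parallel>\<^sup>2\<close>. If \<open>u\<close> vanishes at the
  ends of every edge, and at points that cut edge \<open>i\<close> into equal pieces, one more than the integer
  part of \<open>L i * sqrt E / pi\<close>, then the pieces are shorter than \<open>pi / k\<close> for some \<open>k\<close> with \<open>E < k\<^sup>2\<close>, and
  the Picone inequality gives \<open>k\<^sup>2 * \<parallel>u\<parallel>\<^sup>2 \<le> \<langle>u, T u\<rangle>\<close>; so \<open>u = 0\<close>. These are \<open>d E + 2 * K\<close> linear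
  conditions, so more eigenfunctions than that cannot be independent.

  Lower bound (\<open>eigenfunction_count_lower\<close>). The sine functions with frequency below \<open>sqrt E\<close>
  have Rayleigh quotients less than \<open>E\<close>, and their number is at least \<open>L i * sqrt E / pi - 1\<close> on edge
  \<open>i\<close>. A combination of them whose derivatives also vanish at all ends, which is \<open>2 * K\<close> conditions,
  lies in the domain of every self-adjoint extension. If there were more than
  \<open>N E + 2 * K\<close> sine functions, such a combination could be chosen orthogonal to all eigenvectors
  up to \<open>E\<close>. On the orthogonal complement of these, however, the Rayleigh quotient is at least \<open>E\<close>
  (\<open>rayleigh_bound_off_eigenvectors\<close>).

  That last fact replaces the spectral theorem. It rests on solving \<open>(T - \<mu>) u = f\<close> boundedly
  whenever \<open>f\<close> is orthogonal to the kernel of \<open>T - \<mu>\<close>, for every real \<open>\<mu>\<close>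
  (\<open>solvable_on_kernel_complement\<close>). For the graph this holds because the solution of the initial
  value problem at \<open>0\<close>, given by the kernel \<open>green_kernel\<close>, has zero Cauchy data at both ends of each edge
  as soon as \<open>f\<close> is orthogonal to the \<open>2 * K\<close> classical solutions, and is then in the domain of
  \<open>T\<close> whatever the boundary conditions are (\<open>green_in_domain\<close>). The regularity theory behind this
  is that weak solutions of \<open>- w'' = \<mu> w\<close> are classical (\<open>weak_solution_classical\<close>).

  The two bounds make the multiplicities locally finite with an unbounded sum, so that the
  eigenvalues can be listed (\<open>exists_sequence_with_multiplicities\<close>), in one way only.
\<close>

section \<open>Semi-inner product spaces\<close>

text \<open>
  Elimination of one unknown. All dimension arguments below are applications of this lemma: the
  unknowns are coefficients of a linear combination, the equations are linear conditions on it.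
\<close>

lemma homogeneous_system_nontrivial:
  fixes a :: "'j \<Rightarrow> 'i \<Rightarrow> 'b::field"
  assumes "finite J" "finite I" "card J < card I"
  shows "\<exists>c. (\<exists>i\<in>I. c i \<noteq> 0) \<and> (\<forall>j\<in>J. (\<Sum>i\<in>I. c i * a j i) = 0)"
  using assms
proof (induction J arbitrary: I a rule: finite_induct)
  case empty
  then obtain i where "i \<in> I" by fastforce
  then show ?case by (intro exI[of _ "\<lambda>_. 1"]) auto
next
  case (insert j J)
  show ?case
  proof (cases "\<forall>i\<in>I. a j i = 0")
    case True
    have "card J < card I" using insert by simp
    then obtain c where "\<exists>i\<in>I. c i \<noteq> 0" "\<forall>k\<in>J. (\<Sum>i\<in>I. c i * a k i) = 0"
      using insert.IH[of I a] insert.prems by blast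
    then show ?thesis using True by (intro exI[of _ c]) auto
  next
    case False
    then obtain p where p: "p \<in> I" "a j p \<noteq> 0" by blast
    have "card J < card (I - {p})" using insert p by simp
    then obtain c where c: "\<exists>i\<in>I-{p}. c i \<noteq> 0"
        "\<forall>k\<in>J. (\<Sum>i\<in>I-{p}. c i * (a k i - a k p * a j i / a j p)) = 0"
      using insert.IH[of "I-{p}" "\<lambda>k i. a k i - a k p * a j i / a j p"] insert.prems by auto
    define d where "d = c(p := - (\<Sum>i\<in>I-{p}. c i * a j i) / a j p)"
    have split: "(\<Sum>i\<in>I. d i * a k i) = d p * a k p + (\<Sum>i\<in>I-{p}. c i * a k i)" for k
    proof -
      have "(\<Sum>i\<in>I-{p}. d i * a k i) = (\<Sum>i\<in>I-{p}. c i * a k i)"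
        by (rule sum.cong) (auto simp: d_def)
      then show ?thesis using sum.remove[OF insert.prems(1) p(1), of "\<lambda>i. d i * a k i"] by simp
    qed
    have "(\<Sum>i\<in>I. d i * a k i) = 0" if "k \<in> insert j J" for k
    proof (cases "k = j")
      case True
      then show ?thesis using p by (simp add: split) (simp add: d_def)
    next
      case False
      then have "k \<in> J" using that by simp
      have "(\<Sum>i\<in>I-{p}. c i * (a k i - a k p * a j i / a j p))
          = (\<Sum>i\<in>I-{p}. c i * a k i) - (\<Sum>i\<in>I-{p}. c i * a j i) * (a k p / a j p)"
        by (simp add: right_diff_distrib sum_subtractf sum_distrib_right sum_distrib_left sum_divide_distrib mult_ac)
      then have "(\<Sum>i\<in>I-{p}. c i * a k i) = (\<Sum>i\<in>I-{p}. c i * a j i) * (a k p / a j p)"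
        using c(2) \<open>k \<in> J\<close> by simp
      then show ?thesis by (simp add: split) (simp add: d_def)
    qed
    moreover have "\<exists>i\<in>I. d i \<noteq> 0" using c(1) by (auto simp: d_def)
    ultimately show ?thesis by blast
  qed
qed

text \<open>
  The discriminant argument behind the Cauchy-Schwarz inequality, separated from any
  particular form; it is used for three of them.
\<close>

lemma cauchy_schwarz_from_quadratic:
  fixes B :: complex and A C :: real
  assumes nonneg: "\<And>t. 0 \<le> A + 2 * Re (t * B) + (cmod t)\<^sup>2 * C"
  shows "(cmod B)\<^sup>2 \<le> A * C"
proof -
  have key: "0 \<le> A - 2 * s * (cmod B)\<^sup>2 + s\<^sup>2 * (cmod B)\<^sup>2 * C" for s :: real
  proof -
    have "Re (- of_real s * cnj B * B) = - s * (cmod B)\<^sup>2"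
      by (simp add: cmod_power2) (simp add: power2_eq_square algebra_simps)
    moreover have "(cmod (- of_real s * cnj B))\<^sup>2 = s\<^sup>2 * (cmod B)\<^sup>2"
      by (simp add: norm_mult power_mult_distrib)
    ultimately show ?thesis using nonneg[of "- of_real s * cnj B"] by simp
  qed
  show ?thesis
  proof (cases "C > 0")
    case True
    have "0 \<le> A - 2 * (1/C) * (cmod B)\<^sup>2 + (1/C)\<^sup>2 * (cmod B)\<^sup>2 * C" by (rule key)
    also have "\<dots> = A - (cmod B)\<^sup>2 / C" using True by (simp add: power2_eq_square field_simps)
    finally show ?thesis using True by (simp add: field_simps)
  next
    case False
    have A: "A \<ge> 0" using key[of 0] by simp
    have "B = 0"
    proof (rule ccontr)
      assume "B \<noteq> 0"
      then have b: "(cmod B)\<^sup>2 > 0" by simp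
      define s where "s = (A + 1) / (cmod B)\<^sup>2"
      have "s\<^sup>2 * (cmod B)\<^sup>2 * C \<le> 0" using False by (simp add: mult_nonneg_nonpos)
      moreover have "s * (cmod B)\<^sup>2 = A + 1" using b by (simp add: s_def)
      ultimately show False using key[of s] A by simp
    qed
    moreover have "C = 0"
    proof (rule ccontr)
      assume "C \<noteq> 0"
      then have c: "C < 0" using False by simp
      define t where "t = sqrt ((A + 1) / - C)"
      have "t\<^sup>2 = (A + 1) / - C" using A c by (simp add: t_def divide_nonneg_neg)
      then have "t\<^sup>2 * C = - (A + 1)" using c by (simp add: field_simps)
      then show False using nonneg[of "of_real t"] \<open>B = 0\<close> by simp
    qed
    ultimately show ?thesis by simp
  qed
qed

text \<open>
  The inner product may be degenerate, because its elements will be representatives of classes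
  of functions; \<open>null\<close> is equality to zero up to this degeneracy.
\<close>

locale semi_inner = vector_space scale
  for scale :: "complex \<Rightarrow> 'a::ab_group_add \<Rightarrow> 'a" (infixr "\<odot>" 75) +
  fixes H :: "'a set" and ip :: "'a \<Rightarrow> 'a \<Rightarrow> complex"
  assumes subspace_H: "subspace H"
    and ip_add_right: "\<lbrakk>x \<in> H; y \<in> H; z \<in> H\<rbrakk> \<Longrightarrow> ip x (y + z) = ip x y + ip x z"
    and ip_scale_right: "\<lbrakk>x \<in> H; y \<in> H\<rbrakk> \<Longrightarrow> ip x (c \<odot> y) = c * ip x y"
    and ip_cnj: "\<lbrakk>x \<in> H; y \<in> H\<rbrakk> \<Longrightarrow> ip y x = cnj (ip x y)"
    and ip_nonneg: "x \<in> H \<Longrightarrow> 0 \<le> Re (ip x x)"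
begin

definition nrm :: "'a \<Rightarrow> real" where "nrm x = sqrt (Re (ip x x))"

definition null :: "'a \<Rightarrow> bool" where "null x \<longleftrightarrow> x \<in> H \<and> nrm x = 0"

definition orthonormal :: "('i \<Rightarrow> 'a) \<Rightarrow> 'i set \<Rightarrow> bool" where
  "orthonormal e I \<longleftrightarrow> (\<forall>i\<in>I. e i \<in> H) \<and> (\<forall>i\<in>I. \<forall>j\<in>I. ip (e i) (e j) = (if i = j then 1 else 0))"

definition residual :: "('i \<Rightarrow> 'a) \<Rightarrow> 'i set \<Rightarrow> 'a \<Rightarrow> 'a" where
  "residual e I x = x - (\<Sum>i\<in>I. ip (e i) x \<odot> e i)"

lemma H_closed [simp, intro]:
  shows "0 \<in> H" "x \<in> H \<Longrightarrow> y \<in> H \<Longrightarrow> x + y \<in> H" "x \<in> H \<Longrightarrow> y \<in> H \<Longrightarrow> x - y \<in> H"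
    "x \<in> H \<Longrightarrow> c \<odot> x \<in> H" "(\<And>i. i \<in> I \<Longrightarrow> e i \<in> H) \<Longrightarrow> (\<Sum>i\<in>I. e i) \<in> H"
  using subspace_H by (auto simp: subspace_0 subspace_add subspace_diff subspace_scale intro: subspace_sum)

lemma ip_add_left: "\<lbrakk>x \<in> H; y \<in> H; z \<in> H\<rbrakk> \<Longrightarrow> ip (x + y) z = ip x z + ip y z"
  by (metis H_closed(2) complex_cnj_add ip_add_right ip_cnj)

lemma ip_scale_left: "\<lbrakk>x \<in> H; y \<in> H\<rbrakk> \<Longrightarrow> ip (c \<odot> x) y = cnj c * ip x y"
  by (metis H_closed(4) complex_cnj_mult ip_cnj ip_scale_right)

lemma ip_zero_right [simp]: "x \<in> H \<Longrightarrow> ip x 0 = 0"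
  using ip_scale_right[of x 0 0] by simp

lemma ip_zero_left [simp]: "x \<in> H \<Longrightarrow> ip 0 x = 0"
  using ip_scale_left[of 0 x 0] by simp

lemma ip_diff_right: "\<lbrakk>x \<in> H; y \<in> H; z \<in> H\<rbrakk> \<Longrightarrow> ip x (y - z) = ip x y - ip x z"
  using ip_add_right[of x "y - z" z] by simp

lemma ip_diff_left: "\<lbrakk>x \<in> H; y \<in> H; z \<in> H\<rbrakk> \<Longrightarrow> ip (x - y) z = ip x z - ip y z"
  using ip_add_left[of "x - y" y z] by simp

lemma ip_sum_right:
  assumes "x \<in> H" "\<And>i. i \<in> I \<Longrightarrow> e i \<in> H"
  shows "ip x (\<Sum>i\<in>I. c i \<odot> e i) = (\<Sum>i\<in>I. c i * ip x (e i))"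
  using assms by (induction I rule: infinite_finite_induct) (auto simp: ip_add_right ip_scale_right)

lemma ip_sum_left:
  assumes "x \<in> H" "\<And>i. i \<in> I \<Longrightarrow> e i \<in> H"
  shows "ip (\<Sum>i\<in>I. c i \<odot> e i) x = (\<Sum>i\<in>I. cnj (c i) * ip (e i) x)"
  using assms by (induction I rule: infinite_finite_induct) (auto simp: ip_add_left ip_scale_left)

lemma nrm_nonneg [simp]: "x \<in> H \<Longrightarrow> 0 \<le> nrm x"
  by (simp add: nrm_def ip_nonneg)

lemma nrm_sq: "x \<in> H \<Longrightarrow> (nrm x)\<^sup>2 = Re (ip x x)"
  by (simp add: nrm_def ip_nonneg)

lemma ip_self: "x \<in> H \<Longrightarrow> ip x x = of_real ((nrm x)\<^sup>2)"
  using ip_cnj[of x x] ip_nonneg[of x] by (auto simp: complex_eq_iff nrm_def)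

lemma cauchy_schwarz:
  assumes "x \<in> H" "y \<in> H"
  shows "cmod (ip x y) \<le> nrm x * nrm y"
proof -
  have "0 \<le> (nrm x)\<^sup>2 + 2 * Re (t * ip x y) + (cmod t)\<^sup>2 * (nrm y)\<^sup>2" for t
  proof -
    have "ip (x + t \<odot> y) (x + t \<odot> y)
        = ip x x + t * ip x y + cnj t * cnj (ip x y) + (t * cnj t) * ip y y"
      using assms by (simp add: ip_add_left ip_add_right ip_scale_left ip_scale_right ip_cnj[of x y] algebra_simps)
    also have "Re \<dots> = (nrm x)\<^sup>2 + 2 * Re (t * ip x y) + (cmod t)\<^sup>2 * (nrm y)\<^sup>2"
      unfolding complex_norm_square[symmetric] ip_self[OF assms(1)] ip_self[OF assms(2)]
      by (simp add: complex_cnj_mult[symmetric] del: complex_cnj_mult)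
    finally show ?thesis using ip_nonneg[of "x + t \<odot> y"] assms by simp
  qed
  then have "(cmod (ip x y))\<^sup>2 \<le> (nrm x)\<^sup>2 * (nrm y)\<^sup>2" by (rule cauchy_schwarz_from_quadratic)
  then show ?thesis using assms by (metis mult_nonneg_nonneg nrm_nonneg power2_le_imp_le power_mult_distrib)
qed

lemma null_in_H: "null x \<Longrightarrow> x \<in> H" by (simp add: null_def)

lemma null_ip:
  assumes "null x" "y \<in> H" shows "ip x y = 0" "ip y x = 0"
  using cauchy_schwarz[of x y] cauchy_schwarz[of y x] assms by (auto simp: null_def)

lemma nullI: "x \<in> H \<Longrightarrow> ip x x = 0 \<Longrightarrow> null x"
  by (simp add: null_def nrm_def)

lemma subspace_null: "subspace {x. null x}"
proof (rule subspaceI)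
  show "0 \<in> {x. null x}" using nullI[of 0] by simp
next
  fix x y assume "x \<in> {x. null x}" "y \<in> {x. null x}"
  then have "x \<in> H" "y \<in> H" "null x" "null y" by (auto simp: null_in_H)
  then show "x + y \<in> {x. null x}" 
    by (auto intro: nullI simp: ip_add_left null_ip)
next
  fix c x assume "x \<in> {x. null x}"
  then have "x \<in> H" "null x" by (auto simp: null_in_H)
  then show "c \<odot> x \<in> {x. null x}" 
    by (auto intro: nullI simp: ip_scale_left null_ip)
qed

lemma null_closed:
  shows "null 0" "null x \<Longrightarrow> null y \<Longrightarrow> null (x + y)" "null x \<Longrightarrow> null y \<Longrightarrow> null (x - y)"
    "null x \<Longrightarrow> null (c \<odot> x)" "(\<And>i. i \<in> I \<Longrightarrow> null (e i)) \<Longrightarrow> null (\<Sum>i\<in>I. e i)"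
  using subspace_0[OF subspace_null] apply simp
  using subspace_add[OF subspace_null, of x y] apply simp
  using subspace_diff[OF subspace_null, of x y] apply simp
  using subspace_scale[OF subspace_null, of x c] apply simp
  using subspace_sum[OF subspace_null, of I e] apply simp
  done

lemma nrm_scale: "x \<in> H \<Longrightarrow> nrm (c \<odot> x) = cmod c * nrm x"
proof -
  assume x: "x \<in> H"
  have "Re (ip (c \<odot> x) (c \<odot> x)) = (cmod c)\<^sup>2 * (nrm x)\<^sup>2"
  proof -
    have "ip (c \<odot> x) (c \<odot> x) = (c * cnj c) * ip x x" using x by (simp add: ip_scale_left ip_scale_right)
    also have "\<dots> = of_real ((cmod c)\<^sup>2 * (nrm x)\<^sup>2)"
      unfolding complex_norm_square[symmetric] ip_self[OF x] by simp
    finally show ?thesis by (simp del: of_real_mult of_real_power)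
  qed
  then have "nrm (c \<odot> x) = sqrt ((cmod c * nrm x)\<^sup>2)" by (simp add: nrm_def[of "c \<odot> x"] power_mult_distrib)
  then show ?thesis using x by simp
qed

lemma nrm_triangle:
  assumes "x \<in> H" "y \<in> H" shows "nrm (x + y) \<le> nrm x + nrm y"
proof -
  have "Re (ip (x + y) (x + y)) = (nrm x)\<^sup>2 + 2 * Re (ip x y) + (nrm y)\<^sup>2"
    using assms by (simp add: ip_add_left ip_add_right ip_cnj[of x y] nrm_sq)
  also have "\<dots> \<le> (nrm x)\<^sup>2 + 2 * (nrm x * nrm y) + (nrm y)\<^sup>2"
    using cauchy_schwarz[OF assms] complex_Re_le_cmod[of "ip x y"] by linarith
  also have "\<dots> = (nrm x + nrm y)\<^sup>2" by (simp add: power2_sum)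
  finally have "nrm (x + y) \<le> sqrt ((nrm x + nrm y)\<^sup>2)" unfolding nrm_def[of "x + y"] by (rule real_sqrt_le_mono)
  then show ?thesis using assms by simp
qed

lemma nrm_sum_le:
  assumes "\<And>i. i \<in> I \<Longrightarrow> e i \<in> H"
  shows "nrm (\<Sum>i\<in>I. e i) \<le> (\<Sum>i\<in>I. nrm (e i))"
  using assms
proof (induction I rule: infinite_finite_induct)
  case (insert i I)
  then show ?case using nrm_triangle[of "e i" "\<Sum>i\<in>I. e i"] by fastforce
qed (auto simp: nrm_def)

lemma orthonormal_in_H: "orthonormal e I \<Longrightarrow> i \<in> I \<Longrightarrow> e i \<in> H"
  by (simp add: orthonormal_def)

lemma orthonormal_ip: "orthonormal e I \<Longrightarrow> i \<in> I \<Longrightarrow> j \<in> I \<Longrightarrow> ip (e i) (e j) = (if i = j then 1 else 0)"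
  by (simp add: orthonormal_def)

lemma orthonormal_nrm: "orthonormal e I \<Longrightarrow> i \<in> I \<Longrightarrow> nrm (e i) = 1"
  by (simp add: nrm_def orthonormal_ip)

lemma orthonormal_ip_sum:
  assumes "finite I" "orthonormal e I" "i \<in> I"
  shows "ip (e i) (\<Sum>j\<in>I. c j \<odot> e j) = c i"
proof -
  have "ip (e i) (\<Sum>j\<in>I. c j \<odot> e j) = (\<Sum>j\<in>I. c j * ip (e i) (e j))"
    using assms by (intro ip_sum_right) (auto simp: orthonormal_in_H)
  also have "\<dots> = (\<Sum>j\<in>I. if i = j then c j else 0)"
    using assms by (intro sum.cong) (auto simp: orthonormal_ip)
  finally show ?thesis using assms by simp
qed

lemma orthonormal_null_sum:
  assumes "finite I" "orthonormal e I" "null (\<Sum>j\<in>I. c j \<odot> e j)" "i \<in> I"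
  shows "c i = 0"
  using orthonormal_ip_sum[OF assms(1,2,4), of c] assms by (simp add: orthonormal_in_H null_ip)

lemma residual_in_H:
  "orthonormal e I \<Longrightarrow> x \<in> H \<Longrightarrow> residual e I x \<in> H"
  unfolding residual_def by (intro H_closed) (auto simp: orthonormal_in_H)

lemma residual_orthogonal:
  assumes "finite I" "orthonormal e I" "x \<in> H" "i \<in> I"
  shows "ip (e i) (residual e I x) = 0"
proof -
  have "(\<Sum>i\<in>I. ip (e i) x \<odot> e i) \<in> H" using assms by (auto simp: orthonormal_in_H)
  then show ?thesis unfolding residual_def
    using assms orthonormal_ip_sum[OF assms(1,2,4), of "\<lambda>i. ip (e i) x"]
    by (simp add: ip_diff_right orthonormal_in_H)
qed

lemma nrm_residual_le:
  assumes "finite I" "orthonormal e I" "x \<in> H"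
  shows "nrm (residual e I x) \<le> nrm x"
proof -
  let ?r = "residual e I x"
  have r: "?r \<in> H" using assms residual_in_H by blast
  have "ip (\<Sum>i\<in>I. ip (e i) x \<odot> e i) ?r = 0"
    using assms r by (subst ip_sum_left) (auto simp: orthonormal_in_H residual_orthogonal)
  moreover have "x = ?r + (\<Sum>i\<in>I. ip (e i) x \<odot> e i)" by (simp add: residual_def)
  moreover have "(\<Sum>i\<in>I. ip (e i) x \<odot> e i) \<in> H" using assms by (auto simp: orthonormal_in_H)
  ultimately have "ip x ?r = ip ?r ?r" using r by (metis add.right_neutral ip_add_left)
  then have "(nrm ?r)\<^sup>2 = cmod (ip x ?r)" using ip_self[OF r] by (simp add: norm_power)
  also have "\<dots> \<le> nrm x * nrm ?r" using cauchy_schwarz[OF assms(3) r] .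
  finally have "nrm ?r * nrm ?r \<le> nrm x * nrm ?r" by (simp add: power2_eq_square)
  then show ?thesis using nrm_nonneg[OF r] nrm_nonneg[OF assms(3)]
    by (metis mult_right_le_imp_le order_le_less)
qed

text \<open>
  An orthonormal family of maximal size is a basis: otherwise a normalised residual would
  extend it.
\<close>

lemma exists_orthonormal_basis:
  assumes S: "subspace S" "S \<subseteq> H"
    and bound: "\<And>e (m::nat). orthonormal e {..<m} \<Longrightarrow> (\<forall>i<m. e i \<in> S) \<Longrightarrow> m \<le> n"
  shows "\<exists>m\<le>n. \<exists>e. orthonormal e {..<m} \<and> (\<forall>i<m. e i \<in> S) \<and> (\<forall>x\<in>S. null (residual e {..<m} x))"
proof -
  define P where "P = (\<lambda>m::nat. \<exists>e. orthonormal e {..<m} \<and> (\<forall>i<m. e i \<in> S))"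
  have P0: "P 0" by (simp add: P_def orthonormal_def)
  have Pn: "m \<le> n" if "P m" for m using that bound unfolding P_def by blast
  obtain m where m: "P m" "\<And>k. P k \<Longrightarrow> k \<le> m"
    using GreatestI_nat[of P 0 n] Greatest_le_nat[of P _ n] P0 Pn by blast
  obtain e where e: "orthonormal e {..<m}" "\<forall>i<m. e i \<in> S" using m(1) by (auto simp: P_def)
  have "null (residual e {..<m} x)" if x: "x \<in> S" for x
  proof (rule ccontr)
    let ?r = "residual e {..<m} x"
    assume "\<not> null ?r"
    have xH: "x \<in> H" using x S by blast
    have rS: "?r \<in> S" unfolding residual_def
      using x e(2) S(1) by (intro subspace_diff subspace_sum subspace_scale) auto
    have rH: "?r \<in> H" using rS S by blast
    have n0: "nrm ?r \<noteq> 0" using \<open>\<not> null ?r\<close> rH by (simp add: null_def)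
    define f where "f = e(m := of_real (1 / nrm ?r) \<odot> ?r)"
    have fS: "\<forall>i<Suc m. f i \<in> S" using e(2) rS S(1) by (auto simp: f_def subspace_scale less_Suc_eq)
    have orth: "ip (e i) ?r = 0" "ip ?r (e i) = 0" if "i < m" for i
      using residual_orthogonal[OF _ e(1) xH, of i] that ip_cnj[of "e i" ?r] rH e by (auto simp: orthonormal_in_H)
    have "nrm (f m) = 1" using n0 rH by (simp add: f_def nrm_scale norm_divide)
    then have "ip (f m) (f m) = 1" using fS S ip_self[of "f m"] by auto
    then have "orthonormal f {..<Suc m}"
      unfolding orthonormal_def using fS S e orth rH
      by (auto simp: f_def less_Suc_eq orthonormal_ip ip_scale_left ip_scale_right orthonormal_in_H)
    then have "P (Suc m)" using fS by (auto simp: P_def)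
    then show False using m(2) by fastforce
  qed
  then show ?thesis using m(1) Pn e by blast
qed

lemma orthogonal_to_basis:
  assumes "finite I" "orthonormal e I" "x \<in> H" "null (residual e I x)" "y \<in> H" "\<And>i. i \<in> I \<Longrightarrow> ip (e i) y = 0"
  shows "ip x y = 0"
proof -
  have "(\<Sum>i\<in>I. ip (e i) x \<odot> e i) \<in> H" using assms by (auto simp: orthonormal_in_H)
  moreover have "ip (\<Sum>i\<in>I. ip (e i) x \<odot> e i) y = 0"
    using assms by (subst ip_sum_left) (auto simp: orthonormal_in_H)
  moreover have "x = residual e I x + (\<Sum>i\<in>I. ip (e i) x \<odot> e i)" by (simp add: residual_def)
  ultimately show ?thesis using assms null_in_H by (metis ip_add_left null_ip(1) add.right_neutral)
qed

text \<open>
  Invariance of dimension in the quotient by the null vectors, stated on representatives.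
\<close>

lemma independent_card_le:
  assumes fin: "finite I" "finite J"
    and e: "\<And>i. i \<in> I \<Longrightarrow> e i \<in> H" and v: "\<And>j. j \<in> J \<Longrightarrow> v j \<in> H"
    and span: "\<And>i. i \<in> I \<Longrightarrow> \<exists>c. null (e i - (\<Sum>j\<in>J. c j \<odot> v j))"
    and indep: "\<And>c. null (\<Sum>i\<in>I. c i \<odot> e i) \<Longrightarrow> \<forall>i\<in>I. c i = 0"
  shows "card I \<le> card J"
proof (rule ccontr)
  assume "\<not> card I \<le> card J"
  obtain a where a: "\<And>i. i \<in> I \<Longrightarrow> null (e i - (\<Sum>j\<in>J. a i j \<odot> v j))" using span by metis
  obtain c where c: "\<exists>i\<in>I. c i \<noteq> 0" "\<forall>j\<in>J. (\<Sum>i\<in>I. c i * a i j) = 0"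
    using homogeneous_system_nontrivial[OF fin(2,1), of "\<lambda>j i. a i j"] \<open>\<not> card I \<le> card J\<close> by auto
  have "(\<Sum>i\<in>I. c i \<odot> (\<Sum>j\<in>J. a i j \<odot> v j)) = (\<Sum>j\<in>J. (\<Sum>i\<in>I. c i * a i j) \<odot> v j)"
    unfolding scale_sum_right scale_sum_left scale_scale by (rule sum.swap)
  also have "\<dots> = 0" using c(2) by simp
  finally have "(\<Sum>i\<in>I. c i \<odot> e i) = (\<Sum>i\<in>I. c i \<odot> (e i - (\<Sum>j\<in>J. a i j \<odot> v j)))"
    by (simp add: scale_right_diff_distrib sum_subtractf)
  also have "null \<dots>" using a by (intro null_closed(4,5)) auto
  finally show False using indep c(1) by blast
qed

end

section \<open>Self-adjoint operators with a parametrix\<close>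

text \<open>
  The last assumption is what makes the spectrum discrete. It says that, up to the finitely many
  vectors \<open>v\<close>, the operator \<open>T - \<mu>\<close> has a bounded right inverse and no kernel. For a differential operator on
  intervals the \<open>v\<close> are the classical solutions of the eigenvalue equation, and the
  right inverse solves an initial value problem.
\<close>

locale selfadjoint_operator = semi_inner scale H ip
  for scale :: "complex \<Rightarrow> 'a::ab_group_add \<Rightarrow> 'a" (infixr "\<odot>" 75) and H ip +
  fixes T :: "('a \<times> 'a) set"
  assumes T_in_H: "(u, z) \<in> T \<Longrightarrow> u \<in> H \<and> z \<in> H"
    and T_zero: "(0, 0) \<in> T"
    and T_add: "(u, z) \<in> T \<Longrightarrow> (u', z') \<in> T \<Longrightarrow> (u + u', z + z') \<in> T"
    and T_scale: "(u, z) \<in> T \<Longrightarrow> (c \<odot> u, c \<odot> z) \<in> T"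
    and T_sym: "(u, z) \<in> T \<Longrightarrow> (v, w) \<in> T \<Longrightarrow> ip z v = ip u w"
    and T_max: "\<lbrakk>v \<in> H; w \<in> H; \<And>u z. (u, z) \<in> T \<Longrightarrow> ip z v = ip u w\<rbrakk> \<Longrightarrow> (v, w) \<in> T"
    and parametrix: "\<exists>(J::nat set) v C. finite J \<and> (\<forall>j\<in>J. v j \<in> H) \<and>
       (\<forall>f\<in>H. (\<forall>j\<in>J. ip (v j) f = 0) \<longrightarrow>
          (\<exists>u. (u, complex_of_real \<mu> \<odot> u + f) \<in> T \<and> nrm u \<le> C * nrm f)) \<and>
       (\<forall>u. (u, complex_of_real \<mu> \<odot> u) \<in> T \<longrightarrow> (\<exists>c. null (u - (\<Sum>j\<in>J. c j \<odot> v j))))"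
begin

definition eig :: "real \<Rightarrow> 'a set" where
  "eig \<mu> = {u. (u, complex_of_real \<mu> \<odot> u) \<in> T}"

lemma T_diff: "(u, z) \<in> T \<Longrightarrow> (u', z') \<in> T \<Longrightarrow> (u - u', z - z') \<in> T"
  using T_add[of u z "(-1) \<odot> u'" "(-1) \<odot> z'"] T_scale[of u' z' "-1"] by simp

lemma T_sum: "(\<And>i. i \<in> I \<Longrightarrow> (u i, z i) \<in> T) \<Longrightarrow> ((\<Sum>i\<in>I. u i), (\<Sum>i\<in>I. z i)) \<in> T"
  by (induction I rule: infinite_finite_induct) (auto simp: T_zero T_add)

text \<open>
  The graph of a self-adjoint operator is saturated, since the adjoint is defined through
  inner products only.
\<close>

lemma T_null:
  assumes "(u, z) \<in> T" "null (u' - u)" "null (z' - z)" shows "(u', z') \<in> T"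
proof -
  have "(u' - u, z' - z) \<in> T"
    using assms T_in_H by (intro T_max) (auto simp: null_ip null_in_H)
  then show ?thesis using T_add[OF assms(1)] by fastforce
qed

lemma T_shift_add:
  assumes "(u, c \<odot> u + f) \<in> T" "(w, c \<odot> w + g) \<in> T"
  shows "(u + w, c \<odot> (u + w) + (f + g)) \<in> T"
proof -
  have "c \<odot> (u + w) + (f + g) = (c \<odot> u + f) + (c \<odot> w + g)" by (simp add: scale_right_distrib)
  then show ?thesis using T_add[OF assms] by metis
qed

lemma T_shift_scale:
  assumes "(u, c \<odot> u + f) \<in> T" shows "(a \<odot> u, c \<odot> (a \<odot> u) + a \<odot> f) \<in> T"
proof -
  have "c \<odot> (a \<odot> u) + a \<odot> f = a \<odot> (c \<odot> u + f)" by (simp add: scale_right_distrib mult.commute)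
  then show ?thesis using T_scale[OF assms] by metis
qed

lemma subspace_eig: "subspace (eig \<mu>)"
  using T_zero T_shift_add[of _ "complex_of_real \<mu>" 0 _ 0] T_shift_scale[of _ "complex_of_real \<mu>" 0]
  unfolding eig_def subspace_def mem_Collect_eq by simp

lemma eig_in_H: "eig \<mu> \<subseteq> H"
  using T_in_H by (auto simp: eig_def)

text \<open>
  The Fredholm alternative. Let \<open>V\<close> be the span of the vectors of the parametrix and \<open>R\<close> the range of
  \<open>T - \<mu>\<close>. As \<open>R\<close> contains the orthogonal complement of \<open>V\<close>, it is the sum of that complement and of \<open>R \<inter> V\<close>; a vector of \<open>V\<close> orthogonal
  to \<open>R \<inter> V\<close> is then orthogonal to \<open>R\<close>, hence in the kernel by self-adjointness. So the part of \<open>V\<close>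
  orthogonal to the kernel lies in \<open>R\<close>, and it is enough to solve for a finite basis of this part.
\<close>

lemma solvable_on_kernel_complement:
  "\<exists>C. \<forall>f\<in>H. (\<forall>k\<in>eig \<mu>. ip k f = 0) \<longrightarrow>
     (\<exists>u. (u, complex_of_real \<mu> \<odot> u + f) \<in> T \<and> nrm u \<le> C * nrm f)"
proof -
  let ?l = "complex_of_real \<mu>"
  obtain J :: "nat set" and v C where J: "finite J" "\<And>j. j \<in> J \<Longrightarrow> v j \<in> H"
    and solve: "\<And>f. f \<in> H \<Longrightarrow> (\<forall>j\<in>J. ip (v j) f = 0) \<Longrightarrow>
          (\<exists>u. (u, ?l \<odot> u + f) \<in> T \<and> nrm u \<le> C * nrm f)"
    and ker: "\<And>u. u \<in> eig \<mu> \<Longrightarrow> (\<exists>c. null (u - (\<Sum>j\<in>J. c j \<odot> v j)))"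
    using parametrix[of \<mu>] unfolding eig_def by blast
  define V where "V = {x\<in>H. \<exists>c. null (x - (\<Sum>j\<in>J. c j \<odot> v j))}"
  have VI: "x \<in> V" if "x \<in> H" "null (x - (\<Sum>j\<in>J. c j \<odot> v j))" for x c
    unfolding V_def mem_Collect_eq using that by (intro conjI exI[of _ c])
  have subV: "subspace V"
  proof (rule subspaceI)
    show "0 \<in> V" by (rule VI[of _ "\<lambda>_. 0"]) (simp_all add: null_closed(1))
  next
    fix x y assume "x \<in> V" "y \<in> V"
    then obtain c d where xy: "x \<in> H" "y \<in> H" "null (x - (\<Sum>j\<in>J. c j \<odot> v j))" "null (y - (\<Sum>j\<in>J. d j \<odot> v j))"
      unfolding V_def by blast
    then have "null ((x + y) - (\<Sum>j\<in>J. (c j + d j) \<odot> v j))"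
    proof -
      have "(x + y) - (\<Sum>j\<in>J. (c j + d j) \<odot> v j)
          = (x - (\<Sum>j\<in>J. c j \<odot> v j)) + (y - (\<Sum>j\<in>J. d j \<odot> v j))"
        by (simp add: scale_left_distrib sum.distrib)
      then show ?thesis using null_closed(2) xy by metis
    qed
    with xy show "x + y \<in> V" by (intro VI) auto
  next
    fix b x assume "x \<in> V"
    then obtain c where x: "x \<in> H" "null (x - (\<Sum>j\<in>J. c j \<odot> v j))" unfolding V_def by blast
    then have "null (b \<odot> x - (\<Sum>j\<in>J. (b * c j) \<odot> v j))"
    proof -
      have "b \<odot> x - (\<Sum>j\<in>J. (b * c j) \<odot> v j) = b \<odot> (x - (\<Sum>j\<in>J. c j \<odot> v j))"
        by (simp add: scale_right_diff_distrib scale_sum_right)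
      then show ?thesis using null_closed(4) x by metis
    qed
    with x show "b \<odot> x \<in> V" by (intro VI) auto
  qed
  have VH: "V \<subseteq> H" by (auto simp: V_def)
  have vV: "v j \<in> V" if "j \<in> J" for j
  proof -
    have "(\<Sum>i\<in>J. (if i = j then 1 else 0) \<odot> v i) = (\<Sum>i\<in>J. if i = j then v i else 0)"
      by (rule sum.cong) auto
    then have "v j - (\<Sum>i\<in>J. (if i = j then 1 else 0) \<odot> v i) = 0" using that J by simp
    then have "null (v j - (\<Sum>i\<in>J. (if i = j then 1 else 0) \<odot> v i))" using null_closed(1) by metis
    then show ?thesis by (rule VI[OF J(2)[OF that]])
  qed
  have basis: "\<exists>m e. orthonormal e {..<m::nat} \<and> (\<forall>i<m. e i \<in> S) \<and> (\<forall>x\<in>S. null (residual e {..<m} x))"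
    if "subspace S" "S \<subseteq> V" for S
  proof -
    have "S \<subseteq> H" using that(2) VH by blast
    have "\<exists>m\<le>card J. \<exists>e. orthonormal e {..<m} \<and> (\<forall>i<m. e i \<in> S) \<and> (\<forall>x\<in>S. null (residual e {..<m} x))"
    proof (rule exists_orthonormal_basis[OF that(1) \<open>S \<subseteq> H\<close>])
      fix e :: "nat \<Rightarrow> 'a" and m :: nat
      assume e: "orthonormal e {..<m}" "\<forall>i<m. e i \<in> S"
      have "card {..<m} \<le> card J"
      proof (rule independent_card_le)
        fix c assume "null (\<Sum>i<m. c i \<odot> e i)"
        then show "\<forall>i\<in>{..<m}. c i = 0" using orthonormal_null_sum[OF _ e(1)] by blast
      next
        fix i assume "i \<in> {..<m}"
        then have "e i \<in> V" using e(2) \<open>S \<subseteq> V\<close> by blast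
        then show "\<exists>c. null (e i - (\<Sum>j\<in>J. c j \<odot> v j))" "e i \<in> H" unfolding V_def by blast+
      qed (use J in auto)
      then show "m \<le> card J" by simp
    qed
    then show ?thesis by blast
  qed
  define R where "R = {f\<in>H. \<exists>u. (u, ?l \<odot> u + f) \<in> T}"
  have subR: "subspace R"
  proof (rule subspaceI)
    show "0 \<in> R" unfolding R_def using T_zero by (auto intro!: exI[of _ 0])
  next
    fix f g assume "f \<in> R" "g \<in> R"
    then obtain u w where "f \<in> H" "g \<in> H" "(u, ?l \<odot> u + f) \<in> T" "(w, ?l \<odot> w + g) \<in> T" by (auto simp: R_def)
    then show "f + g \<in> R" using T_shift_add[of u ?l f w g] unfolding R_def by auto
  next
    fix c f assume "f \<in> R"
    then obtain u where "f \<in> H" "(u, ?l \<odot> u + f) \<in> T" by (auto simp: R_def)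
    then show "c \<odot> f \<in> R" using T_shift_scale[of u ?l f c] unfolding R_def by (auto simp del: scale_scale)
  qed
  have eigV: "eig \<mu> \<subseteq> V" using ker eig_in_H by (auto simp: V_def)
  have Vperp: "f \<in> R" if "f \<in> H" "\<And>x. x \<in> V \<Longrightarrow> ip x f = 0" for f
    using solve[OF that(1)] that vV unfolding R_def by blast
  have Reig: "g \<in> eig \<mu>" if "g \<in> H" "\<And>y. y \<in> R \<Longrightarrow> ip y g = 0" for g
  proof -
    have "ip z g = ip u (?l \<odot> g)" if uz: "(u, z) \<in> T" for u z
    proof -
      have H: "u \<in> H" "z \<in> H" using T_in_H[OF uz] by auto
      have "z - ?l \<odot> u \<in> R" using uz H by (auto simp: R_def intro!: exI[of _ u])
      then have "ip (z - ?l \<odot> u) g = 0" using \<open>\<And>y. y \<in> R \<Longrightarrow> ip y g = 0\<close> by blast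
      then show ?thesis using H \<open>g \<in> H\<close> by (simp add: ip_diff_left ip_scale_left ip_scale_right)
    qed
    then show ?thesis using T_max[of g "?l \<odot> g"] that(1) by (simp add: eig_def)
  qed
  \<comment> \<open>The part of \<open>V\<close> orthogonal to the kernel consists of right-hand sides that can be solved.\<close>
  define W where "W = {x\<in>V. \<forall>k\<in>eig \<mu>. ip k x = 0}"
  have subW: "subspace W"
    unfolding W_def using subV eig_in_H VH
    by (auto simp: subspace_def ip_add_right ip_scale_right subset_iff)
  have WR: "x \<in> R" if x: "x \<in> W" for x
  proof -
    have xH: "x \<in> H" and xV: "x \<in> V" using x VH by (auto simp: W_def)
    have "subspace (R \<inter> V)" using subR subV by (rule subspace_inter)
    then obtain m r where r: "orthonormal r {..<m::nat}" "\<forall>i<m. r i \<in> R \<inter> V"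
      "\<forall>x\<in>R\<inter>V. null (residual r {..<m} x)" using basis by blast
    obtain n b where b: "orthonormal b {..<n::nat}" "\<forall>i<n. b i \<in> V"
      "\<forall>x\<in>V. null (residual b {..<n} x)" using basis[OF subV] by blast
    define g where "g = residual r {..<m} x"
    have gH: "g \<in> H" unfolding g_def using residual_in_H[OF r(1) xH] .
    have gV: "g \<in> V" unfolding g_def residual_def
      using xV r subV by (intro subspace_diff subspace_sum subspace_scale) auto
    have rg: "ip (r i) g = 0" if "i < m" for i
      unfolding g_def using residual_orthogonal[OF _ r(1) xH] that by auto
    have g_eig: "g \<in> eig \<mu>"
    proof (rule Reig[OF gH])
      fix y assume y: "y \<in> R"
      then have yH: "y \<in> H" by (auto simp: R_def)
      define y' where "y' = residual b {..<n} y"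
      have y'H: "y' \<in> H" unfolding y'_def using residual_in_H[OF b(1) yH] .
      have y'V: "ip x y' = 0" if "x \<in> V" for x
        using orthogonal_to_basis[OF _ b(1), of x y'] b that VH y'H residual_orthogonal[OF _ b(1) yH]
        by (auto simp: y'_def)
      have "y' \<in> R" by (rule Vperp[OF y'H y'V])
      then have 1: "y - y' \<in> R" using y subR by (simp add: subspace_diff)
      have "y - y' = (\<Sum>i<n. ip (b i) y \<odot> b i)" by (simp add: y'_def residual_def)
      then have "y - y' \<in> V" using b subV by (auto intro!: subspace_sum subspace_scale)
      then have "ip (y - y') g = 0"
        using orthogonal_to_basis[OF _ r(1), of "y - y'" g] 1 VH gH rg r(3) by auto
      moreover have "ip y' g = 0" using y'V[OF gV] ip_cnj[OF gH y'H] by simp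
      ultimately show "ip y g = 0" using ip_diff_left[OF yH y'H gH] by simp
    qed
    have "ip g g = ip g x - (\<Sum>i<m. ip (r i) x * ip g (r i))"
    proof -
      have "ip g (\<Sum>i<m. ip (r i) x \<odot> r i) = (\<Sum>i<m. ip (r i) x * ip g (r i))"
        using r gH by (intro ip_sum_right) (auto simp: orthonormal_in_H)
      moreover have "(\<Sum>i<m. ip (r i) x \<odot> r i) \<in> H" using r by (auto simp: orthonormal_in_H)
      ultimately show ?thesis
        using ip_diff_right[OF gH xH] by (metis g_def residual_def)
    qed
    also have "ip g x = 0" using g_eig x by (auto simp: W_def)
    also have "(\<Sum>i<m. ip (r i) x * ip g (r i)) = 0"
      using rg ip_cnj[OF _ gH] r by (intro sum.neutral) (auto simp: orthonormal_in_H)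
    finally have gnull: "null g" using gH by (intro nullI) auto
    have "x - g = (\<Sum>i<m. ip (r i) x \<odot> r i)" by (simp add: g_def residual_def)
    then have "x - g \<in> R" using r subR by (auto intro!: subspace_sum subspace_scale)
    then obtain u where u: "(u, ?l \<odot> u + (x - g)) \<in> T" by (auto simp: R_def)
    have "(u, ?l \<odot> u + x) \<in> T"
      by (rule T_null[OF u]) (simp_all add: null_closed gnull)
    then show ?thesis using xH by (auto simp: R_def)
  qed
  obtain p k where k: "orthonormal k {..<p::nat}" "\<forall>i<p. k i \<in> eig \<mu>" "\<forall>x\<in>eig \<mu>. null (residual k {..<p} x)"
    using basis[OF subspace_eig eigV] by blast
  have "W \<subseteq> V" by (auto simp: W_def)
  then obtain q w where w: "orthonormal w {..<q::nat}" "\<forall>i<q. w i \<in> W" "\<forall>x\<in>W. null (residual w {..<q} x)"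
    using basis[OF subW] by blast
  have "\<forall>i<q. \<exists>u. (u, ?l \<odot> u + w i) \<in> T" using w(2) WR unfolding R_def by blast
  then obtain a where a: "\<And>i. i < q \<Longrightarrow> (a i, ?l \<odot> a i + w i) \<in> T" by metis
  have aH: "a i \<in> H" if "i < q" for i using a T_in_H that by blast
  define C' where "C' = \<bar>C\<bar> + (\<Sum>i<q. nrm (a i))"
  have "\<exists>u. (u, ?l \<odot> u + f) \<in> T \<and> nrm u \<le> C' * nrm f"
    if fH: "f \<in> H" and f: "\<forall>k\<in>eig \<mu>. ip k f = 0" for f
  proof -
    define f' where "f' = residual w {..<q} f"
    have f'H: "f' \<in> H" unfolding f'_def using residual_in_H[OF w(1) fH] .
    have wf': "ip (w i) f' = 0" if "i < q" for i
      unfolding f'_def using residual_orthogonal[OF _ w(1) fH] that by auto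
    have kf': "ip y f' = 0" if "y \<in> eig \<mu>" for y
    proof -
      have yH: "y \<in> H" using that eig_in_H by blast
      have "ip y (\<Sum>i<q. ip (w i) f \<odot> w i) = (\<Sum>i<q. ip (w i) f * ip y (w i))"
        using w yH by (intro ip_sum_right) (auto simp: orthonormal_in_H)
      also have "\<dots> = 0" using w(2) that by (intro sum.neutral) (auto simp: W_def)
      finally have *: "ip y (\<Sum>i<q. ip (w i) f \<odot> w i) = 0" .
      have "(\<Sum>i<q. ip (w i) f \<odot> w i) \<in> H" using w by (auto simp: orthonormal_in_H)
      then show ?thesis unfolding f'_def residual_def
        using * f that yH fH by (simp add: ip_diff_right)
    qed
    have "ip (v j) f' = 0" if "j \<in> J" for j
    proof -
      define x where "x = v j"
      have xV: "x \<in> V" using vV that by (simp add: x_def)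
      then have xH: "x \<in> H" using VH by blast
      define x' where "x' = residual k {..<p} x"
      have x'V: "x' \<in> V" unfolding x'_def residual_def
        using xV k eigV subV by (intro subspace_diff subspace_sum subspace_scale) auto
      then have x'H: "x' \<in> H" using VH by blast
      have "ip y x' = 0" if "y \<in> eig \<mu>" for y
        using orthogonal_to_basis[OF _ k(1), of y x'] k that eig_in_H x'H residual_orthogonal[OF _ k(1) xH]
        by (auto simp: x'_def)
      then have "x' \<in> W" using x'V by (simp add: W_def)
      then have 1: "ip x' f' = 0"
        using orthogonal_to_basis[OF _ w(1), of x' f'] w x'H f'H wf' by auto
      have "x - x' = (\<Sum>i<p. ip (k i) x \<odot> k i)" by (simp add: x'_def residual_def)
      then have "x - x' \<in> eig \<mu>" using k subspace_eig by (auto intro!: subspace_sum subspace_scale)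
      then have "ip (x - x') f' = 0" by (rule kf')
      then show ?thesis using 1 ip_diff_left[OF xH x'H f'H] by (simp add: x_def)
    qed
    then obtain s where s: "(s, ?l \<odot> s + f') \<in> T" "nrm s \<le> C * nrm f'"
      using solve[OF f'H] by blast
    define u where "u = s + (\<Sum>i<q. ip (w i) f \<odot> a i)"
    have "(\<Sum>i<q. ip (w i) f \<odot> a i, \<Sum>i<q. ip (w i) f \<odot> (?l \<odot> a i + w i)) \<in> T"
      using a by (intro T_sum T_scale) auto
    from T_add[OF s(1) this]
    have "(u, ?l \<odot> s + f' + (\<Sum>i<q. ip (w i) f \<odot> (?l \<odot> a i + w i))) \<in> T" by (simp add: u_def)
    also have "?l \<odot> s + f' + (\<Sum>i<q. ip (w i) f \<odot> (?l \<odot> a i + w i)) = ?l \<odot> u + f"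
      unfolding u_def f'_def residual_def
      by (simp add: scale_right_distrib sum.distrib scale_sum_right mult.commute)
    finally have uT: "(u, ?l \<odot> u + f) \<in> T" .
    have sH: "s \<in> H" using s T_in_H by blast
    have "nrm u \<le> nrm s + nrm (\<Sum>i<q. ip (w i) f \<odot> a i)"
      unfolding u_def using sH aH by (intro nrm_triangle) auto
    also have "nrm (\<Sum>i<q. ip (w i) f \<odot> a i) \<le> (\<Sum>i<q. nrm (ip (w i) f \<odot> a i))"
      using aH by (intro nrm_sum_le) auto
    also have "\<dots> \<le> (\<Sum>i<q. nrm f * nrm (a i))"
    proof (rule sum_mono)
      fix i assume i: "i \<in> {..<q}"
      have "cmod (ip (w i) f) \<le> nrm f"
        using cauchy_schwarz[of "w i" f] i w fH by (auto simp: orthonormal_in_H orthonormal_nrm)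
      then show "nrm (ip (w i) f \<odot> a i) \<le> nrm f * nrm (a i)"
        using aH[of i] i by (simp add: nrm_scale mult_right_mono)
    qed
    also have "nrm s \<le> \<bar>C\<bar> * nrm f"
    proof -
      have "C * nrm f' \<le> \<bar>C\<bar> * nrm f'" using f'H by (simp add: mult_right_mono)
      also have "\<dots> \<le> \<bar>C\<bar> * nrm f"
        unfolding f'_def using nrm_residual_le[OF _ w(1) fH] by (simp add: mult_left_mono)
      finally show ?thesis using s(2) by simp
    qed
    finally have "nrm u \<le> C' * nrm f"
      by (simp add: C'_def distrib_right sum_distrib_right mult.commute[of "nrm f"])
    with uT show ?thesis by blast
  qed
  then show ?thesis by blast
qed

end

section \<open>The Rayleigh quotient off the low eigenvectors\<close>

context selfadjoint_operator
begin

lemma nrm_triangle_diff: "x \<in> H \<Longrightarrow> y \<in> H \<Longrightarrow> nrm (x - y) \<le> nrm x + nrm y"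
  using nrm_triangle[of x "(-1) \<odot> y"] nrm_scale[of y "-1"] H_closed(4)[of y "-1"] by simp

lemma nrm_null_diff:
  assumes "u \<in> H" "null (u - u')" shows "nrm u \<le> nrm u'"
proof -
  have "u' \<in> H" using assms null_in_H[of "u - u'"] H_closed(3)[of u "u - u'"] by simp
  then have "nrm (u' + (u - u')) \<le> nrm u' + nrm (u - u')" using assms null_in_H by (intro nrm_triangle) auto
  then show ?thesis using assms by (simp add: null_def)
qed

text \<open>
  On the complement \<open>D\<close> of the given eigenvectors, \<open>T - \<mu>\<close> has a bounded inverse for every
  \<open>\<mu> \<le> E\<close>. Let \<open>R\<close> be the inverse of \<open>T - E\<close>; the claim is that \<open>R\<close> is non-negative. Otherwise let
  \<open>- \<kappa> < 0\<close> be the infimum of its quadratic form on unit vectors, which is finite because \<open>R\<close> is bounded.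
  The form of \<open>R + \<kappa>\<close> is non-negative, and \<open>R + \<kappa>\<close> has a bounded inverse, which can be written with the
  inverse of \<open>T - (E - 1 / \<kappa>)\<close>. The Cauchy-Schwarz inequality for the form then bounds it below by a positive multiple
  of the squared norm, contradicting the choice of \<open>\<kappa>\<close>. The operator \<open>R\<close> itself is not mentioned: its
  graph consists of the pairs \<open>(rhs u z, u)\<close> with \<open>(u, z) \<in> D\<close>.
\<close>

lemma rayleigh_bound_off_eigenvectors:
  assumes fin: "finite I" and on: "orthonormal e I" and e_eig: "\<And>i. i \<in> I \<Longrightarrow> e i \<in> eig (\<nu> i)"
    and complete: "\<And>\<mu> k. \<mu> \<le> E \<Longrightarrow> k \<in> eig \<mu> \<Longrightarrow> (\<forall>i\<in>I. ip (e i) k = 0) \<Longrightarrow> null k"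
    and uz: "(u, z) \<in> T" "\<And>i. i \<in> I \<Longrightarrow> ip (e i) u = 0"
  shows "E * (nrm u)\<^sup>2 \<le> Re (ip z u)"
proof -
  let ?E = "complex_of_real E"
  define D where "D = {(u, z). (u, z) \<in> T \<and> (\<forall>i\<in>I. ip (e i) u = 0)}"
  have eH: "e i \<in> H" if "i \<in> I" for i using orthonormal_in_H[OF on that] .
  have D_H: "u \<in> H" "z \<in> H" if "(u, z) \<in> D" for u z using that T_in_H by (auto simp: D_def)
  have D_z: "ip (e i) z = 0" if "(u, z) \<in> D" "i \<in> I" for u z i
  proof -
    have "(e i, complex_of_real (\<nu> i) \<odot> e i) \<in> T" using e_eig[OF that(2)] by (simp add: eig_def)
    then have "ip (complex_of_real (\<nu> i) \<odot> e i) u = ip (e i) z" using that T_sym by (auto simp: D_def)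
    then show ?thesis using that eH D_H[OF that(1)] by (simp add: ip_scale_left D_def)
  qed
  have D_add_scale: "(u + t \<odot> p, z + t \<odot> q) \<in> D" if "(u, z) \<in> D" "(p, q) \<in> D" for u z p q t
    using that T_add[OF _ T_scale, of u z p q t] D_H[OF that(1)] D_H[OF that(2)] eH
    by (auto simp: D_def ip_add_right ip_scale_right)
  have D_scale: "(t \<odot> p, t \<odot> q) \<in> D" if "(p, q) \<in> D" for p q t
    using that T_scale[of p q t] D_H[OF that(1)] eH by (auto simp: D_def ip_scale_right)
  have solve: "\<exists>C\<ge>0. \<forall>f\<in>H. (\<forall>i\<in>I. ip (e i) f = 0) \<longrightarrow>
       (\<exists>u. (u, complex_of_real \<mu> \<odot> u + f) \<in> D \<and> nrm u \<le> C * nrm f)" if "\<mu> \<le> E" for \<mu>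
  proof -
    let ?m = "complex_of_real \<mu>"
    obtain C where C: "\<And>f. f \<in> H \<Longrightarrow> (\<forall>k\<in>eig \<mu>. ip k f = 0) \<Longrightarrow>
        (\<exists>u. (u, ?m \<odot> u + f) \<in> T \<and> nrm u \<le> C * nrm f)"
      using solvable_on_kernel_complement[of \<mu>] by blast
    have proj: "(residual e I u, ?m \<odot> residual e I u + f) \<in> T"
      if uT: "(u, ?m \<odot> u + f) \<in> T" and fH: "f \<in> H" and f: "\<forall>i\<in>I. ip (e i) f = 0" for u f
    proof -
      have uH: "u \<in> H" using T_in_H[OF uT] by simp
      have "(ip (e i) u \<odot> e i, ?m \<odot> (ip (e i) u \<odot> e i) + 0) \<in> T" if i: "i \<in> I" for i
      proof -
        have ei: "(e i, complex_of_real (\<nu> i) \<odot> e i) \<in> T" using e_eig[OF i] by (simp add: eig_def)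
        from T_sym[OF this uT] have "of_real (\<nu> i) * ip (e i) u = ?m * ip (e i) u"
          using eH[OF i] uH fH f i by (simp add: ip_scale_left ip_scale_right ip_add_right)
        then have "ip (e i) u = 0 \<or> \<nu> i = \<mu>" by auto
        then show ?thesis using T_scale[OF ei, of "ip (e i) u"] T_zero by (auto simp: mult.commute)
      qed
      then have "((\<Sum>i\<in>I. ip (e i) u \<odot> e i), (\<Sum>i\<in>I. ?m \<odot> (ip (e i) u \<odot> e i) + 0)) \<in> T"
        by (rule T_sum)
      from T_diff[OF uT this] show ?thesis
        by (simp add: residual_def scale_right_diff_distrib scale_sum_right algebra_simps)
    qed
    have "\<exists>u. (u, ?m \<odot> u + f) \<in> D \<and> nrm u \<le> \<bar>C\<bar> * nrm f"
      if fH: "f \<in> H" and f: "\<forall>i\<in>I. ip (e i) f = 0" for f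
    proof -
      have "ip k f = 0" if k: "k \<in> eig \<mu>" for k
      proof -
        have kH: "k \<in> H" using k eig_in_H by blast
        have "(k, ?m \<odot> k + 0) \<in> T" using k by (simp add: eig_def)
        from proj[OF this] eH have "residual e I k \<in> eig \<mu>" by (simp add: eig_def)
        then have "null (residual e I k)"
          using residual_orthogonal[OF fin on kH] \<open>\<mu> \<le> E\<close> complete by blast
        then show ?thesis using orthogonal_to_basis[OF fin on kH _ fH] f by blast
      qed
      then obtain u where u: "(u, ?m \<odot> u + f) \<in> T" "nrm u \<le> C * nrm f" using C[OF fH] by blast
      have uH: "u \<in> H" using T_in_H[OF u(1)] by simp
      have "(residual e I u, ?m \<odot> residual e I u + f) \<in> D"
        using proj[OF u(1) fH f] residual_orthogonal[OF fin on uH] by (simp add: D_def)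
      moreover have "nrm (residual e I u) \<le> \<bar>C\<bar> * nrm f"
        using nrm_residual_le[OF fin on uH] u(2) mult_right_mono[OF abs_ge_self nrm_nonneg[OF fH], of C] by linarith
      ultimately show ?thesis by blast
    qed
    then show ?thesis by (intro exI[of _ "\<bar>C\<bar>"]) auto
  qed
  define rhs where "rhs u z = z - ?E \<odot> u" for u z
  define Q where "Q u z = Re (ip (rhs u z) u)" for u z
  have rhs_H: "rhs u z \<in> H" if "(u, z) \<in> D" for u z using D_H[OF that] by (simp add: rhs_def)
  have rhs_orth: "ip (e i) (rhs u z) = 0" if "(u, z) \<in> D" "i \<in> I" for u z i
    using that D_H[OF that(1)] eH D_z[OF that] by (simp add: rhs_def ip_diff_right ip_scale_right D_def)
  obtain C where C: "C \<ge> 0" "\<And>f. f \<in> H \<Longrightarrow> (\<forall>i\<in>I. ip (e i) f = 0) \<Longrightarrow>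
       (\<exists>u. (u, ?E \<odot> u + f) \<in> D \<and> nrm u \<le> C * nrm f)" using solve[of E] by blast
  have Q_lower: "- Q u z \<le> C * (nrm (rhs u z))\<^sup>2" if uz: "(u, z) \<in> D" for u z
  proof -
    have H: "u \<in> H" "z \<in> H" "rhs u z \<in> H" using D_H[OF uz] rhs_H[OF uz] by auto
    obtain w where w: "(w, ?E \<odot> w + rhs u z) \<in> D" "nrm w \<le> C * nrm (rhs u z)"
      using C(2)[OF H(3)] rhs_orth[OF uz] by blast
    have "(u - w, z - (?E \<odot> w + rhs u z)) \<in> T" using uz w(1) by (auto simp: D_def intro!: T_diff)
    moreover have "z - (?E \<odot> w + rhs u z) = ?E \<odot> (u - w)"
      by (simp add: rhs_def scale_right_diff_distrib)
    ultimately have "u - w \<in> eig E" by (simp add: eig_def)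
    moreover have "\<forall>i\<in>I. ip (e i) (u - w) = 0"
      using uz w(1) H D_H[OF w(1)] eH by (auto simp: D_def ip_diff_right)
    ultimately have "null (u - w)" using complete[of E] by blast
    then have "nrm u \<le> C * nrm (rhs u z)" using nrm_null_diff[OF H(1)] w(2) by fastforce
    then have "nrm (rhs u z) * nrm u \<le> nrm (rhs u z) * (C * nrm (rhs u z))"
      using H by (intro mult_left_mono) auto
    moreover have "- Q u z \<le> nrm (rhs u z) * nrm u"
      unfolding Q_def using cauchy_schwarz[OF H(3,1)] abs_Re_le_cmod[of "ip (rhs u z) u"] by linarith
    ultimately show ?thesis by (simp add: power2_eq_square mult_ac)
  qed
  have Q_nonneg: "0 \<le> Q u z" if uz: "(u, z) \<in> D" for u z
  proof (rule ccontr)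
    assume neg: "\<not> 0 \<le> Q u z"
    define S where "S = {- Q u z / (nrm (rhs u z))\<^sup>2 | u z. (u, z) \<in> D \<and> nrm (rhs u z) > 0}"
    have bdd: "bdd_above S"
    proof (rule bdd_aboveI[of _ C])
      fix x assume "x \<in> S"
      then obtain u z where x: "x = - Q u z / (nrm (rhs u z))\<^sup>2" "(u, z) \<in> D" "nrm (rhs u z) > 0"
        by (auto simp: S_def)
      then show "x \<le> C" using Q_lower[OF x(2)] unfolding x(1) by (subst pos_divide_le_eq) auto
    qed
    define \<kappa> where "\<kappa> = Sup S"
    have pos: "nrm (rhs u z) > 0"
      using Q_lower[OF uz] neg C(1) nrm_nonneg[OF rhs_H[OF uz]] by (cases "nrm (rhs u z) = 0") auto
    then have in_S: "- Q u z / (nrm (rhs u z))\<^sup>2 \<in> S" using uz by (auto simp: S_def)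
    have kpos: "\<kappa> > 0"
    proof -
      have "0 < - Q u z / (nrm (rhs u z))\<^sup>2" using neg pos by (intro divide_pos_pos) auto
      also have "\<dots> \<le> \<kappa>" unfolding \<kappa>_def using in_S bdd by (rule cSup_upper)
      finally show ?thesis .
    qed
    have form_nonneg: "0 \<le> Q u z + \<kappa> * (nrm (rhs u z))\<^sup>2" if uz: "(u, z) \<in> D" for u z
    proof (cases "nrm (rhs u z) = 0")
      case True
      then show ?thesis using Q_lower[OF uz] by simp
    next
      case False
      then have "nrm (rhs u z) > 0" using nrm_nonneg[OF rhs_H[OF uz]] by simp
      moreover from this have "- Q u z / (nrm (rhs u z))\<^sup>2 \<le> \<kappa>"
        unfolding \<kappa>_def using bdd uz by (intro cSup_upper) (auto simp: S_def)
      ultimately show ?thesis by (subst (asm) pos_divide_le_eq) auto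
    qed
    \<comment> \<open>The resolvent parameter at which \<open>- \<kappa>\<close> would be an eigenvalue of \<open>R\<close>.\<close>
    define \<mu> where "\<mu> = E - 1 / \<kappa>"
    have "\<mu> \<le> E" using kpos by (simp add: \<mu>_def)
    then obtain B where B: "B \<ge> 0" "\<And>f. f \<in> H \<Longrightarrow> (\<forall>i\<in>I. ip (e i) f = 0) \<Longrightarrow>
       (\<exists>u. (u, complex_of_real \<mu> \<odot> u + f) \<in> D \<and> nrm u \<le> B * nrm f)" using solve[of \<mu>] by blast
    define M where "M = (1 / \<kappa>) * (1 + B / \<kappa>)"
    have Mpos: "M > 0" using kpos B by (simp add: M_def add_pos_nonneg)
    have improved: "(nrm (rhs u z))\<^sup>2 \<le> M * (Q u z + \<kappa> * (nrm (rhs u z))\<^sup>2)" if uz: "(u, z) \<in> D" for u z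
    proof -
      define f where "f = rhs u z"
      have fH: "f \<in> H" and uH: "u \<in> H" and zH: "z \<in> H" using rhs_H[OF uz] D_H[OF uz] by (auto simp: f_def)
      obtain w where w: "(w, complex_of_real \<mu> \<odot> w + f) \<in> D" "nrm w \<le> B * nrm f"
        using B(2)[OF fH] rhs_orth[OF uz] by (auto simp: f_def)
      have wH: "w \<in> H" using D_H[OF w(1)] by simp
      let ?k = "complex_of_real (1 / \<kappa>)"
      define p where "p = ?k \<odot> w"
      define q where "q = ?k \<odot> (complex_of_real \<mu> \<odot> w + f)"
      have pq: "(p, q) \<in> D" unfolding p_def q_def by (rule D_scale[OF w(1)])
      define g where "g = rhs p q"
      have pH: "p \<in> H" and gH: "g \<in> H" using D_H[OF pq] rhs_H[OF pq] by (auto simp: g_def)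
      have g_eq: "g = ?k \<odot> (f - ?k \<odot> w)"
      proof -
        have "g = (?k * complex_of_real \<mu> - ?E * ?k) \<odot> w + ?k \<odot> f"
          unfolding g_def rhs_def p_def q_def
          by (simp add: scale_right_distrib scale_left_diff_distrib)
        moreover have "?k * complex_of_real \<mu> - ?E * ?k = - (?k * ?k)"
          by (simp add: \<mu>_def algebra_simps)
        ultimately show ?thesis by (simp add: scale_right_diff_distrib)
      qed
      \<comment> \<open>That is, \<open>g\<close> is mapped to \<open>f\<close> by \<open>R + \<kappa>\<close>.\<close>
      have sum: "p + complex_of_real \<kappa> \<odot> g = f"
        unfolding p_def g_eq using kpos by (simp add: scale_right_diff_distrib)
      have fp: "ip f p = ip u g"
      proof -
        have "ip z p = ip u q" using uz pq T_sym by (auto simp: D_def)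
        then show ?thesis unfolding f_def g_def rhs_def
          using uH zH pH D_H[OF pq] by (simp add: ip_diff_left ip_diff_right ip_scale_left ip_scale_right)
      qed
      have ff: "ip f p + complex_of_real \<kappa> * ip f g = of_real ((nrm f)\<^sup>2)"
        using ip_add_right[OF fH pH, of "complex_of_real \<kappa> \<odot> g"] fH gH ip_self[OF fH]
        by (simp add: sum ip_scale_right)
      have gf: "ip g p + complex_of_real \<kappa> * ip g g = ip g f"
        using ip_add_right[OF gH pH, of "complex_of_real \<kappa> \<odot> g"] gH
        by (simp add: sum ip_scale_right)
      have "(cmod (complex_of_real ((nrm f)\<^sup>2)))\<^sup>2 \<le> (Q u z + \<kappa> * (nrm f)\<^sup>2) * Re (ip g f)"
      proof (rule cauchy_schwarz_from_quadratic)
        fix t :: complex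
        have tD: "(u + t \<odot> p, z + t \<odot> q) \<in> D" by (rule D_add_scale[OF uz pq])
        have r: "rhs (u + t \<odot> p) (z + t \<odot> q) = f + t \<odot> g"
          unfolding f_def g_def rhs_def by (simp add: scale_right_distrib scale_right_diff_distrib mult.commute)
        have "ip (f + t \<odot> g) (u + t \<odot> p) + \<kappa> * ip (f + t \<odot> g) (f + t \<odot> g)
           = (ip f u + \<kappa> * ip f f) + t * (ip f p + \<kappa> * ip f g)
             + cnj t * (ip g u + \<kappa> * ip g f) + (t * cnj t) * (ip g p + \<kappa> * ip g g)"
          using fH gH pH uH by (simp add: ip_add_left ip_add_right ip_scale_left ip_scale_right algebra_simps)
        also have "ip g u + \<kappa> * ip g f = of_real ((nrm f)\<^sup>2)"
        proof -
          have "ip g u + \<kappa> * ip g f = cnj (ip f p + \<kappa> * ip f g)"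
            using fp ip_cnj[OF uH gH] ip_cnj[OF fH gH] by simp
          then show ?thesis unfolding ff by simp
        qed
        also note ff
        also note gf
        finally have eq: "ip (f + t \<odot> g) (u + t \<odot> p) + \<kappa> * ip (f + t \<odot> g) (f + t \<odot> g)
           = (ip f u + \<kappa> * ip f f) + t * of_real ((nrm f)\<^sup>2) + cnj t * of_real ((nrm f)\<^sup>2)
             + (t * cnj t) * ip g f" .
        have "Q (u + t \<odot> p) (z + t \<odot> q) + \<kappa> * (nrm (f + t \<odot> g))\<^sup>2
            = Re (ip (f + t \<odot> g) (u + t \<odot> p) + \<kappa> * ip (f + t \<odot> g) (f + t \<odot> g))"
          using fH gH by (simp add: Q_def r nrm_sq)
        also have "\<dots> = (Q u z + \<kappa> * (nrm f)\<^sup>2) + 2 * Re (t * of_real ((nrm f)\<^sup>2)) + (cmod t)\<^sup>2 * Re (ip g f)"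
          unfolding eq complex_norm_square[symmetric] using fH by (simp add: Q_def f_def nrm_sq)
        finally show "0 \<le> (Q u z + \<kappa> * (nrm f)\<^sup>2) + 2 * Re (t * of_real ((nrm f)\<^sup>2)) + (cmod t)\<^sup>2 * Re (ip g f)"
          using form_nonneg[OF tD] by (simp add: r)
      qed
      also have "\<dots> \<le> (Q u z + \<kappa> * (nrm f)\<^sup>2) * (M * (nrm f)\<^sup>2)"
      proof (rule mult_left_mono)
        have "nrm (f - ?k \<odot> w) \<le> nrm f + nrm (?k \<odot> w)"
          using fH wH by (intro nrm_triangle_diff) auto
        also have "nrm (?k \<odot> w) \<le> (1 / \<kappa>) * (B * nrm f)"
          using wH kpos w(2) by (simp add: nrm_scale norm_divide divide_right_mono)
        finally have "nrm (f - ?k \<odot> w) \<le> (1 + B / \<kappa>) * nrm f" by (simp add: algebra_simps)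
        then have "nrm g \<le> M * nrm f"
          unfolding g_eq M_def using fH wH kpos
          by (subst nrm_scale) (auto simp: norm_divide divide_right_mono)
        then have "nrm g * nrm f \<le> M * nrm f * nrm f" using fH by (intro mult_right_mono) auto
        moreover have "Re (ip g f) \<le> nrm g * nrm f"
          using cauchy_schwarz[OF gH fH] complex_Re_le_cmod[of "ip g f"] by linarith
        ultimately show "Re (ip g f) \<le> M * (nrm f)\<^sup>2" by (simp add: power2_eq_square)
      qed (use form_nonneg[OF uz] in \<open>simp add: f_def\<close>)
      finally have *: "(nrm f)\<^sup>2 * (nrm f)\<^sup>2 \<le> (M * (Q u z + \<kappa> * (nrm f)\<^sup>2)) * (nrm f)\<^sup>2"
        by (simp only: norm_of_real abs_power2 power2_eq_square[of "(nrm f)\<^sup>2"] mult_ac)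
      show ?thesis
      proof (cases "nrm f = 0")
        case True
        then show ?thesis using form_nonneg[OF uz] Mpos by (simp add: f_def)
      next
        case False
        then have "(nrm f)\<^sup>2 > 0" by simp
        with * have "(nrm f)\<^sup>2 \<le> M * (Q u z + \<kappa> * (nrm f)\<^sup>2)" by (rule mult_right_le_imp_le)
        then show ?thesis by (simp add: f_def)
      qed
    qed
    have "\<kappa> \<le> \<kappa> - 1 / M"
      unfolding \<kappa>_def
    proof (rule cSup_least)
      show "S \<noteq> {}" using in_S by auto
      fix x assume "x \<in> S"
      then obtain u z where x: "x = - Q u z / (nrm (rhs u z))\<^sup>2" "(u, z) \<in> D" "nrm (rhs u z) > 0"
        by (auto simp: S_def)
      have "(nrm (rhs u z))\<^sup>2 / M \<le> Q u z + \<kappa> * (nrm (rhs u z))\<^sup>2"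
        using improved[OF x(2)] Mpos by (simp add: divide_le_eq mult.commute)
      then have "- Q u z \<le> (\<kappa> - 1 / M) * (nrm (rhs u z))\<^sup>2" by (simp add: left_diff_distrib)
      then show "x \<le> Sup S - 1 / M" unfolding x(1) using x(3) by (subst pos_divide_le_eq) (auto simp: \<kappa>_def)
    qed
    then show False using Mpos by simp
  qed
  have "(u, z) \<in> D" using uz by (auto simp: D_def)
  moreover from this have "Q u z = Re (ip z u) - E * (nrm u)\<^sup>2"
    using D_H[of u z] unfolding Q_def rhs_def by (simp add: ip_diff_left ip_scale_left nrm_sq)
  ultimately show ?thesis using Q_nonneg[of u z] by simp
qed

end

section \<open>Smooth functions and the fundamental lemma of the calculus of variations\<close>

lemma iter_deriv_Suc: "iter_deriv (Suc n) f = iter_deriv n (\<lambda>x. vector_derivative f (at x))"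
  by (simp only: iter_deriv_def funpow_Suc_right comp_def)

text \<open>
  The definition by iterated derivatives is awkward to verify directly; membership in a set of
  functions closed under differentiation is the usable form.
\<close>

lemma smooth_coinduct:
  assumes "f \<in> P" and step: "\<And>g. g \<in> P \<Longrightarrow> \<exists>g'\<in>P. \<forall>x. (g has_vector_derivative g' x) (at x)"
  shows "smooth f"
proof -
  have "iter_deriv n g \<in> P" if "g \<in> P" for n g
    using that
  proof (induction n arbitrary: g)
    case 0
    then show ?case by (simp add: iter_deriv_def)
  next
    case (Suc n)
    obtain g' where g': "g' \<in> P" "\<forall>x. (g has_vector_derivative g' x) (at x)" using step[OF Suc.prems] by blast
    then have "(\<lambda>x. vector_derivative g (at x)) = g'" by (auto simp: vector_derivative_at)
    then show ?case using Suc.IH[OF g'(1)] by (simp add: iter_deriv_Suc)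
  qed
  then show ?thesis using assms unfolding smooth_def
    by (meson differentiableI_vector)
qed

lemma smooth_deriv:
  assumes "smooth f"
  shows "smooth (\<lambda>x. vector_derivative f (at x))"
    and "(f has_vector_derivative vector_derivative f (at x)) (at x)"
proof -
  show "smooth (\<lambda>x. vector_derivative f (at x))"
    using assms unfolding smooth_def iter_deriv_Suc[symmetric] by blast
  have "iter_deriv 0 f differentiable (at x)" using assms unfolding smooth_def by blast
  then show "(f has_vector_derivative vector_derivative f (at x)) (at x)"
    by (simp add: iter_deriv_def vector_derivative_works)
qed

text \<open>
  Used for solutions of differential equations that are built by integration.
\<close>

lemma smooth_antideriv:
  assumes "smooth f" "\<And>x. (F has_vector_derivative f x) (at x)"
  shows "smooth F"
proof (rule smooth_coinduct[where P = "insert F {g. smooth g}"])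
  fix g assume g: "g \<in> insert F {g. smooth g}"
  show "\<exists>g'\<in>insert F {g. smooth g}. \<forall>x. (g has_vector_derivative g' x) (at x)"
  proof (cases "g = F")
    case True
    then show ?thesis using assms by auto
  next
    case False
    then have "smooth g" using g by simp
    then show ?thesis using smooth_deriv[of g]
      by (intro bexI[of _ "\<lambda>x. vector_derivative g (at x)"]) auto
  qed
qed simp

lemma smooth_continuous: "smooth f \<Longrightarrow> continuous_on A f"
  using smooth_deriv(2) by (intro continuous_at_imp_continuous_on ballI) (rule has_vector_derivative_continuous)

lemma smooth_add:
  assumes "smooth f" "smooth g" shows "smooth (\<lambda>x. f x + g x)"
proof (rule smooth_coinduct[where P = "{\<lambda>x. f x + g x | f g. smooth f \<and> smooth g}"])
  fix h assume "h \<in> {\<lambda>x. f x + g x | f g. smooth f \<and> smooth g}"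
  then obtain f g where fg: "h = (\<lambda>x. f x + g x)" "smooth f" "smooth g" by blast
  show "\<exists>h'\<in>{\<lambda>x. f x + g x | f g. smooth f \<and> smooth g}. \<forall>x. (h has_vector_derivative h' x) (at x)"
    using smooth_deriv[OF fg(2)] smooth_deriv[OF fg(3)] unfolding fg(1)
    by (intro bexI[of _ "\<lambda>x. vector_derivative f (at x) + vector_derivative g (at x)"])
      (auto intro!: derivative_intros)
qed (use assms in blast)

text \<open>
  By the product rule these are closed under differentiation, which products alone are not.
\<close>

inductive_set product_sums :: "(real \<Rightarrow> complex) set" where
  mult: "smooth f \<Longrightarrow> smooth g \<Longrightarrow> (\<lambda>x. f x * g x) \<in> product_sums"
| add: "f \<in> product_sums \<Longrightarrow> g \<in> product_sums \<Longrightarrow> (\<lambda>x. f x + g x) \<in> product_sums"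

lemma smooth_mult:
  assumes "smooth f" "smooth g" shows "smooth (\<lambda>x. f x * g x)"
proof (rule smooth_coinduct[where P = product_sums])
  show "(\<lambda>x. f x * g x) \<in> product_sums" using assms by (rule product_sums.mult)
next
  fix h assume "h \<in> product_sums"
  then show "\<exists>h'\<in>product_sums. \<forall>x. (h has_vector_derivative h' x) (at x)"
  proof induction
    case (mult f g)
    let ?f = "\<lambda>x. vector_derivative f (at x)" and ?g = "\<lambda>x. vector_derivative g (at x)"
    have "(\<lambda>x. f x * ?g x + ?f x * g x) \<in> product_sums"
      using mult smooth_deriv by (intro product_sums.add product_sums.mult) auto
    then show ?case
      using smooth_deriv(2)[OF mult(1)] smooth_deriv(2)[OF mult(2)]
      by (intro bexI[of _ "\<lambda>x. f x * ?g x + ?f x * g x"]) (auto intro!: derivative_intros)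
  next
    case (add f g)
    then obtain f' g' where "f' \<in> product_sums" "g' \<in> product_sums"
      "\<forall>x. (f has_vector_derivative f' x) (at x)" "\<forall>x. (g has_vector_derivative g' x) (at x)" by blast
    then show ?case
      by (intro bexI[of _ "\<lambda>x. f' x + g' x"]) (auto intro!: derivative_intros product_sums.add)
  qed
qed

lemma smooth_const [simp]: "smooth (\<lambda>x. c)"
proof (rule smooth_coinduct[where P = "range (\<lambda>c x. c)"])
  fix g :: "real \<Rightarrow> complex" assume "g \<in> range (\<lambda>c x. c)"
  then show "\<exists>g'\<in>range (\<lambda>c x. c). \<forall>x. (g has_vector_derivative g' x) (at x)"
    by (intro bexI[of _ "\<lambda>x. 0"]) auto
qed blast

lemma smooth_scale: "smooth f \<Longrightarrow> smooth (\<lambda>x. c * f x)"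
  by (rule smooth_mult) auto

lemma smooth_affine:
  assumes "smooth f" shows "smooth (\<lambda>x. f (a * x + b))"
proof (rule smooth_coinduct[where P = "{\<lambda>x. c * f (a * x + b) | f c. smooth f}"])
  show "(\<lambda>x. f (a * x + b)) \<in> {\<lambda>x. c * f (a * x + b) | f c. smooth f}"
    using assms by (intro CollectI exI[of _ f] exI[of _ 1]) auto
next
  fix g assume "g \<in> {\<lambda>x. c * f (a * x + b) | f c. smooth f}"
  then obtain f c where g: "g = (\<lambda>x. c * f (a * x + b))" "smooth f" by blast
  let ?f = "\<lambda>x. vector_derivative f (at x)"
  have "(g has_vector_derivative (c * of_real a) * ?f (a * x + b)) (at x)" for x
  proof -
    have "((\<lambda>x. f (a * x + b)) has_vector_derivative a *\<^sub>R ?f (a * x + b)) (at x)"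
    proof -
      have d: "((\<lambda>x. a * x + b) has_vector_derivative a) (at x)"
        by (auto intro!: derivative_eq_intros simp: has_real_derivative_iff_has_vector_derivative[symmetric])
      show ?thesis using vector_diff_chain_at[OF d smooth_deriv(2)[OF g(2), of "a * x + b"]] by (simp add: o_def)
    qed
    then show ?thesis unfolding g(1)
      by (auto intro!: derivative_eq_intros simp: scaleR_conv_of_real)
  qed
  then show "\<exists>g'\<in>{\<lambda>x. c * f (a * x + b) | f c. smooth f}. \<forall>x. (g has_vector_derivative g' x) (at x)"
    using smooth_deriv(1)[OF g(2)]
    by (intro bexI[of _ "\<lambda>x. (c * of_real a) * ?f (a * x + b)"]) (auto intro!: exI[of _ ?f])
qed

lemma poly_times_exp_minus_tendsto_0:
  fixes p :: "real poly"
  shows "((\<lambda>t. poly p t * exp (- t)) \<longlongrightarrow> 0) at_top"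
proof -
  have "((\<lambda>t. \<Sum>i\<le>degree p. coeff p i * (t ^ i / exp t)) \<longlongrightarrow> (\<Sum>i\<le>degree p. coeff p i * 0)) at_top"
    by (intro tendsto_sum tendsto_mult tendsto_const tendsto_power_div_exp_0)
  moreover have "(\<lambda>t. \<Sum>i\<le>degree p. coeff p i * (t ^ i / exp t)) = (\<lambda>t. poly p t * exp (- t))"
    by (auto simp: poly_altdef exp_minus field_simps sum_distrib_right sum_divide_distrib)
  ultimately show ?thesis by simp
qed

text \<open>
  The functions \<open>p (1 / x) * exp (- 1 / x)\<close>, continued by zero to \<open>x \<le> 0\<close>, form a family closed under
  differentiation; the member for \<open>p = 1\<close> is the usual smooth function that is flat at \<open>0\<close>.
\<close>

definition poly_bump :: "real poly \<Rightarrow> real \<Rightarrow> real" where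
  "poly_bump p x = (if x > 0 then poly p (1 / x) * exp (- (1 / x)) else 0)"

lemma poly_bump_deriv:
  "(poly_bump p has_real_derivative poly_bump ([:0, 0, 1:] * (p - pderiv p)) x) (at x)"
proof -
  consider "x > 0" | "x < 0" | "x = 0" by linarith
  then show ?thesis
  proof cases
    case 1
    have "((\<lambda>x. poly p (1 / x) * exp (- (1 / x))) has_real_derivative
        poly_bump ([:0, 0, 1:] * (p - pderiv p)) x) (at x)"
      using 1 by (auto intro!: derivative_eq_intros DERIV_chain'[OF _ poly_DERIV] simp: poly_bump_def field_simps power2_eq_square)
    moreover have "\<forall>\<^sub>F y in nhds x. poly p (1 / y) * exp (- (1 / y)) = poly_bump p y"
      using eventually_nhds_in_open[of "{0<..}" x] 1 by (auto elim!: eventually_mono simp: poly_bump_def)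
    ultimately show ?thesis by (subst DERIV_cong_ev[OF refl _ refl, symmetric])
  next
    case 2
    have "((\<lambda>x. 0) has_real_derivative poly_bump ([:0, 0, 1:] * (p - pderiv p)) x) (at x)"
      using 2 by (auto simp: poly_bump_def)
    moreover have "\<forall>\<^sub>F y in nhds x. 0 = poly_bump p y"
      using eventually_nhds_in_open[of "{..<0}" x] 2 by (auto elim!: eventually_mono simp: poly_bump_def)
    ultimately show ?thesis by (subst DERIV_cong_ev[OF refl _ refl, symmetric])
  next
    case 3
    have "((\<lambda>y. poly_bump p y / y) \<longlongrightarrow> 0) (at_right 0)"
    proof -
      have "((\<lambda>t. poly ([:0, 1:] * p) t * exp (- t)) \<longlongrightarrow> 0) at_top" by (rule poly_times_exp_minus_tendsto_0)
      then have "((\<lambda>y. poly ([:0, 1:] * p) (inverse y) * exp (- inverse y)) \<longlongrightarrow> 0) (at_right 0)"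
        using filterlim_compose filterlim_inverse_at_top_right by blast
      then show ?thesis
        by (rule Lim_transform_eventually) (auto simp: eventually_at_filter poly_bump_def field_simps)
    qed
    moreover have "((\<lambda>y. poly_bump p y / y) \<longlongrightarrow> 0) (at_left 0)"
      by (rule Lim_transform_eventually[OF tendsto_const]) (auto simp: eventually_at_filter poly_bump_def)
    ultimately have "((\<lambda>y. poly_bump p y / y) \<longlongrightarrow> 0) (at 0)" by (rule filterlim_split_at[rotated])
    then show ?thesis using 3 by (simp add: has_field_derivative_iff poly_bump_def)
  qed
qed

lemma smooth_poly_bump: "smooth (\<lambda>x. of_real (poly_bump p x))"
proof (rule smooth_coinduct[where P = "range (\<lambda>p x. of_real (poly_bump p x))"])
  fix g :: "real \<Rightarrow> complex" assume "g \<in> range (\<lambda>p x. of_real (poly_bump p x))"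
  then obtain p where g: "g = (\<lambda>x. of_real (poly_bump p x))" by blast
  have "(g has_vector_derivative of_real (poly_bump ([:0, 0, 1:] * (p - pderiv p)) x)) (at x)" for x
    unfolding g by (rule has_vector_derivative_of_real)
      (rule poly_bump_deriv)
  then show "\<exists>g'\<in>range (\<lambda>p x. of_real (poly_bump p x)). \<forall>x. (g has_vector_derivative g' x) (at x)"
    by (intro bexI[of _ "\<lambda>x. of_real (poly_bump ([:0, 0, 1:] * (p - pderiv p)) x)"]) blast+
qed blast

lemma poly_bump_bounds: "0 \<le> poly_bump 1 x" "poly_bump 1 x \<le> 1"
  by (auto simp: poly_bump_def)

text \<open>
  The shift by \<open>1\<close> keeps the support in the closed interval from \<open>a + 1 / n\<close> to \<open>b - 1 / n\<close>, so that even \<open>a = 0\<close> and \<open>b = l\<close> give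
  test functions on the edge; for \<open>n\<close> tending to infinity both factors tend to \<open>1\<close> inside.
\<close>

definition cutoff :: "real \<Rightarrow> real \<Rightarrow> nat \<Rightarrow> real \<Rightarrow> real" where
  "cutoff a b n x = poly_bump 1 (real n * (x - a) - 1) * poly_bump 1 (real n * (b - x) - 1)"

lemma cutoff_eq_0: "n > 0 \<Longrightarrow> x \<notin> {a + 1 / n .. b - 1 / n} \<Longrightarrow> cutoff a b n x = 0"
  by (auto simp: cutoff_def poly_bump_def field_simps)

lemma cutoff_test:
  assumes "0 \<le> a" "b \<le> l" "n > 0" shows "(\<lambda>x. complex_of_real (cutoff a b n x)) \<in> test_functions l"
proof -
  have 1: "smooth (\<lambda>x. of_real (poly_bump 1 (real n * x + (- real n * a - 1))))"
    by (rule smooth_affine[OF smooth_poly_bump])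
  have 2: "smooth (\<lambda>x. of_real (poly_bump 1 ((- real n) * x + (real n * b - 1))))"
    by (rule smooth_affine[OF smooth_poly_bump])
  have "smooth (\<lambda>x. complex_of_real (cutoff a b n x))"
    using smooth_mult[OF 1 2] by (simp add: cutoff_def algebra_simps)
  moreover have sub: "closure {x. complex_of_real (cutoff a b n x) \<noteq> 0} \<subseteq> {a + 1 / n .. b - 1 / n}"
    using cutoff_eq_0[OF assms(3), of _ a b] by (intro closure_minimal) (auto simp del: atLeastAtMost_iff)
  moreover have "compact (closure {x. complex_of_real (cutoff a b n x) \<noteq> 0})"
    using compact_Int_closed[OF compact_Icc closed_closure] sub by (metis inf.absorb2)
  moreover have "{a + 1 / n .. b - 1 / n} \<subseteq> {0<..<l}"
  proof
    fix x assume "x \<in> {a + 1 / real n..b - 1 / real n}"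
    moreover have "1 / real n > 0" using assms(3) by simp
    ultimately show "x \<in> {0<..<l}" using assms unfolding atLeastAtMost_iff greaterThanLessThan_iff by linarith
  qed
  ultimately show ?thesis by (auto simp: test_functions_def)
qed

lemma poly_bump_1_tendsto:
  assumes "c > 0" shows "(\<lambda>n. poly_bump 1 (real n * c - 1)) \<longlonglongrightarrow> 1"
proof -
  have lim: "filterlim (\<lambda>n. real n * c - 1) at_top sequentially"
    using assms by real_asymp
  then have "(\<lambda>n. exp (- (1 / (real n * c - 1)))) \<longlonglongrightarrow> exp (- 0)"
    by (intro tendsto_intros tendsto_divide_0[OF tendsto_const] filterlim_at_top_imp_at_infinity)
  moreover have "\<forall>\<^sub>F n in sequentially. real n * c - 1 > 0"
    using lim unfolding filterlim_at_top_dense by blast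
  ultimately show ?thesis
    by (auto intro: Lim_transform_eventually elim!: eventually_mono simp: poly_bump_def)
qed

lemma cutoff_tendsto:
  "(\<lambda>n. cutoff a b n x) \<longlonglongrightarrow> indicat_real {a<..<b} x"
proof (cases "x \<in> {a<..<b}")
  case True
  have "(\<lambda>n. poly_bump 1 (real n * (x - a) - 1) * poly_bump 1 (real n * (b - x) - 1)) \<longlonglongrightarrow> 1 * 1"
    using True by (intro tendsto_mult poly_bump_1_tendsto) auto
  then show ?thesis using True by (simp add: cutoff_def)
next
  case False
  have "cutoff a b n x = 0" for n
  proof (cases "n = 0")
    case True
    then show ?thesis by (simp add: cutoff_def poly_bump_def)
  next
    case f: False
    have "1 / real n > 0" using f by simp
    then have "x \<notin> {a + 1 / n .. b - 1 / n}"
      using False unfolding atLeastAtMost_iff greaterThanLessThan_iff by linarith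
    then show ?thesis using f by (intro cutoff_eq_0) auto
  qed
  then show ?thesis using False by simp
qed

text \<open>
  Open intervals are an intersection-stable generator of the Borel sets, and Lebesgue sets
  differ from Borel sets by null sets.
\<close>

lemma AE_zero_if_interval_integrals_zero:
  fixes v :: "real \<Rightarrow> complex"
  assumes int: "integrable lebesgue v"
    and zero: "\<And>a b. (LINT x|lebesgue. indicat_real {a<..<b} x *\<^sub>R v x) = 0"
    and supp: "\<And>x. v x \<noteq> 0 \<Longrightarrow> x \<in> {c<..<d}"
  shows "AE x in lebesgue. v x = 0"
proof -
  have gen_borel: "sets (borel :: real measure) = sigma_sets UNIV (range (\<lambda>(a, b). {a<..<b}))"
    by (subst borel_eq_box[where 'a = real]) (simp add: box_real sets_measure_of case_prod_unfold)
  have borel: "set_lebesgue_integral lebesgue A v = 0" if "A \<in> sets borel" for A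
  proof -
    let ?G = "range (\<lambda>(a::real, b). {a<..<b})"
    have gen: "A \<in> sigma_sets UNIV ?G" using that by (simp only: gen_borel)
    have leb: "A \<in> sets lebesgue" if "A \<in> sigma_sets UNIV ?G" for A
    proof -
      have "A \<in> sets borel" using that by (simp only: gen_borel)
      then show ?thesis by (auto intro: sets_completionI_sets)
    qed
    have total: "integral\<^sup>L lebesgue v = 0"
    proof -
      have "(\<lambda>x. indicat_real {c<..<d} x *\<^sub>R v x) = v" using supp by (fastforce simp: indicator_def)
      then show ?thesis using zero[of c d] by simp
    qed
    have si: "set_integrable lebesgue A v" if "A \<in> sigma_sets UNIV ?G" for A
      using leb[OF that] int unfolding set_integrable_def by (rule integrable_mult_indicator)
    have "Int_stable ?G"
    proof (rule Int_stableI, clarify)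
      fix a b a' b' :: real
      have "{a<..<b} \<inter> {a'<..<b'} = {max a a'<..<min b b'}" by auto
      then show "{a<..<b} \<inter> {a'<..<b'} \<in> ?G" by auto
    qed
    moreover have "?G \<subseteq> Pow UNIV" by simp
    ultimately show ?thesis using gen
    proof (induction rule: sigma_sets_induct_disjoint)
      case (basic A)
      then show ?case using zero by (auto simp: set_lebesgue_integral_def)
    next
      case empty
      then show ?case by (simp add: set_lebesgue_integral_def)
    next
      case (compl A)
      have "set_lebesgue_integral lebesgue (UNIV - A) v = integral\<^sup>L lebesgue v - set_lebesgue_integral lebesgue A v"
      proof -
        have "(\<lambda>x. indicat_real (UNIV - A) x *\<^sub>R v x) = (\<lambda>x. v x - indicat_real A x *\<^sub>R v x)"
          by (auto simp: indicator_def)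
        then show ?thesis using int si[OF compl(1)]
          unfolding set_lebesgue_integral_def set_integrable_def by simp
      qed
      then show ?case using total compl by simp
    next
      case (union A)
      have A: "\<And>i. A i \<in> sigma_sets UNIV ?G" using union(2) by auto
      then have "(\<Union>i. A i) \<in> sigma_sets UNIV ?G" by (rule sigma_sets.Union)
      then have "set_lebesgue_integral lebesgue (\<Union>i. A i) v = (\<Sum>i. set_lebesgue_integral lebesgue (A i) v)"
        using union(1) leb[OF A] si by (intro lebesgue_integral_countable_add) (auto simp: disjoint_family_on_def)
      then show ?case using union by simp
    qed
  qed
  have leb: "set_lebesgue_integral lebesgue A v = 0" if A: "A \<in> sets lebesgue" for A
  proof -
    obtain N where N: "N \<in> null_sets lborel" "null_part lborel A \<subseteq> N" using null_part[OF A] by blast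
    have "AE x in lborel. x \<notin> N" using N(1) by (rule AE_not_in)
    then have "AE x in lebesgue. x \<notin> N" by (rule AE_completion)
    then have "AE x in lebesgue. indicat_real A x *\<^sub>R v x = indicat_real (main_part lborel A) x *\<^sub>R v x"
    proof eventually_elim
      case (elim x)
      then show ?case using main_part_null_part_Un[OF A] N(2) by (auto simp: indicator_def)
    qed
    moreover have mp: "main_part lborel A \<in> sets borel" using main_part_sets[OF A] by simp
    then have "main_part lborel A \<in> sets lebesgue" by (auto intro: sets_completionI_sets)
    ultimately have "set_lebesgue_integral lebesgue A v = set_lebesgue_integral lebesgue (main_part lborel A) v"
      unfolding set_lebesgue_integral_def using A int
      by (intro integral_cong_AE borel_measurable_integrable[OF integrable_mult_indicator]) auto
    then show ?thesis using borel[OF mp] by simp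
  qed
  interpret M: finite_measure "lebesgue_on {c<..<d}"
    by (rule finite_measure_lebesgue_on) auto
  have supp': "indicat_real {c<..<d} x *\<^sub>R v x = v x" for x using supp[of x] by (auto simp: indicator_def)
  have supp'': "(indicat_real {c<..<d} x * a) *\<^sub>R v x = a *\<^sub>R v x" for a x
    by (metis mult.commute scaleR_scaleR supp')
  have "AE x in lebesgue_on {c<..<d}. v x = 0"
  proof (rule M.density_zero)
    show "integrable (lebesgue_on {c<..<d}) v"
      using int by (simp add: integrable_restrict_space supp')
    fix A assume "A \<in> sets (lebesgue_on {c<..<d})"
    then have "A \<in> sets lebesgue" by (simp add: sets_restrict_space_iff)
    moreover have "set_lebesgue_integral (lebesgue_on {c<..<d}) A v = set_lebesgue_integral lebesgue A v"
      unfolding set_lebesgue_integral_def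
      by (simp add: integral_restrict_space supp'')
    ultimately show "set_lebesgue_integral (lebesgue_on {c<..<d}) A v = 0" using leb by simp
  qed
  then show ?thesis
    by (simp add: AE_restrict_space_iff) (auto elim!: eventually_mono dest: supp)
qed

text \<open>
  The fundamental lemma of the calculus of variations: the cutoff functions approximate
  indicators of intervals boundedly, which reduces the claim to integrals over intervals.
\<close>

lemma AE_zero_if_test_integrals_zero:
  fixes v :: "real \<Rightarrow> complex"
  assumes int: "integrable (lebesgue_on {0<..<l}) v"
    and zero: "\<And>f. f \<in> test_functions l \<Longrightarrow> (LINT x|lebesgue_on {0<..<l}. f x * v x) = 0"
  shows "AE x in lebesgue_on {0<..<l}. v x = 0"
proof -
  let ?M = "lebesgue_on {0<..<l}"
  define w where "w x = indicat_real {0<..<l} x *\<^sub>R v x" for x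
  have w_int: "integrable lebesgue w" unfolding w_def using int by (simp add: integrable_restrict_space)
  have "(LINT x|lebesgue. indicat_real {a<..<b} x *\<^sub>R w x) = 0" for a b
  proof -
    let ?a = "max a 0" and ?b = "min b l"
    have lim: "(\<lambda>n. LINT x|?M. of_real (cutoff ?a ?b (Suc n) x) * v x)
        \<longlonglongrightarrow> (LINT x|?M. of_real (indicat_real {?a<..<?b} x) * v x)"
    proof (rule integral_dominated_convergence[where w = "\<lambda>x. cmod (v x)"])
      have "continuous_on UNIV (\<lambda>x. complex_of_real (cutoff ?a ?b (Suc n) x))" for n
        using cutoff_test[of ?a ?b l "Suc n"] by (intro smooth_continuous) (simp add: test_functions_def)
      then have m: "(\<lambda>x. complex_of_real (cutoff ?a ?b (Suc n) x)) \<in> borel_measurable ?M" for n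
        by (intro continuous_imp_measurable_on_sets_lebesgue) (auto intro: continuous_on_subset)
      show "(\<lambda>x. of_real (cutoff ?a ?b (Suc n) x) * v x) \<in> borel_measurable ?M" for n
        using m[of n] int by measurable
      have "(\<lambda>x. complex_of_real (indicat_real {?a<..<?b} x)) \<in> borel_measurable ?M"
        by (rule measurable_restrict_space1) (auto intro!: measurable_completion)
      then show "(\<lambda>x. of_real (indicat_real {?a<..<?b} x) * v x) \<in> borel_measurable ?M"
        using int by measurable
      show "integrable ?M (\<lambda>x. cmod (v x))" using int by (rule integrable_norm)
      show "AE x in ?M. (\<lambda>n. of_real (cutoff ?a ?b (Suc n) x) * v x) \<longlonglongrightarrow> of_real (indicat_real {?a<..<?b} x) * v x"
        by (intro AE_I2 tendsto_intros LIMSEQ_Suc cutoff_tendsto)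
      show "AE x in ?M. cmod (of_real (cutoff ?a ?b (Suc n) x) * v x) \<le> cmod (v x)" for n
      proof (rule AE_I2)
        fix x
        have "\<bar>cutoff ?a ?b (Suc n) x\<bar> \<le> 1"
          unfolding cutoff_def using poly_bump_bounds by (simp add: abs_mult mult_le_one)
        then show "cmod (of_real (cutoff ?a ?b (Suc n) x) * v x) \<le> cmod (v x)"
          by (simp add: norm_mult mult_left_le_one_le)
      qed
    qed
    have "(LINT x|?M. of_real (cutoff ?a ?b (Suc n) x) * v x) = 0" for n
      using zero[OF cutoff_test[of ?a ?b l "Suc n"]] by simp
    then have "(LINT x|?M. of_real (indicat_real {?a<..<?b} x) * v x) = 0"
      using lim LIMSEQ_unique[OF tendsto_const] by fastforce
    moreover have "(LINT x|?M. of_real (indicat_real {?a<..<?b} x) * v x)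
       = (LINT x|lebesgue. indicat_real {a<..<b} x *\<^sub>R w x)"
      unfolding integral_restrict_space[of "{0<..<l}" lebesgue, simplified]
      by (rule Bochner_Integration.integral_cong) (auto simp: w_def indicator_def)
    ultimately show ?thesis by simp
  qed
  then have "AE x in lebesgue. w x = 0"
    by (rule AE_zero_if_interval_integrals_zero[OF w_int, where c = 0 and d = l])
      (auto simp: w_def indicator_def split: if_splits)
  then show ?thesis
    by (subst AE_restrict_space_iff) (auto simp: w_def indicator_def elim!: eventually_mono)
qed

section \<open>Classical solutions of the eigenvalue equation\<close>

text \<open>
  The solutions of \<open>- y'' = \<mu> y\<close> with Cauchy data \<open>(0, 1)\<close> and \<open>(1, 0)\<close> at \<open>0\<close>.
\<close>

definition sn :: "real \<Rightarrow> real \<Rightarrow> real" where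
  "sn \<mu> x = (if \<mu> = 0 then x else if \<mu> > 0 then sin (sqrt \<mu> * x) / sqrt \<mu> else sinh (sqrt (- \<mu>) * x) / sqrt (- \<mu>))"

definition cs :: "real \<Rightarrow> real \<Rightarrow> real" where
  "cs \<mu> x = (if \<mu> = 0 then 1 else if \<mu> > 0 then cos (sqrt \<mu> * x) else cosh (sqrt (- \<mu>) * x))"

lemma sn_0 [simp]: "sn \<mu> 0 = 0" and cs_0 [simp]: "cs \<mu> 0 = 1"
  by (auto simp: sn_def cs_def)

lemma sn_deriv: "(sn \<mu> has_real_derivative cs \<mu> x) (at x)"
proof -
  consider "\<mu> = 0" | "\<mu> > 0" | "\<mu> < 0" by linarith
  then show ?thesis
    by cases (auto simp: sn_def[abs_def] cs_def mult.assoc intro!: derivative_eq_intros)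
qed

lemma cs_deriv: "(cs \<mu> has_real_derivative - \<mu> * sn \<mu> x) (at x)"
proof -
  consider "\<mu> = 0" | "\<mu> > 0" | "\<mu> < 0" by linarith
  then show ?thesis
  proof cases
    case 1
    then show ?thesis by (simp add: cs_def[abs_def])
  next
    case 2
    define r where "r = sqrt \<mu>"
    have r: "\<mu> = r * r" "r \<noteq> 0" using 2 by (auto simp: r_def)
    have "((\<lambda>x. cos (r * x)) has_real_derivative - (sin (r * x) * r)) (at x)"
      by (auto intro!: derivative_eq_intros)
    moreover have "cs \<mu> = (\<lambda>x. cos (r * x))" using 2 by (auto simp: cs_def r_def)
    moreover have "- \<mu> * sn \<mu> x = - (sin (r * x) * r)"
    proof -
      have "sn \<mu> x = sin (r * x) / r" using 2 by (simp add: sn_def r_def)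
      then show ?thesis using r(2) by (simp add: r(1))
    qed
    ultimately show ?thesis by simp
  next
    case 3
    define r where "r = sqrt (- \<mu>)"
    have r: "- \<mu> = r * r" "r \<noteq> 0" using 3 by (auto simp: r_def)
    have "((\<lambda>x. cosh (r * x)) has_real_derivative sinh (r * x) * r) (at x)"
      by (auto intro!: derivative_eq_intros)
    moreover have "cs \<mu> = (\<lambda>x. cosh (r * x))" using 3 by (auto simp: cs_def r_def)
    moreover have "- \<mu> * sn \<mu> x = sinh (r * x) * r"
    proof -
      have "sn \<mu> x = sinh (r * x) / r" using 3 by (simp add: sn_def r_def)
      then show ?thesis using r(2) by (simp add: r(1))
    qed
    ultimately show ?thesis by simp
  qed
qed

text \<open>
  The addition theorem splits the kernel of the initial value problem into products of
  solutions.
\<close>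

lemma sn_diff: "sn \<mu> (x - y) = sn \<mu> x * cs \<mu> y - cs \<mu> x * sn \<mu> y"
  by (auto simp: sn_def cs_def right_diff_distrib sin_diff sinh_diff diff_divide_distrib)

lemma cs_sn_pythagoras: "(cs \<mu> x)\<^sup>2 + \<mu> * (sn \<mu> x)\<^sup>2 = 1"
proof -
  consider "\<mu> = 0" | "\<mu> > 0" | "\<mu> < 0" by linarith
  then show ?thesis
  proof cases
    case 1
    then show ?thesis by (simp add: cs_def)
  next
    case 2
    have "\<mu> * (sn \<mu> x)\<^sup>2 = (sin (sqrt \<mu> * x))\<^sup>2"
      using 2 by (simp add: sn_def power_divide del: sin_squared_eq)
    moreover have "(cs \<mu> x)\<^sup>2 = (cos (sqrt \<mu> * x))\<^sup>2" using 2 by (simp add: cs_def)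
    ultimately show ?thesis by (metis sin_cos_squared_add2)
  next
    case 3
    have "\<mu> * (sn \<mu> x)\<^sup>2 = - (sinh (sqrt (- \<mu>) * x))\<^sup>2"
      using 3 by (simp add: sn_def power_divide)
    moreover have "(cs \<mu> x)\<^sup>2 = (cosh (sqrt (- \<mu>) * x))\<^sup>2" using 3 by (simp add: cs_def)
    ultimately show ?thesis using hyperbolic_pythagoras[of "sqrt (- \<mu>) * x"] by linarith
  qed
qed

lemma sn_continuous: "continuous_on A (sn \<mu>)" and cs_continuous: "continuous_on A (cs \<mu>)"
  by (intro continuous_at_imp_continuous_on ballI DERIV_isCont[OF sn_deriv] DERIV_isCont[OF cs_deriv])+

lemma sn_vderiv: "((\<lambda>x. complex_of_real (sn \<mu> x)) has_vector_derivative of_real (cs \<mu> x)) (at x)"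
  and cs_vderiv: "((\<lambda>x. complex_of_real (cs \<mu> x)) has_vector_derivative of_real (- \<mu> * sn \<mu> x)) (at x)"
  by (intro has_vector_derivative_of_real sn_deriv cs_deriv)+

lemma smooth_solution: "smooth (\<lambda>x. a * of_real (cs \<mu> x) + b * of_real (sn \<mu> x))"
proof (rule smooth_coinduct[where P = "{\<lambda>x. a * of_real (cs \<mu> x) + b * of_real (sn \<mu> x) | a b. True}"])
  fix g assume "g \<in> {\<lambda>x. a * complex_of_real (cs \<mu> x) + b * of_real (sn \<mu> x) | a b. True}"
  then obtain a b where g: "g = (\<lambda>x. a * of_real (cs \<mu> x) + b * of_real (sn \<mu> x))" by blast
  have "(g has_vector_derivative b * of_real (cs \<mu> x) + (- a * of_real \<mu>) * of_real (sn \<mu> x)) (at x)" for x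
    unfolding g
    by (rule has_vector_derivative_eq_rhs[OF has_vector_derivative_add[OF
          has_vector_derivative_mult_right[OF cs_vderiv] has_vector_derivative_mult_right[OF sn_vderiv]]]) simp
  then show "\<exists>g'\<in>{\<lambda>x. a * complex_of_real (cs \<mu> x) + b * of_real (sn \<mu> x) | a b. True}.
      \<forall>x. (g has_vector_derivative g' x) (at x)"
    by (intro bexI[of _ "\<lambda>x. b * of_real (cs \<mu> x) + (- a * of_real \<mu>) * of_real (sn \<mu> x)"]) blast+
qed blast

lemma smooth_cs: "smooth (\<lambda>x. of_real (cs \<mu> x))" and smooth_sn: "smooth (\<lambda>x. of_real (sn \<mu> x))"
  using smooth_solution[of 1 \<mu> 0] smooth_solution[of 0 \<mu> 1] by simp_all

section \<open>Square-integrable functions on an edge\<close>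

abbreviation edge_measure :: "real \<Rightarrow> real measure" where
  "edge_measure l \<equiv> lebesgue_on {0<..<l}"

lemma finite_edge_measure: "finite_measure (edge_measure l)"
  by (rule finite_measure_lebesgue_on) auto

lemma L2_iff: "f \<in> L2_interval l \<longleftrightarrow> f \<in> borel_measurable (edge_measure l) \<and>
    integrable (edge_measure l) (\<lambda>x. (cmod (f x))\<^sup>2)"
  by (simp add: L2_interval_def)

lemma L2_mult_integrable:
  assumes "f \<in> L2_interval l" "g \<in> L2_interval l"
  shows "integrable (edge_measure l) (\<lambda>x. cnj (f x) * g x)"
proof (rule Bochner_Integration.integrable_bound)
  show "integrable (edge_measure l) (\<lambda>x. (cmod (f x))\<^sup>2 + (cmod (g x))\<^sup>2)"
    using assms by (auto simp: L2_iff)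
  have [measurable]: "f \<in> borel_measurable (edge_measure l)" "g \<in> borel_measurable (edge_measure l)"
    using assms by (auto simp: L2_iff)
  show "(\<lambda>x. cnj (f x) * g x) \<in> borel_measurable (edge_measure l)"
    by (intro borel_measurable_times borel_measurable_continuous_on[of cnj]) (auto intro: continuous_intros)
  have "cmod (f x) * cmod (g x) \<le> (cmod (f x))\<^sup>2 + (cmod (g x))\<^sup>2" for x
  proof -
    have "0 \<le> cmod (f x) * cmod (g x)" by simp
    then show ?thesis using sum_squares_bound[of "cmod (f x)" "cmod (g x)"] by linarith
  qed
  then show "AE x in edge_measure l. norm (cnj (f x) * g x) \<le> norm ((cmod (f x))\<^sup>2 + (cmod (g x))\<^sup>2)"
    by (auto simp: norm_mult)
qed

lemma L2_scale: "f \<in> L2_interval l \<Longrightarrow> (\<lambda>x. c * f x) \<in> L2_interval l"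
  by (auto simp: L2_iff norm_mult power_mult_distrib)

lemma L2_add:
  assumes "f \<in> L2_interval l" "g \<in> L2_interval l" shows "(\<lambda>x. f x + g x) \<in> L2_interval l"
proof -
  have m: "f \<in> borel_measurable (edge_measure l)" "g \<in> borel_measurable (edge_measure l)"
    using assms by (auto simp: L2_iff)
  have "integrable (edge_measure l) (\<lambda>x. (cmod (f x + g x))\<^sup>2)"
  proof (rule Bochner_Integration.integrable_bound)
    show "integrable (edge_measure l) (\<lambda>x. 2 * (cmod (f x))\<^sup>2 + 2 * (cmod (g x))\<^sup>2)"
      using assms by (auto simp: L2_iff)
    show "(\<lambda>x. (cmod (f x + g x))\<^sup>2) \<in> borel_measurable (edge_measure l)" using m by measurable
    have "(cmod (f x + g x))\<^sup>2 \<le> 2 * (cmod (f x))\<^sup>2 + 2 * (cmod (g x))\<^sup>2" for x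
    proof -
      have "(cmod (f x + g x))\<^sup>2 \<le> (cmod (f x) + cmod (g x))\<^sup>2"
        by (intro power_mono norm_triangle_ineq) auto
      also have "\<dots> \<le> 2 * (cmod (f x))\<^sup>2 + 2 * (cmod (g x))\<^sup>2"
        using sum_squares_bound[of "cmod (f x)" "cmod (g x)"] by (simp add: power2_sum)
      finally show ?thesis .
    qed
    then show "AE x in edge_measure l. norm ((cmod (f x + g x))\<^sup>2) \<le> norm (2 * (cmod (f x))\<^sup>2 + 2 * (cmod (g x))\<^sup>2)"
      by auto
  qed
  then show ?thesis using m by (auto simp: L2_iff)
qed

lemma L2_bounded:
  assumes "f \<in> borel_measurable (edge_measure l)" "\<And>x. 0 < x \<Longrightarrow> x < l \<Longrightarrow> cmod (f x) \<le> B"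
  shows "f \<in> L2_interval l"
proof -
  interpret finite_measure "edge_measure l" by (rule finite_edge_measure)
  have "integrable (edge_measure l) (\<lambda>x. (cmod (f x))\<^sup>2)"
  proof (rule integrable_const_bound[of _ "B\<^sup>2"])
    show "AE x in edge_measure l. norm ((cmod (f x))\<^sup>2) \<le> B\<^sup>2"
      using assms(2) by (intro AE_I2) (auto intro!: power_mono)
  qed (use assms(1) in measurable)
  then show ?thesis using assms(1) by (simp add: L2_iff)
qed

lemma L2_continuous:
  assumes "continuous_on {0..l} f" shows "f \<in> L2_interval l"
proof -
  have "bounded (f ` {0..l})" using assms by (intro compact_imp_bounded compact_continuous_image) auto
  then obtain B where "\<forall>x\<in>{0..l}. cmod (f x) \<le> B" by (auto simp: bounded_iff)
  moreover have "f \<in> borel_measurable (edge_measure l)"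
    by (intro continuous_imp_measurable_on_sets_lebesgue continuous_on_subset[OF assms]) auto
  ultimately show ?thesis by (intro L2_bounded[of f l B]) auto
qed

lemma L2_integrable:
  assumes "f \<in> L2_interval l" shows "integrable (edge_measure l) f"
  using L2_mult_integrable[OF L2_continuous assms, of "\<lambda>_. 1"] by simp

lemma L2_cauchy_schwarz:
  assumes "f \<in> L2_interval l" "g \<in> L2_interval l"
  shows "(cmod (LINT x|edge_measure l. cnj (f x) * g x))\<^sup>2
    \<le> (LINT x|edge_measure l. (cmod (f x))\<^sup>2) * (LINT x|edge_measure l. (cmod (g x))\<^sup>2)"
proof (rule cauchy_schwarz_from_quadratic)
  fix t :: complex
  let ?M = "edge_measure l"
  note int = L2_mult_integrable[OF assms]
  have i2: "integrable ?M (\<lambda>x. (cmod (f x))\<^sup>2)" "integrable ?M (\<lambda>x. (cmod (g x))\<^sup>2)"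
    using assms by (auto simp: L2_iff)
  have pt: "(cmod (f x + t * g x))\<^sup>2 = (cmod (f x))\<^sup>2 + 2 * Re (t * (cnj (f x) * g x)) + (cmod t)\<^sup>2 * (cmod (g x))\<^sup>2" for x
    unfolding cmod_power2 by (simp add: power2_eq_square algebra_simps)
  have "0 \<le> (LINT x|?M. (cmod (f x + t * g x))\<^sup>2)" by (rule integral_nonneg_AE) auto
  also have "\<dots> = (LINT x|?M. (cmod (f x))\<^sup>2) + 2 * Re (t * (LINT x|?M. cnj (f x) * g x))
      + (cmod t)\<^sup>2 * (LINT x|?M. (cmod (g x))\<^sup>2)"
    unfolding pt using int i2
    by (simp add: integral_Re[symmetric] del: Re_complex_of_real times_complex.sel)
  finally show "0 \<le> (LINT x|?M. (cmod (f x))\<^sup>2) + 2 * Re (t * (LINT x|?M. cnj (f x) * g x))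
      + (cmod t)\<^sup>2 * (LINT x|?M. (cmod (g x))\<^sup>2)" .
qed

section \<open>Integral operators with a bounded kernel\<close>

definition kernel_op :: "real \<Rightarrow> (real \<Rightarrow> real \<Rightarrow> real) \<Rightarrow> (real \<Rightarrow> complex) \<Rightarrow> real \<Rightarrow> complex" where
  "kernel_op l k f x = (LINT y|edge_measure l. of_real (k x y) * f y)"

locale bounded_kernel =
  fixes l :: real and k :: "real \<Rightarrow> real \<Rightarrow> real" and B :: real
  assumes cont: "continuous_on UNIV (\<lambda>(x, y). k x y)"
    and bound: "\<And>x y. 0 < x \<Longrightarrow> x < l \<Longrightarrow> 0 < y \<Longrightarrow> y < l \<Longrightarrow> \<bar>k x y\<bar> \<le> B"
    and l_pos: "0 < l"
begin

lemma B_nonneg: "0 \<le> B"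
  using bound[of "l/2" "l/2"] l_pos abs_ge_zero[of "k (l/2) (l/2)"] by linarith

lemma id_measurable: "(\<lambda>x. x) \<in> measurable (edge_measure l) borel"
  by (rule measurable_restrict_space1) (auto intro!: measurable_completion)

lemma kernel_measurable:
  "(\<lambda>p. complex_of_real (k (fst p) (snd p))) \<in> borel_measurable (edge_measure l \<Otimes>\<^sub>M edge_measure l)"
proof -
  have "(\<lambda>p. (fst p, snd p)) \<in> measurable (edge_measure l \<Otimes>\<^sub>M edge_measure l) (borel \<Otimes>\<^sub>M borel)"
    by (intro measurable_Pair measurable_compose[OF measurable_fst id_measurable]
        measurable_compose[OF measurable_snd id_measurable])
  then have 1: "(\<lambda>p. (fst p, snd p)) \<in> measurable (edge_measure l \<Otimes>\<^sub>M edge_measure l) borel"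
    by (simp add: borel_prod)
  have "(\<lambda>(x, y). k x y) \<in> borel_measurable borel"
    using cont by (rule borel_measurable_continuous_onI)
  from measurable_compose[OF 1 this] show ?thesis by (simp add: borel_measurable_of_real)
qed

lemma section_measurable: "(\<lambda>y. complex_of_real (k x y)) \<in> borel_measurable (edge_measure l)"
proof -
  have "continuous_on UNIV (\<lambda>y. k x y)"
  proof -
    have "continuous_on UNIV (\<lambda>y. (x, y))"
      by (intro continuous_on_Pair continuous_on_const continuous_on_id)
    from continuous_on_compose2[OF cont this] show ?thesis by simp
  qed
  then show ?thesis
    by (intro continuous_imp_measurable_on_sets_lebesgue) (auto intro!: continuous_intros intro: continuous_on_subset)
qed

lemma section_integrable:
  assumes "f \<in> L2_interval l" "0 < x" "x < l"
  shows "integrable (edge_measure l) (\<lambda>y. of_real (k x y) * f y)"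
proof (rule Bochner_Integration.integrable_bound)
  show "integrable (edge_measure l) (\<lambda>y. B * cmod (f y))"
    using L2_integrable[OF assms(1)] by auto
  show "(\<lambda>y. of_real (k x y) * f y) \<in> borel_measurable (edge_measure l)"
    using assms(1) section_measurable by (intro borel_measurable_times) (auto simp: L2_iff)
  show "AE y in edge_measure l. norm (of_real (k x y) * f y) \<le> norm (B * cmod (f y))"
    using bound[OF assms(2,3)] B_nonneg by (intro AE_I2) (auto simp: norm_mult abs_mult intro!: mult_right_mono)
qed

lemma kernel_op_bound:
  assumes f: "f \<in> L2_interval l" and x: "0 < x" "x < l"
  shows "cmod (kernel_op l k f x) \<le> B * sqrt l * sqrt (LINT y|edge_measure l. (cmod (f y))\<^sup>2)"
proof -
  let ?M = "edge_measure l"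
  have fa: "(\<lambda>y. complex_of_real (cmod (f y))) \<in> L2_interval l" using f by (auto simp: L2_iff)
  have "(cmod (LINT y|?M. cnj 1 * complex_of_real (cmod (f y))))\<^sup>2
     \<le> (LINT y|?M. (cmod 1)\<^sup>2) * (LINT y|?M. (cmod (complex_of_real (cmod (f y))))\<^sup>2)"
    by (rule L2_cauchy_schwarz[OF L2_continuous fa]) auto
  also have "(LINT y|?M. (cmod 1)\<^sup>2) = l" using l_pos by (simp add: measure_restrict_space)
  finally have "(LINT y|?M. cmod (f y))\<^sup>2 \<le> l * (LINT y|?M. (cmod (f y))\<^sup>2)" by simp
  then have L1: "(LINT y|?M. cmod (f y)) \<le> sqrt l * sqrt (LINT y|?M. (cmod (f y))\<^sup>2)"
    by (metis real_le_rsqrt real_sqrt_mult)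
  have "cmod (kernel_op l k f x) \<le> (LINT y|?M. norm (of_real (k x y) * f y))"
    unfolding kernel_op_def by (rule integral_norm_bound)
  also have "\<dots> \<le> (LINT y|?M. B * cmod (f y))"
  proof (rule integral_mono)
    show "integrable ?M (\<lambda>y. norm (of_real (k x y) * f y))" using section_integrable[OF assms] by simp
    show "integrable ?M (\<lambda>y. B * cmod (f y))" using L2_integrable[OF f] by auto
    show "norm (of_real (k x y) * f y) \<le> B * cmod (f y)" if "y \<in> space ?M" for y
      using bound[OF x, of y] that by (auto simp: norm_mult intro!: mult_right_mono)
  qed
  also have "\<dots> = B * (LINT y|?M. cmod (f y))" by simp
  also have "\<dots> \<le> B * (sqrt l * sqrt (LINT y|?M. (cmod (f y))\<^sup>2))"
    using L1 B_nonneg by (rule mult_left_mono)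
  finally show ?thesis by simp
qed

lemma kernel_op_L2:
  assumes f: "f \<in> L2_interval l" shows "kernel_op l k f \<in> L2_interval l"
proof -
  let ?M = "edge_measure l"
  interpret M: finite_measure ?M by (rule finite_edge_measure)
  have [measurable]: "f \<in> borel_measurable ?M" using f by (simp add: L2_iff)
  have "(\<lambda>x. LINT y|?M. of_real (k x y) * f y) \<in> borel_measurable ?M"
  proof (rule M.borel_measurable_lebesgue_integral)
    have "(\<lambda>p. complex_of_real (k (fst p) (snd p)) * f (snd p)) \<in> borel_measurable (?M \<Otimes>\<^sub>M ?M)"
      by (rule borel_measurable_times[OF kernel_measurable]) measurable
    then show "(\<lambda>(x, y). complex_of_real (k x y) * f y) \<in> borel_measurable (?M \<Otimes>\<^sub>M ?M)"
      by (simp add: case_prod_unfold)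
  qed
  then show ?thesis using kernel_op_bound[OF f] by (intro L2_bounded) (auto simp: kernel_op_def[abs_def])
qed

lemma kernel_op_norm:
  assumes f: "f \<in> L2_interval l"
  shows "(LINT x|edge_measure l. (cmod (kernel_op l k f x))\<^sup>2) \<le> (B * l)\<^sup>2 * (LINT x|edge_measure l. (cmod (f x))\<^sup>2)"
proof -
  let ?M = "edge_measure l" and ?N = "LINT x|edge_measure l. (cmod (f x))\<^sup>2"
  interpret M: finite_measure ?M by (rule finite_edge_measure)
  have N: "0 \<le> ?N" by (rule integral_nonneg_AE) auto
  have "(LINT x|?M. (cmod (kernel_op l k f x))\<^sup>2) \<le> (LINT x|?M. (B * sqrt l * sqrt ?N)\<^sup>2)"
    using kernel_op_L2[OF f] kernel_op_bound[OF f]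
    by (intro integral_mono) (auto simp: L2_iff intro!: power_mono)
  also have "\<dots> = l * (B * sqrt l * sqrt ?N)\<^sup>2" using l_pos by (simp add: measure_restrict_space)
  also have "\<dots> = (B * l)\<^sup>2 * ?N"
    using l_pos N by (simp add: power_mult_distrib) (simp add: power2_eq_square)
  finally show ?thesis .
qed

text \<open>
  Fubini: the adjoint has the transposed kernel.
\<close>

lemma kernel_op_adjoint:
  assumes f: "f \<in> L2_interval l" and g: "g \<in> L2_interval l"
  shows "(LINT x|edge_measure l. cnj (kernel_op l k f x) * g x)
       = (LINT y|edge_measure l. cnj (f y) * kernel_op l (\<lambda>y x. k x y) g y)"
proof -
  let ?M = "edge_measure l"
  interpret M: finite_measure ?M by (rule finite_edge_measure)
  interpret P: pair_sigma_finite ?M ?M ..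
  have [measurable]: "f \<in> borel_measurable ?M" "g \<in> borel_measurable ?M" using f g by (auto simp: L2_iff)
  have cm [measurable]: "(\<lambda>y. cnj (f y)) \<in> borel_measurable ?M"
    by (rule borel_measurable_continuous_on[of cnj]) (auto intro: continuous_intros)
  have fi: "integrable ?M (\<lambda>y. cnj (f y))" and gi: "integrable ?M g"
    using L2_integrable[OF f] L2_integrable[OF g] by auto
  have prod: "integrable (?M \<Otimes>\<^sub>M ?M) (\<lambda>p. g (fst p) * cnj (f (snd p)))"
  proof (rule P.Fubini_integrable)
    show "(\<lambda>p. g (fst p) * cnj (f (snd p))) \<in> borel_measurable (?M \<Otimes>\<^sub>M ?M)"
      by (intro borel_measurable_times measurable_compose[OF measurable_fst] measurable_compose[OF measurable_snd] cm) simp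
    show "integrable ?M (\<lambda>x. LINT y|?M. norm (g (fst (x, y)) * cnj (f (snd (x, y)))))"
      using gi by (simp add: norm_mult)
    show "AE x in ?M. integrable ?M (\<lambda>y. g (fst (x, y)) * cnj (f (snd (x, y))))"
      using fi by simp
  qed
  have "integrable (?M \<Otimes>\<^sub>M ?M) (\<lambda>p. of_real (k (fst p) (snd p)) * (g (fst p) * cnj (f (snd p))))"
  proof (rule Bochner_Integration.integrable_bound)
    show "integrable (?M \<Otimes>\<^sub>M ?M) (\<lambda>p. B * norm (g (fst p) * cnj (f (snd p))))" using prod by simp
    show "(\<lambda>p. of_real (k (fst p) (snd p)) * (g (fst p) * cnj (f (snd p)))) \<in> borel_measurable (?M \<Otimes>\<^sub>M ?M)"
      by (rule borel_measurable_times[OF kernel_measurable borel_measurable_integrable[OF prod]])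
    show "AE p in ?M \<Otimes>\<^sub>M ?M. norm (of_real (k (fst p) (snd p)) * (g (fst p) * cnj (f (snd p))))
        \<le> norm (B * norm (g (fst p) * cnj (f (snd p))))"
    proof (rule AE_I2)
      fix p assume "p \<in> space (?M \<Otimes>\<^sub>M ?M)"
      then have "\<bar>k (fst p) (snd p)\<bar> \<le> B" by (intro bound) (auto simp: space_pair_measure)
      then show "norm (of_real (k (fst p) (snd p)) * (g (fst p) * cnj (f (snd p))))
        \<le> norm (B * norm (g (fst p) * cnj (f (snd p))))"
        using B_nonneg by (simp add: norm_mult[of "of_real _"] abs_mult mult_right_mono)
    qed
  qed
  then have "integrable (?M \<Otimes>\<^sub>M ?M) (case_prod (\<lambda>x y. of_real (k x y) * (g x * cnj (f y))))"
    by (simp add: case_prod_unfold)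
  from P.Fubini_integral[OF this]
  have "(LINT y|?M. LINT x|?M. of_real (k x y) * (g x * cnj (f y)))
      = (LINT x|?M. LINT y|?M. of_real (k x y) * (g x * cnj (f y)))" .
  moreover have "(LINT x|?M. of_real (k x y) * (g x * cnj (f y))) = cnj (f y) * kernel_op l (\<lambda>y x. k x y) g y" for y
    unfolding kernel_op_def integral_mult_right_zero[symmetric] by (simp add: mult_ac)
  moreover have "(LINT y|?M. of_real (k x y) * (g x * cnj (f y))) = cnj (kernel_op l k f x) * g x" for x
  proof -
    have "cnj (kernel_op l k f x) = (LINT y|?M. of_real (k x y) * cnj (f y))"
      unfolding kernel_op_def using Bochner_Integration.integral_cnj[of ?M "\<lambda>y. of_real (k x y) * f y"] by simp
    then show ?thesis unfolding integral_mult_left_zero[symmetric] by (simp add: mult_ac)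
  qed
  ultimately show ?thesis by simp
qed

end

section \<open>The Green operator and weak solutions\<close>

lemma LINT_continuous:
  fixes h :: "real \<Rightarrow> complex"
  assumes "continuous_on {0..l} h"
  shows "(LINT x|edge_measure l. h x) = integral {0..l} h"
proof -
  have "integrable (edge_measure l) h" using L2_continuous[OF assms] by (rule L2_integrable)
  then have "(LINT x|edge_measure l. h x) = integral {0<..<l} h" by (rule lebesgue_integral_eq_integral) auto
  then show ?thesis by (simp add: integral_open_interval_real)
qed

lemma continuous_mult_integrable:
  assumes "continuous_on {0..l} g" "f \<in> L2_interval l"
  shows "integrable (edge_measure l) (\<lambda>x. complex_of_real (g x) * f x)"
  using L2_mult_integrable[OF L2_continuous assms(2), of "\<lambda>x. complex_of_real (g x)"] assms(1)
  by (simp add: continuous_on_of_real)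

lemma L2_inner_swap:
  "(LINT x|edge_measure l. cnj (f x) * g x) = cnj (LINT x|edge_measure l. cnj (g x) * f x)"
  using Bochner_Integration.integral_cnj[of "edge_measure l" "\<lambda>x. cnj (g x) * f x"] by (simp add: mult.commute)

text \<open>
  Compactness of the support leaves room for an open interval around it whose closure is still
  inside the edge.
\<close>

lemma test_functions_iff:
  assumes "0 < l"
  shows "f \<in> test_functions l \<longleftrightarrow> smooth f \<and> (\<exists>a b. 0 < a \<and> a < b \<and> b < l \<and> (\<forall>x. x \<notin> {a<..<b} \<longrightarrow> f x = 0))"
proof
  assume f: "f \<in> test_functions l"
  let ?S = "closure {x. f x \<noteq> 0}"
  have S: "compact ?S" "?S \<subseteq> {0<..<l}" "smooth f"
    using f unfolding test_functions_def mem_Collect_eq by blast+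
  have sub: "f x = 0" if "x \<notin> ?S" for x
  proof (rule ccontr)
    assume "f x \<noteq> 0"
    then have "x \<in> {x. f x \<noteq> 0}" by simp
    then have "x \<in> ?S" by (rule subsetD[OF closure_subset])
    with that show False by contradiction
  qed
  show "smooth f \<and> (\<exists>a b. 0 < a \<and> a < b \<and> b < l \<and> (\<forall>x. x \<notin> {a<..<b} \<longrightarrow> f x = 0))"
  proof (cases "?S = {}")
    case True
    have "x \<notin> ?S" for x unfolding True by simp
    then have "f x = 0" for x by (rule sub)
    then show ?thesis using S(3) assms by (intro conjI exI[of _ "l/3"] exI[of _ "l/2"]) auto
  next
    case False
    obtain p where p: "p \<in> ?S" "\<forall>x\<in>?S. p \<le> x" using compact_attains_inf[OF S(1) False] by blast
    obtain q where q: "q \<in> ?S" "\<forall>x\<in>?S. x \<le> q" using compact_attains_sup[OF S(1) False] by blast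
    have pq: "0 < p" "p \<le> q" "q < l" using p q S(2) by auto
    have "f x = 0" if "x \<notin> {p/2<..<(q+l)/2}" for x
    proof (rule sub, rule notI)
      assume "x \<in> ?S"
      then have "p \<le> x" "x \<le> q" using p q by auto
      then show False using that pq by auto
    qed
    then show ?thesis using S(3) pq by (intro conjI exI[of _ "p/2"] exI[of _ "(q+l)/2"]) auto
  qed
next
  assume "smooth f \<and> (\<exists>a b. 0 < a \<and> a < b \<and> b < l \<and> (\<forall>x. x \<notin> {a<..<b} \<longrightarrow> f x = 0))"
  then obtain a b where ab: "smooth f" "0 < a" "b < l" "\<And>x. x \<notin> {a<..<b} \<Longrightarrow> f x = 0" by blast
  have sub: "closure {x. f x \<noteq> 0} \<subseteq> {a..b}"
    using ab(4) by (intro closure_minimal) (auto, (metis greaterThanLessThan_iff less_imp_le)+)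
  moreover have "compact (closure {x. f x \<noteq> 0})"
    using compact_Int_closed[OF compact_Icc closed_closure] sub by (metis inf.absorb2)
  ultimately show "f \<in> test_functions l" using ab by (auto simp: test_functions_def)
qed

lemma derivative_zero_outside:
  assumes f: "\<And>x. (f has_vector_derivative f' x) (at x)" and zero: "\<And>x::real. x \<notin> {a<..<b} \<Longrightarrow> f x = (0::complex)"
  shows "x \<notin> {a<..<b} \<Longrightarrow> f' x = 0"
proof -
  assume x: "x \<notin> {a<..<b}"
  \<comment> \<open>At \<open>a\<close> and \<open>b\<close> only one of the one-sided derivatives is seen to vanish.\<close>
  have left: "f' x = 0" if "\<And>y. y \<le> x \<Longrightarrow> f y = 0"
  proof -
    have "(f has_vector_derivative f' x) (at x within {x-1..x})" using f by (rule has_vector_derivative_at_within)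
    moreover have "((\<lambda>_. 0) has_vector_derivative (0::complex)) (at x within {x-1..x})" by simp
    then have "(f has_vector_derivative 0) (at x within {x-1..x})"
      by (rule has_vector_derivative_transform[rotated 2]) (use that in auto)
    ultimately show ?thesis by (rule vector_derivative_unique_within[rotated]) (simp add: trivial_limit_within islimpt_Icc)
  qed
  have right: "f' x = 0" if "\<And>y. y \<ge> x \<Longrightarrow> f y = 0"
  proof -
    have "(f has_vector_derivative f' x) (at x within {x..x+1})" using f by (rule has_vector_derivative_at_within)
    moreover have "((\<lambda>_. 0) has_vector_derivative (0::complex)) (at x within {x..x+1})" by simp
    then have "(f has_vector_derivative 0) (at x within {x..x+1})"
      by (rule has_vector_derivative_transform[rotated 2]) (use that in auto)
    ultimately show ?thesis by (rule vector_derivative_unique_within[rotated]) (simp add: trivial_limit_within islimpt_Icc)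
  qed
  show "f' x = 0" using x zero left right by (cases "x \<le> a") auto
qed

lemma iter_deriv_2_eq:
  assumes "\<And>x. (f has_vector_derivative f' x) (at x)" "\<And>x. (f' has_vector_derivative f'' x) (at x)"
  shows "iter_deriv 2 f = f''"
proof -
  have "(\<lambda>x. vector_derivative f (at x)) = f'" "(\<lambda>x. vector_derivative f' (at x)) = f''"
    using assms by (auto simp: vector_derivative_at)
  then show ?thesis by (simp add: numeral_2_eq_2 iter_deriv_Suc) (simp add: iter_deriv_def)
qed

lemma smooth_second_deriv:
  assumes "smooth f"
  obtains f' where "\<And>x. (f has_vector_derivative f' x) (at x)"
    "\<And>x. (f' has_vector_derivative iter_deriv 2 f x) (at x)" "smooth f'" "smooth (iter_deriv 2 f)"
proof
  let ?f = "\<lambda>x. vector_derivative f (at x)"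
  show "smooth ?f" using smooth_deriv(1)[OF assms] .
  show "(f has_vector_derivative ?f x) (at x)" for x using smooth_deriv(2)[OF assms] .
  have "iter_deriv 2 f = (\<lambda>x. vector_derivative ?f (at x))"
    by (simp add: numeral_2_eq_2 iter_deriv_Suc) (simp add: iter_deriv_def)
  then show "smooth (iter_deriv 2 f)" "(?f has_vector_derivative iter_deriv 2 f x) (at x)" for x
    using smooth_deriv[OF \<open>smooth ?f\<close>] by auto
qed

text \<open>
  Variation of constants: \<open>green \<mu> l f\<close> is the solution of \<open>- y'' - \<mu> y = f\<close> with zero Cauchy data
  at \<open>0\<close>, and \<open>green_adj \<mu> l f\<close> the one with zero Cauchy data at \<open>l\<close>. The maximum cuts the kernel off
  continuously at \<open>y = x\<close>, because \<open>sn \<mu> 0 = 0\<close>.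
\<close>

definition green_kernel :: "real \<Rightarrow> real \<Rightarrow> real \<Rightarrow> real" where
  "green_kernel \<mu> x y = - sn \<mu> (max 0 (x - y))"

abbreviation green :: "real \<Rightarrow> real \<Rightarrow> (real \<Rightarrow> complex) \<Rightarrow> real \<Rightarrow> complex" where
  "green \<mu> l \<equiv> kernel_op l (green_kernel \<mu>)"

abbreviation green_adj :: "real \<Rightarrow> real \<Rightarrow> (real \<Rightarrow> complex) \<Rightarrow> real \<Rightarrow> complex" where
  "green_adj \<mu> l \<equiv> kernel_op l (\<lambda>y x. green_kernel \<mu> x y)"

lemma green_bounded_kernel:
  assumes "0 < l" obtains B where "bounded_kernel l (green_kernel \<mu>) B"
proof -
  have "bounded (sn \<mu> ` {0..l})"
    by (intro compact_imp_bounded compact_continuous_image sn_continuous) auto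
  then obtain B where B: "\<forall>t\<in>{0..l}. \<bar>sn \<mu> t\<bar> \<le> B" by (auto simp: bounded_iff)
  have "bounded_kernel l (green_kernel \<mu>) B"
  proof
    show "continuous_on UNIV (\<lambda>(x, y). green_kernel \<mu> x y)"
      unfolding green_kernel_def case_prod_unfold
      by (intro continuous_intros continuous_on_compose2[OF sn_continuous[of UNIV]]) auto
    show "\<bar>green_kernel \<mu> x y\<bar> \<le> B" if "0 < x" "x < l" "0 < y" "y < l" for x y
      using B that unfolding green_kernel_def by auto
  qed (rule assms)
  then show ?thesis using that by blast
qed

lemma sn_minus: "sn \<mu> (- x) = - sn \<mu> x"
  using sn_diff[of \<mu> 0 x] by simp

text \<open>
  The difference of the two solutions is the classical solution
  \<open>sn \<mu> x * \<integral> cs \<mu> f - cs \<mu> x * \<integral> sn \<mu> f\<close> up to sign. When it vanishes, \<open>green \<mu> l f\<close> has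
  zero Cauchy data at both ends.
\<close>

lemma green_eq_adjoint:
  assumes f: "f \<in> L2_interval l"
    and c: "(LINT x|edge_measure l. of_real (cs \<mu> x) * f x) = 0"
    and s: "(LINT x|edge_measure l. of_real (sn \<mu> x) * f x) = 0"
  shows "green \<mu> l f x = green_adj \<mu> l f x"
proof -
  let ?M = "edge_measure l"
  have i: "integrable ?M (\<lambda>y. complex_of_real (green_kernel \<mu> x y) * f y)"
    "integrable ?M (\<lambda>y. complex_of_real (green_kernel \<mu> y x) * f y)"
    unfolding green_kernel_def
    by (intro continuous_mult_integrable[OF _ f] continuous_intros continuous_on_compose2[OF sn_continuous[of UNIV]]; simp)+
  have j: "integrable ?M (\<lambda>y. complex_of_real (cs \<mu> y) * f y)" "integrable ?M (\<lambda>y. complex_of_real (sn \<mu> y) * f y)"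
    by (intro continuous_mult_integrable[OF _ f] sn_continuous cs_continuous)+
  have pt: "complex_of_real (green_kernel \<mu> x y) * f y - complex_of_real (green_kernel \<mu> y x) * f y
    = of_real (cs \<mu> x) * (of_real (sn \<mu> y) * f y) - of_real (sn \<mu> x) * (of_real (cs \<mu> y) * f y)" for y
  proof -
    have "green_kernel \<mu> x y - green_kernel \<mu> y x = - sn \<mu> (x - y)"
      using sn_minus[of \<mu> "x - y"] by (auto simp: green_kernel_def max_def)
    then have "green_kernel \<mu> x y - green_kernel \<mu> y x = cs \<mu> x * sn \<mu> y - sn \<mu> x * cs \<mu> y"
      by (simp add: sn_diff)
    then have "complex_of_real (green_kernel \<mu> x y) - of_real (green_kernel \<mu> y x)
      = of_real (cs \<mu> x) * of_real (sn \<mu> y) - of_real (sn \<mu> x) * of_real (cs \<mu> y)"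
      by (simp only: of_real_diff[symmetric] of_real_mult[symmetric])
    then show ?thesis by (simp only: left_diff_distrib[symmetric] mult.assoc[symmetric])
  qed
  have "green \<mu> l f x - green_adj \<mu> l f x
      = (LINT y|?M. complex_of_real (green_kernel \<mu> x y) * f y - complex_of_real (green_kernel \<mu> y x) * f y)"
    unfolding kernel_op_def using i by simp
  also have "\<dots> = 0" unfolding pt using j c s by simp
  finally show ?thesis by simp
qed

text \<open>
  A test function has zero Cauchy data at \<open>l\<close>, so it is the solution of the final value problem.
  The proof integrates the Lagrange identity from \<open>y\<close> to \<open>l\<close>.
\<close>

lemma green_adj_inverts:
  assumes l: "0 < l" and \<phi>: "\<phi> \<in> test_functions l" and y: "0 < y" "y < l"
  shows "green_adj \<mu> l (\<lambda>x. - iter_deriv 2 \<phi> x - of_real \<mu> * \<phi> x) y = \<phi> y"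
proof -
  obtain a b where ab: "0 < a" "a < b" "b < l" "\<And>x. x \<notin> {a<..<b} \<Longrightarrow> \<phi> x = 0" and sm: "smooth \<phi>"
    using \<phi> test_functions_iff[OF l] by auto
  obtain \<phi>' where d: "\<And>x. (\<phi> has_vector_derivative \<phi>' x) (at x)"
    "\<And>x. (\<phi>' has_vector_derivative iter_deriv 2 \<phi> x) (at x)" "smooth \<phi>'" "smooth (iter_deriv 2 \<phi>)"
    using smooth_second_deriv[OF sm] by blast
  have end_zero: "\<phi> l = 0" "\<phi>' l = 0" using ab(1-3) ab(4)[of l] derivative_zero_outside[of \<phi> \<phi>' a b l, OF d(1) ab(4)] by auto
  define h where "h x = complex_of_real (sn \<mu> (max 0 (x - y))) * (iter_deriv 2 \<phi> x + of_real \<mu> * \<phi> x)" for x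
  have h_cont: "continuous_on A h" for A
    unfolding h_def
    by (intro continuous_intros continuous_on_compose2[OF sn_continuous[of UNIV]] smooth_continuous d sm) auto
  define F where "F x = of_real (sn \<mu> (x - y)) * \<phi>' x - of_real (cs \<mu> (x - y)) * \<phi> x" for x
  have "(h has_integral (F l - F y)) {y..l}"
  proof (rule fundamental_theorem_of_calculus)
    show "y \<le> l" using y by simp
    fix x assume x: "x \<in> {y..l}"
    have sh: "((\<lambda>x. x - y) has_vector_derivative 1) (at x)"
      by (auto intro!: derivative_eq_intros)
    have s: "((\<lambda>x. complex_of_real (sn \<mu> (x - y))) has_vector_derivative of_real (cs \<mu> (x - y))) (at x)"
      using vector_diff_chain_at[OF sh, of "\<lambda>x. complex_of_real (sn \<mu> x)"] sn_vderiv[of \<mu> "x - y"] by (simp add: o_def)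
    have c: "((\<lambda>x. complex_of_real (cs \<mu> (x - y))) has_vector_derivative of_real (- \<mu> * sn \<mu> (x - y))) (at x)"
      using vector_diff_chain_at[OF sh, of "\<lambda>x. complex_of_real (cs \<mu> x)"] cs_vderiv[of \<mu> "x - y"] by (simp add: o_def)
    have "(F has_vector_derivative (of_real (sn \<mu> (x - y)) * iter_deriv 2 \<phi> x + of_real (cs \<mu> (x - y)) * \<phi>' x)
       - (of_real (cs \<mu> (x - y)) * \<phi>' x + of_real (- \<mu> * sn \<mu> (x - y)) * \<phi> x)) (at x)"
      unfolding F_def by (intro has_vector_derivative_diff has_vector_derivative_mult s c d)
    moreover have "(of_real (sn \<mu> (x - y)) * iter_deriv 2 \<phi> x + of_real (cs \<mu> (x - y)) * \<phi>' x)
       - (of_real (cs \<mu> (x - y)) * \<phi>' x + of_real (- \<mu> * sn \<mu> (x - y)) * \<phi> x) = h x"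
      using x by (simp add: h_def max_def algebra_simps)
    ultimately show "(F has_vector_derivative h x) (at x within {y..l})"
      by (metis has_vector_derivative_at_within)
  qed
  moreover have "(h has_integral 0) {0..y}"
    by (rule has_integral_is_0) (auto simp: h_def max_def)
  ultimately have "(h has_integral (0 + (F l - F y))) {0..l}"
    using y by (intro has_integral_combine[of 0 y l]) auto
  then have "integral {0..l} h = F l - F y" by (simp add: integral_unique)
  also have "\<dots> = \<phi> y" using end_zero by (simp add: F_def)
  finally have "(LINT x|edge_measure l. h x) = \<phi> y" using LINT_continuous[OF h_cont] by simp
  moreover have "green_adj \<mu> l (\<lambda>x. - iter_deriv 2 \<phi> x - of_real \<mu> * \<phi> x) y = (LINT x|edge_measure l. h x)"
    unfolding kernel_op_def h_def green_kernel_def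
    by (rule Bochner_Integration.integral_cong) (auto simp: algebra_simps)
  ultimately show ?thesis by simp
qed

text \<open>
  The integral from a point to the left of the support vanishes beyond the support on both
  sides, as the total integral is zero.
\<close>

lemma compactly_supported_antiderivative:
  fixes g :: "real \<Rightarrow> complex"
  assumes g: "smooth g" "\<And>x. x \<notin> {a<..<b} \<Longrightarrow> g x = 0" and ab: "a < b" and zero: "integral {a..b} g = 0"
  obtains F where "smooth F" "\<And>x. (F has_vector_derivative g x) (at x)" "\<And>x. x \<notin> {a<..<b} \<Longrightarrow> F x = 0"
proof -
  define F where "F x = integral {a - 1..max x (a - 1)} g" for x
  have cont: "continuous_on A g" for A using g(1) by (rule smooth_continuous)
  have left: "F x = 0" if "x \<le> a" for x
    unfolding F_def by (rule integral_unique, rule has_integral_is_0) (use g(2) that ab in \<open>auto simp: max_def split: if_splits\<close>)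
  have deriv: "(F has_vector_derivative g x) (at x)" for x
  proof (cases "x < a")
    case True
    have "((\<lambda>_. 0) has_vector_derivative g x) (at x)" using g(2)[of x] True by simp
    then show ?thesis
      by (rule has_vector_derivative_transform_within_open[of _ _ _ "{..<a}"]) (use True left in auto)
  next
    case False
    have "((\<lambda>u. integral {a - 1..u} g) has_vector_derivative g x) (at x within {a - 1..x + 1})"
      by (rule integral_has_vector_derivative[OF cont]) (use False in auto)
    moreover have "x \<in> interior {a - 1..x + 1}" using False by (simp add: interior_atLeastAtMost_real)
    ultimately have "((\<lambda>u. integral {a - 1..u} g) has_vector_derivative g x) (at x)"
      by (metis at_within_interior)
    then show ?thesis
      by (rule has_vector_derivative_transform_within_open[of _ _ _ "{a - 1<..}"]) (use False in \<open>auto simp: F_def\<close>)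
  qed
  have right: "F x = 0" if "b \<le> x" for x
  proof -
    have 1: "(g has_integral 0) {a - 1..a}" by (rule has_integral_is_0) (use g(2) in auto)
    have 2: "(g has_integral 0) {a..b}"
      using integrable_continuous_real[OF cont] zero by (metis has_integral_integral)
    have 3: "(g has_integral 0) {b..x}" by (rule has_integral_is_0) (use g(2) in auto)
    have "(g has_integral (0 + 0 + 0)) {a - 1..x}"
      by (rule has_integral_combine[OF _ _ has_integral_combine[OF _ _ 1 2] 3]) (use that ab in auto)
    then show ?thesis using that ab by (simp add: F_def integral_unique max_def)
  qed
  have "F x = 0" if "x \<notin> {a<..<b}" for x using left[of x] right[of x] that by (cases "x \<le> a") auto
  with that deriv smooth_antideriv[OF g(1)] show ?thesis by blast
qed

text \<open>
  Variation of constants stays within the test functions when the two coefficient functions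
  \<open>F1\<close> and \<open>F2\<close>, the antiderivatives of \<open>f * cs \<mu>\<close> and \<open>f * sn \<mu>\<close>, have compact support.
\<close>

lemma test_solution:
  assumes l: "0 < l" and f: "f \<in> test_functions l"
    and c: "(LINT x|edge_measure l. f x * of_real (cs \<mu> x)) = 0"
    and s: "(LINT x|edge_measure l. f x * of_real (sn \<mu> x)) = 0"
  obtains \<phi> where "\<phi> \<in> test_functions l" "(\<lambda>x. - iter_deriv 2 \<phi> x - of_real \<mu> * \<phi> x) = f"
proof -
  obtain a b where ab: "0 < a" "a < b" "b < l" "\<And>x. x \<notin> {a<..<b} \<Longrightarrow> f x = 0" and sm: "smooth f"
    using f test_functions_iff[OF l] by auto
  have int: "integral {a..b} (\<lambda>x. f x * of_real (g x)) = 0"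
    if g: "continuous_on UNIV g" "(LINT x|edge_measure l. f x * of_real (g x)) = 0" for g
  proof -
    let ?h = "\<lambda>x. f x * complex_of_real (g x)"
    have hc: "continuous_on A ?h" for A
      by (intro continuous_intros smooth_continuous[OF sm] continuous_on_subset[OF g(1)]) auto
    have 1: "(?h has_integral 0) {0..a}" by (rule has_integral_is_0) (use ab(4) in auto)
    have 2: "(?h has_integral integral {a..b} ?h) {a..b}"
      using integrable_continuous_real[OF hc] by (rule integrable_integral)
    have 3: "(?h has_integral 0) {b..l}" by (rule has_integral_is_0) (use ab(4) in auto)
    have "(?h has_integral (0 + integral {a..b} ?h + 0)) {0..l}"
      by (rule has_integral_combine[OF _ _ has_integral_combine[OF _ _ 1 2] 3]) (use ab in auto)
    then show ?thesis using g(2) LINT_continuous[OF hc] by (simp add: integral_unique)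
  qed
  obtain F1 where F1: "smooth F1" "\<And>x. (F1 has_vector_derivative f x * of_real (cs \<mu> x)) (at x)" "\<And>x. x \<notin> {a<..<b} \<Longrightarrow> F1 x = 0"
    by (rule compactly_supported_antiderivative[OF smooth_mult[OF sm smooth_cs] _ ab(2) int[OF cs_continuous c]])
      (use ab(4) in auto)
  obtain F2 where F2: "smooth F2" "\<And>x. (F2 has_vector_derivative f x * of_real (sn \<mu> x)) (at x)" "\<And>x. x \<notin> {a<..<b} \<Longrightarrow> F2 x = 0"
    by (rule compactly_supported_antiderivative[OF smooth_mult[OF sm smooth_sn] _ ab(2) int[OF sn_continuous s]])
      (use ab(4) in auto)
  define \<phi> where "\<phi> x = of_real (cs \<mu> x) * F2 x + of_real (- sn \<mu> x) * F1 x" for x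
  define \<phi>' where "\<phi>' x = - (of_real (cs \<mu> x) * F1 x + of_real \<mu> * (of_real (sn \<mu> x) * F2 x))" for x
  have py: "complex_of_real (cs \<mu> x) * of_real (cs \<mu> x) = 1 - of_real \<mu> * (of_real (sn \<mu> x) * of_real (sn \<mu> x))" for x
  proof -
    have "cs \<mu> x * cs \<mu> x = 1 - \<mu> * (sn \<mu> x * sn \<mu> x)"
      using cs_sn_pythagoras[of \<mu> x] by (simp add: power2_eq_square)
    then show ?thesis by (metis of_real_1 of_real_diff of_real_mult)
  qed
  have sneg: "((\<lambda>x. complex_of_real (- sn \<mu> x)) has_vector_derivative - of_real (cs \<mu> x)) (at x)" for x
    using has_vector_derivative_minus[OF sn_vderiv[of \<mu> x]] by simp
  have "(\<phi> has_vector_derivative \<phi>' x) (at x)" for x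
  proof -
    have "(\<phi> has_vector_derivative
       (of_real (cs \<mu> x) * (f x * of_real (sn \<mu> x)) + of_real (- \<mu> * sn \<mu> x) * F2 x)
        + (of_real (- sn \<mu> x) * (f x * of_real (cs \<mu> x)) + - of_real (cs \<mu> x) * F1 x)) (at x)"
      unfolding \<phi>_def by (intro has_vector_derivative_add has_vector_derivative_mult sneg cs_vderiv F1 F2)
    then show ?thesis by (rule has_vector_derivative_eq_rhs) (simp add: \<phi>'_def algebra_simps)
  qed
  moreover have "(\<phi>' has_vector_derivative (- of_real \<mu> * \<phi> x - f x)) (at x)" for x
  proof -
    have "(\<phi>' has_vector_derivative - ((of_real (cs \<mu> x) * (f x * of_real (cs \<mu> x)) + of_real (- \<mu> * sn \<mu> x) * F1 x)
       + of_real \<mu> * (of_real (sn \<mu> x) * (f x * of_real (sn \<mu> x)) + of_real (cs \<mu> x) * F2 x))) (at x)"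
      unfolding \<phi>'_def
      by (intro has_vector_derivative_add has_vector_derivative_minus has_vector_derivative_mult
          has_vector_derivative_mult_right cs_vderiv sn_vderiv F1 F2)
    moreover have "of_real (cs \<mu> x) * (f x * of_real (cs \<mu> x)) = f x * (1 - of_real \<mu> * (of_real (sn \<mu> x) * of_real (sn \<mu> x)))"
      unfolding py[symmetric] by simp
    ultimately show ?thesis
      by (elim has_vector_derivative_eq_rhs) (simp add: \<phi>_def algebra_simps)
  qed
  ultimately have d2: "iter_deriv 2 \<phi> = (\<lambda>x. - of_real \<mu> * \<phi> x - f x)" by (rule iter_deriv_2_eq)
  have "smooth \<phi>"
    using smooth_add[OF smooth_mult[OF smooth_cs F2(1)] smooth_mult[OF smooth_scale[OF smooth_sn, of "-1"] F1(1)]]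
    by (simp add: \<phi>_def[abs_def])
  moreover have "\<phi> x = 0" if "x \<notin> {a<..<b}" for x using F1(3)[OF that] F2(3)[OF that] by (simp add: \<phi>_def)
  ultimately have "\<phi> \<in> test_functions l" using ab test_functions_iff[OF l] by blast
  then show ?thesis using that d2 by auto
qed

lemma functional_multiple:
  fixes m m1 :: "(real \<Rightarrow> complex) \<Rightarrow> complex"
  assumes closed: "\<And>f g c. f \<in> X \<Longrightarrow> g \<in> X \<Longrightarrow> (\<lambda>x. f x + c * g x) \<in> X"
    and lin: "\<And>f g c. f \<in> X \<Longrightarrow> g \<in> X \<Longrightarrow> m (\<lambda>x. f x + c * g x) = m f + c * m g"
      "\<And>f g c. f \<in> X \<Longrightarrow> g \<in> X \<Longrightarrow> m1 (\<lambda>x. f x + c * g x) = m1 f + c * m1 g"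
    and ker: "\<And>f. f \<in> X \<Longrightarrow> m1 f = 0 \<Longrightarrow> m f = 0"
  shows "\<exists>\<alpha>. \<forall>f\<in>X. m f = \<alpha> * m1 f"
proof (cases "\<exists>p\<in>X. m1 p \<noteq> 0")
  case True
  then obtain p where p: "p \<in> X" "m1 p \<noteq> 0" by blast
  have "m f = (m p / m1 p) * m1 f" if f: "f \<in> X" for f
  proof -
    define h where "h = (\<lambda>x. f x + (- m1 f / m1 p) * p x)"
    have "h \<in> X" unfolding h_def by (rule closed[OF f p(1)])
    moreover have "m1 h = 0" unfolding h_def lin(2)[OF f p(1)] using p(2) by simp
    ultimately have "m h = 0" by (rule ker)
    then show ?thesis unfolding h_def lin(1)[OF f p(1)] by (simp add: algebra_simps)
  qed
  then show ?thesis by blast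
qed (use ker in auto)

text \<open>
  Two applications of the case of one functional: on the kernel of \<open>m2\<close> the
  functional \<open>m\<close> is a multiple of \<open>m1\<close>, and the difference is then a multiple of \<open>m2\<close>.
\<close>

lemma functional_combination:
  fixes m m1 m2 :: "(real \<Rightarrow> complex) \<Rightarrow> complex"
  assumes closed: "\<And>f g c. f \<in> X \<Longrightarrow> g \<in> X \<Longrightarrow> (\<lambda>x. f x + c * g x) \<in> X"
    and lin: "\<And>f g c. f \<in> X \<Longrightarrow> g \<in> X \<Longrightarrow> m (\<lambda>x. f x + c * g x) = m f + c * m g"
      "\<And>f g c. f \<in> X \<Longrightarrow> g \<in> X \<Longrightarrow> m1 (\<lambda>x. f x + c * g x) = m1 f + c * m1 g"
      "\<And>f g c. f \<in> X \<Longrightarrow> g \<in> X \<Longrightarrow> m2 (\<lambda>x. f x + c * g x) = m2 f + c * m2 g"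
    and ker: "\<And>f. f \<in> X \<Longrightarrow> m1 f = 0 \<Longrightarrow> m2 f = 0 \<Longrightarrow> m f = 0"
  shows "\<exists>\<alpha> \<beta>. \<forall>f\<in>X. m f = \<alpha> * m1 f + \<beta> * m2 f"
proof -
  have "\<exists>\<alpha>. \<forall>f\<in>{f\<in>X. m2 f = 0}. m f = \<alpha> * m1 f"
    by (rule functional_multiple) (use assms in auto)
  then obtain \<alpha> where \<alpha>: "\<And>f. f \<in> X \<Longrightarrow> m2 f = 0 \<Longrightarrow> m f = \<alpha> * m1 f" by blast
  have "\<exists>\<beta>. \<forall>f\<in>X. m f - \<alpha> * m1 f = \<beta> * m2 f"
    by (rule functional_multiple) (use closed lin \<alpha> in \<open>auto simp: algebra_simps\<close>)
  then obtain \<beta> where "\<forall>f\<in>X. m f - \<alpha> * m1 f = \<beta> * m2 f" by blast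
  then show ?thesis by (intro exI[of _ \<alpha>] exI[of _ \<beta>]) (auto simp: algebra_simps)
qed

text \<open>
  Every test function orthogonal to both classical solutions has the form \<open>- \<phi>'' - \<mu> \<phi>\<close>, so the functional
  \<open>f \<mapsto> \<integral> f w\<close> vanishes on the common kernel of \<open>f \<mapsto> \<integral> f cs\<close> and \<open>f \<mapsto> \<integral> f sn\<close>. It is therefore a
  combination of these two, and the fundamental lemma applies to the difference.
\<close>

lemma weak_solution_classical:
  assumes l: "0 < l" and w: "w \<in> L2_interval l"
    and weak: "\<And>\<phi>. \<phi> \<in> test_functions l \<Longrightarrow> (LINT x|edge_measure l. (- iter_deriv 2 \<phi> x - of_real \<mu> * \<phi> x) * w x) = 0"
  shows "\<exists>\<alpha> \<beta>. AE x in edge_measure l. w x = \<alpha> * of_real (cs \<mu> x) + \<beta> * of_real (sn \<mu> x)"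
proof -
  let ?M = "edge_measure l"
  have closed: "(\<lambda>x. f x + c * g x) \<in> test_functions l" if fg: "f \<in> test_functions l" "g \<in> test_functions l" for f g c
  proof -
    obtain a b a' b' where ab: "0 < a" "a < b" "b < l" "\<And>x. x \<notin> {a<..<b} \<Longrightarrow> f x = 0" "smooth f"
      "0 < a'" "a' < b'" "b' < l" "\<And>x. x \<notin> {a'<..<b'} \<Longrightarrow> g x = 0" "smooth g"
      using fg unfolding test_functions_iff[OF l] by metis
    have "f x + c * g x = 0" if "x \<notin> {min a a'<..<max b b'}" for x
      using ab(4)[of x] ab(9)[of x] that by (auto simp: min_def max_def split: if_splits)
    moreover have "0 < min a a'" "min a a' < max b b'" "max b b' < l" using ab by auto
    ultimately show ?thesis unfolding test_functions_iff[OF l]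
      using smooth_add[OF ab(5) smooth_scale[OF ab(10)]] by blast
  qed
  have test_L2: "f \<in> L2_interval l" if "f \<in> test_functions l" for f
    using that by (intro L2_continuous smooth_continuous) (simp add: test_functions_def)
  have int: "integrable ?M (\<lambda>x. f x * v x)" if "f \<in> test_functions l" "v \<in> L2_interval l" for f v
  proof -
    have "(\<lambda>x. cnj (f x)) \<in> L2_interval l"
      using that(1) by (intro L2_continuous continuous_on_cnj smooth_continuous) (simp add: test_functions_def)
    from L2_mult_integrable[OF this that(2)] show ?thesis by simp
  qed
  have csL2: "(\<lambda>x. complex_of_real (cs \<mu> x)) \<in> L2_interval l" and snL2: "(\<lambda>x. complex_of_real (sn \<mu> x)) \<in> L2_interval l"
    by (intro L2_continuous smooth_continuous smooth_cs smooth_sn)+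
  have lin: "(LINT x|?M. (f x + c * g x) * v x) = (LINT x|?M. f x * v x) + c * (LINT x|?M. g x * v x)"
    if "f \<in> test_functions l" "g \<in> test_functions l" "v \<in> L2_interval l" for f g c v
    using int[OF that(1,3)] int[OF that(2,3)] by (simp add: distrib_right mult.assoc)
  have "\<exists>\<alpha> \<beta>. \<forall>f\<in>test_functions l. (LINT x|?M. f x * w x)
      = \<alpha> * (LINT x|?M. f x * of_real (cs \<mu> x)) + \<beta> * (LINT x|?M. f x * of_real (sn \<mu> x))"
  proof (rule functional_combination)
    fix f assume f: "f \<in> test_functions l" "(LINT x|?M. f x * of_real (cs \<mu> x)) = 0" "(LINT x|?M. f x * of_real (sn \<mu> x)) = 0"
    obtain \<phi> where \<phi>: "\<phi> \<in> test_functions l" "(\<lambda>x. - iter_deriv 2 \<phi> x - of_real \<mu> * \<phi> x) = f"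
      using test_solution[OF l f] .
    have "f x = - iter_deriv 2 \<phi> x - of_real \<mu> * \<phi> x" for x using \<phi>(2) by auto
    then show "(LINT x|?M. f x * w x) = 0" using weak[OF \<phi>(1)] by simp
  qed (intro closed lin w csL2 snL2; assumption)+
  then obtain \<alpha> \<beta> where eq: "\<And>f. f \<in> test_functions l \<Longrightarrow> (LINT x|?M. f x * w x)
      = \<alpha> * (LINT x|?M. f x * of_real (cs \<mu> x)) + \<beta> * (LINT x|?M. f x * of_real (sn \<mu> x))" by blast
  define v where "v x = w x - (\<alpha> * of_real (cs \<mu> x) + \<beta> * of_real (sn \<mu> x))" for x
  have "integrable ?M v" unfolding v_def using L2_integrable[OF w] L2_integrable[OF csL2] L2_integrable[OF snL2] by simp
  then have "AE x in ?M. v x = 0"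
  proof (rule AE_zero_if_test_integrals_zero)
    fix f assume f: "f \<in> test_functions l"
    have pt: "f x * v x = f x * w x - (\<alpha> * (f x * of_real (cs \<mu> x)) + \<beta> * (f x * of_real (sn \<mu> x)))" for x
      by (simp add: v_def algebra_simps)
    show "(LINT x|?M. f x * v x) = 0"
      unfolding pt using int[OF f w] int[OF f csL2] int[OF f snL2] eq[OF f] by simp
  qed
  then show ?thesis by (intro exI[of _ \<alpha>] exI[of _ \<beta>]) (auto simp: v_def elim!: eventually_mono)
qed

section \<open>The Hilbert space and the operator of a metric graph\<close>

definition fscale :: "complex \<Rightarrow> family \<Rightarrow> family" where
  "fscale c u = (\<lambda>i x. c * u i x)"

lemma fscale_apply [simp]: "fscale c u i x = c * u i x"
  by (simp add: fscale_def)

interpretation family: vector_space fscale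
  by standard (auto simp: fun_eq_iff algebra_simps)

lemma family_sum_apply: "(\<Sum>j\<in>J. (f j :: family)) i x = (\<Sum>j\<in>J. f j i x)"
  by (induction J rule: infinite_finite_induct) auto

lemma H_spaceD: "u \<in> H_space K L \<Longrightarrow> i < K \<Longrightarrow> u i \<in> L2_interval (L i)"
  by (simp add: H_space_def)

lemma H_add: "u \<in> H_space K L \<Longrightarrow> v \<in> H_space K L \<Longrightarrow> u + v \<in> H_space K L"
  using L2_add by (auto simp: H_space_def plus_fun_def)

lemma H_scale: "u \<in> H_space K L \<Longrightarrow> fscale c u \<in> H_space K L"
  using L2_scale by (auto simp: H_space_def fscale_def)

lemma L2_zero: "(\<lambda>x. 0) \<in> L2_interval l"
  by (rule L2_continuous) simp

lemma H_inner_self_Re: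
  "Re (H_inner K L u u) = (\<Sum>i<K. LINT x|edge_measure (L i). (cmod (u i x))\<^sup>2)"
proof -
  have "(LINT x|edge_measure (L i). cnj (u i x) * u i x) = of_real (LINT x|edge_measure (L i). (cmod (u i x))\<^sup>2)" for i
    unfolding integral_complex_of_real[symmetric]
    by (rule Bochner_Integration.integral_cong) (auto simp: complex_norm_square mult.commute simp del: of_real_power)
  then show ?thesis by (simp add: H_inner_def)
qed

lemma semi_inner_H: "semi_inner fscale (H_space K L) (H_inner K L)"
proof
  show "family.subspace (H_space K L)"
    using H_add H_scale L2_zero by (auto simp: family.subspace_def H_space_def zero_fun_def)
next
  fix x y z assume "x \<in> H_space K L" "y \<in> H_space K L" "z \<in> H_space K L"
  then have "integrable (edge_measure (L i)) (\<lambda>t. cnj (x i t) * y i t)"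
    "integrable (edge_measure (L i)) (\<lambda>t. cnj (x i t) * z i t)" if "i < K" for i
    using that by (auto intro!: L2_mult_integrable H_spaceD)
  then show "H_inner K L x (y + z) = H_inner K L x y + H_inner K L x z"
    by (simp add: H_inner_def distrib_left sum.distrib[symmetric])
next
  fix x y c
  have "(LINT t|edge_measure (L i). cnj (x i t) * (c * y i t)) = c * (LINT t|edge_measure (L i). cnj (x i t) * y i t)" for i
    unfolding integral_mult_right_zero[symmetric] by (simp add: mult_ac)
  then show "H_inner K L x (fscale c y) = c * H_inner K L x y"
    by (simp add: H_inner_def sum_distrib_left)
next
  fix x y
  show "H_inner K L y x = cnj (H_inner K L x y)"
    unfolding H_inner_def cnj_sum by (intro sum.cong refl L2_inner_swap)
next
  fix x
  show "0 \<le> Re (H_inner K L x x)"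
    unfolding H_inner_self_Re by (intro sum_nonneg integral_nonneg_AE) auto
qed

lemma H_null_iff:
  assumes "u \<in> H_space K L"
  shows "semi_inner.null (H_space K L) (H_inner K L) u \<longleftrightarrow> (\<forall>i<K. AE x in edge_measure (L i). u i x = 0)"
proof -
  interpret semi_inner fscale "H_space K L" "H_inner K L" by (rule semi_inner_H)
  have nn: "0 \<le> (LINT x|edge_measure (L i). (cmod (u i x))\<^sup>2)" for i by (rule integral_nonneg_AE) auto
  have "null u \<longleftrightarrow> (\<Sum>i<K. LINT x|edge_measure (L i). (cmod (u i x))\<^sup>2) = 0"
    using assms by (simp add: null_def nrm_def H_inner_self_Re)
  also have "\<dots> \<longleftrightarrow> (\<forall>i<K. (LINT x|edge_measure (L i). (cmod (u i x))\<^sup>2) = 0)"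
    using nn by (subst sum_nonneg_eq_0_iff) auto
  also have "\<dots> \<longleftrightarrow> (\<forall>i<K. AE x in edge_measure (L i). u i x = 0)"
  proof (intro all_cong1 imp_cong refl)
    fix i assume "i < K"
    then have "integrable (edge_measure (L i)) (\<lambda>x. (cmod (u i x))\<^sup>2)"
      using H_spaceD[OF assms] by (simp add: L2_iff)
    then show "((LINT x|edge_measure (L i). (cmod (u i x))\<^sup>2) = 0) = (AE x in edge_measure (L i). u i x = 0)"
      by (subst integral_nonneg_eq_0_iff_AE) auto
  qed
  finally show ?thesis .
qed

text \<open>
  The bridge between equality almost everywhere and the abstract notion of null vector.
\<close>

lemma H_eq_iff_null:
  assumes "u \<in> H_space K L" "v \<in> H_space K L"
  shows "H_eq K L u v \<longleftrightarrow> semi_inner.null (H_space K L) (H_inner K L) (u - v)"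
proof -
  interpret semi_inner fscale "H_space K L" "H_inner K L" by (rule semi_inner_H)
  show ?thesis using H_null_iff[OF H_closed(3)[OF assms]] by (simp add: H_eq_def)
qed

definition on_edge :: "nat \<Rightarrow> (real \<Rightarrow> complex) \<Rightarrow> family" where
  "on_edge i f = (\<lambda>j. if j = i then f else (\<lambda>x. 0))"

lemma H_inner_on_edge:
  assumes "i < K" shows "H_inner K L (on_edge i f) u = (LINT x|edge_measure (L i). cnj (f x) * u i x)"
proof -
  have "H_inner K L (on_edge i f) u = (\<Sum>j<K. if j = i then (LINT x|edge_measure (L i). cnj (f x) * u i x) else 0)"
    unfolding H_inner_def by (rule sum.cong) (auto simp: on_edge_def)
  then show ?thesis using assms by simp
qed

lemma on_edge_in_H: "f \<in> L2_interval (L i) \<Longrightarrow> on_edge i f \<in> H_space K L"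
  using L2_zero by (auto simp: H_space_def on_edge_def)

locale metric_graph =
  fixes K :: nat and L :: "nat \<Rightarrow> real" and T :: "(family \<times> family) set"
  assumes L_pos: "i < K \<Longrightarrow> 0 < L i"
    and graph: "quantum_graph K L T"
begin

lemma T_lin: "linear_operator K L T" and T_adjoint: "adjoint_op K L T = T" and T_minimal: "minimal_laplacian K L \<subseteq> T"
  using graph by (auto simp: quantum_graph_def self_adjoint_def)

lemma T_in_H': "(u, z) \<in> T \<Longrightarrow> u \<in> H_space K L \<and> z \<in> H_space K L"
  using T_lin by (auto simp: linear_operator_def)

lemma T_sym':
  assumes "(u, z) \<in> T" "(v, w) \<in> T" shows "H_inner K L z v = H_inner K L u w"
proof -
  have "(v, w) \<in> adjoint_op K L T" using assms(2) by (simp add: T_adjoint)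
  then show ?thesis using assms(1) by (auto simp: adjoint_op_def)
qed

lemma T_max':
  assumes "v \<in> H_space K L" "w \<in> H_space K L" "\<And>u z. (u, z) \<in> T \<Longrightarrow> H_inner K L z v = H_inner K L u w"
  shows "(v, w) \<in> T"
proof -
  have "(v, w) \<in> adjoint_op K L T" using assms by (auto simp: adjoint_op_def)
  then show ?thesis by (simp add: T_adjoint)
qed

text \<open>
  Test functions on a single edge are in the domain of the minimal operator, hence of \<open>T\<close>; this
  is symmetry of \<open>T\<close> tested against them.
\<close>

lemma weak_equation:
  assumes uz: "(u, z) \<in> T" and i: "i < K" and \<phi>: "\<phi> \<in> test_functions (L i)"
  shows "(LINT x|edge_measure (L i). cnj (- iter_deriv 2 \<phi> x) * u i x) = (LINT x|edge_measure (L i). cnj (\<phi> x) * z i x)"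
proof -
  have sm: "smooth \<phi>" using \<phi> by (simp add: test_functions_def)
  have d: "smooth (iter_deriv 2 \<phi>)" using smooth_second_deriv[OF sm] by blast
  have zero_test: "(\<lambda>x. 0) \<in> test_functions (L j)" if "j < K" for j
    by (simp add: test_functions_def)
  have zero2: "iter_deriv 2 (\<lambda>x. 0) = (\<lambda>x. 0)"
    by (rule iter_deriv_2_eq[of _ "\<lambda>x. 0"]) auto
  have eq: "(\<lambda>j x. - iter_deriv 2 (on_edge i \<phi> j) x) = on_edge i (\<lambda>x. - iter_deriv 2 \<phi> x)"
    by (auto simp: on_edge_def zero2 fun_eq_iff)
  have L2: "\<phi> \<in> L2_interval (L i)" "(\<lambda>x. - iter_deriv 2 \<phi> x) \<in> L2_interval (L i)"
    by (intro L2_continuous continuous_on_minus smooth_continuous sm d)+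
  have "(on_edge i \<phi>, on_edge i (\<lambda>x. - iter_deriv 2 \<phi> x)) \<in> minimal_laplacian K L"
    unfolding minimal_laplacian_def mem_Collect_eq case_prod_conv
  proof (intro conjI exI[of _ "on_edge i \<phi>"])
    show "\<forall>j<K. on_edge i \<phi> j \<in> test_functions (L j)" using \<phi> zero_test by (auto simp: on_edge_def)
  qed (auto simp: eq H_eq_def intro: on_edge_in_H L2)
  then have "(on_edge i \<phi>, on_edge i (\<lambda>x. - iter_deriv 2 \<phi> x)) \<in> T" using T_minimal by blast
  from T_sym'[OF this uz] show ?thesis using i by (simp add: H_inner_on_edge)
qed

text \<open>
  Elements of the domain solve \<open>- u'' - \<mu> u = z - \<mu> u\<close> weakly. The Green operator applied to the right-hand side
  gives one weak solution, and the difference solves the homogeneous equation.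
\<close>

lemma domain_representation:
  assumes uz: "(u, z) \<in> T" and i: "i < K"
  shows "\<exists>\<alpha> \<beta>. AE x in edge_measure (L i). u i x = green \<mu> (L i) (\<lambda>y. z i y - of_real \<mu> * u i y) x
      + (\<alpha> * of_real (cs \<mu> x) + \<beta> * of_real (sn \<mu> x))"
proof -
  let ?M = "edge_measure (L i)"
  have l: "0 < L i" using L_pos[OF i] .
  have uL: "u i \<in> L2_interval (L i)" and zL: "z i \<in> L2_interval (L i)" using T_in_H'[OF uz] H_spaceD[OF _ i] by auto
  define g where "g y = z i y - of_real \<mu> * u i y" for y
  have gL: "g \<in> L2_interval (L i)"
    using L2_add[OF zL L2_scale[OF uL, of "- of_real \<mu>"]] by (simp add: g_def[abs_def])
  obtain B where "bounded_kernel (L i) (green_kernel \<mu>) B" using green_bounded_kernel[OF l] .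
  then interpret bounded_kernel "L i" "green_kernel \<mu>" B .
  have GL: "green \<mu> (L i) g \<in> L2_interval (L i)" using kernel_op_L2[OF gL] .
  define v where "v x = u i x - green \<mu> (L i) g x" for x
  have vL: "v \<in> L2_interval (L i)"
    using L2_add[OF uL L2_scale[OF GL, of "- 1"]] by (simp add: v_def[abs_def])
  have cvL: "(\<lambda>x. cnj (v x)) \<in> L2_interval (L i)"
    using vL unfolding L2_iff by (auto intro!: borel_measurable_continuous_on[of cnj] continuous_intros)
  have "\<exists>\<alpha> \<beta>. AE x in ?M. cnj (v x) = \<alpha> * of_real (cs \<mu> x) + \<beta> * of_real (sn \<mu> x)"
  proof (rule weak_solution_classical[OF l cvL])
    fix \<phi> assume \<phi>: "\<phi> \<in> test_functions (L i)"
    have sm: "smooth \<phi>" using \<phi> by (simp add: test_functions_def)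
    have d: "smooth (iter_deriv 2 \<phi>)" using smooth_second_deriv[OF sm] by blast
    define \<psi> where "\<psi> x = - iter_deriv 2 \<phi> x - of_real \<mu> * \<phi> x" for x
    have \<phi>L: "\<phi> \<in> L2_interval (L i)" and dL: "(\<lambda>x. - iter_deriv 2 \<phi> x) \<in> L2_interval (L i)"
      by (intro L2_continuous continuous_on_minus smooth_continuous sm d)+
    have \<psi>L: "\<psi> \<in> L2_interval (L i)"
      using L2_add[OF dL L2_scale[OF \<phi>L, of "- of_real \<mu>"]] by (simp add: \<psi>_def[abs_def])
    have "(LINT x|?M. cnj (\<psi> x) * u i x) = (LINT x|?M. cnj (\<phi> x) * g x)"
    proof -
      have "(LINT x|?M. cnj (\<psi> x) * u i x)
          = (LINT x|?M. cnj (- iter_deriv 2 \<phi> x) * u i x - of_real \<mu> * (cnj (\<phi> x) * u i x))"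
        by (rule Bochner_Integration.integral_cong) (auto simp: \<psi>_def algebra_simps)
      also have "\<dots> = (LINT x|?M. cnj (- iter_deriv 2 \<phi> x) * u i x) - of_real \<mu> * (LINT x|?M. cnj (\<phi> x) * u i x)"
        using L2_mult_integrable[OF dL uL] L2_mult_integrable[OF \<phi>L uL]
        by (subst Bochner_Integration.integral_diff) auto
      also have "\<dots> = (LINT x|?M. cnj (\<phi> x) * z i x) - of_real \<mu> * (LINT x|?M. cnj (\<phi> x) * u i x)"
        using weak_equation[OF uz i \<phi>] by simp
      also have "\<dots> = (LINT x|?M. cnj (\<phi> x) * z i x - of_real \<mu> * (cnj (\<phi> x) * u i x))"
        using L2_mult_integrable[OF \<phi>L zL] L2_mult_integrable[OF \<phi>L uL]
        by (subst Bochner_Integration.integral_diff) auto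
      also have "\<dots> = (LINT x|?M. cnj (\<phi> x) * g x)"
        by (rule Bochner_Integration.integral_cong) (auto simp: g_def algebra_simps)
      finally show ?thesis .
    qed
    moreover have "(LINT x|?M. cnj (\<psi> x) * green \<mu> (L i) g x) = (LINT x|?M. cnj (\<phi> x) * g x)"
    proof -
      have "(LINT x|?M. cnj (green \<mu> (L i) g x) * \<psi> x) = (LINT y|?M. cnj (g y) * green_adj \<mu> (L i) \<psi> y)"
        by (rule kernel_op_adjoint[OF gL \<psi>L])
      also have "\<dots> = (LINT y|?M. cnj (g y) * \<phi> y)"
        using green_adj_inverts[OF l \<phi>] unfolding \<psi>_def[abs_def]
        by (intro Bochner_Integration.integral_cong) auto
      finally show ?thesis by (subst (1 2) L2_inner_swap) simp
    qed
    ultimately have "(LINT x|?M. cnj (\<psi> x) * v x) = 0"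
      unfolding v_def using L2_mult_integrable[OF \<psi>L uL] L2_mult_integrable[OF \<psi>L GL]
      by (simp add: right_diff_distrib)
    then have "(LINT x|?M. cnj (v x) * \<psi> x) = 0" by (subst L2_inner_swap) simp
    then show "(LINT x|?M. (- iter_deriv 2 \<phi> x - of_real \<mu> * \<phi> x) * cnj (v x)) = 0"
      by (simp add: \<psi>_def mult.commute)
  qed
  then obtain \<alpha> \<beta> where ae: "AE x in ?M. cnj (v x) = \<alpha> * of_real (cs \<mu> x) + \<beta> * of_real (sn \<mu> x)" by blast
  have "AE x in ?M. u i x = green \<mu> (L i) g x + (cnj \<alpha> * of_real (cs \<mu> x) + cnj \<beta> * of_real (sn \<mu> x))"
    using ae
  proof eventually_elim
    case (elim x)
    then have "v x = cnj (\<alpha> * of_real (cs \<mu> x) + \<beta> * of_real (sn \<mu> x))" by (metis complex_cnj_cnj)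
    then show ?case by (simp add: v_def algebra_simps)
  qed
  then show ?thesis unfolding g_def[abs_def] by blast
qed

lemma eigenfunction_representation:
  assumes "(u, fscale (of_real \<mu>) u) \<in> T" "i < K"
  shows "\<exists>\<alpha> \<beta>. AE x in edge_measure (L i). u i x = \<alpha> * of_real (cs \<mu> x) + \<beta> * of_real (sn \<mu> x)"
  using domain_representation[OF assms, of \<mu>] by (simp add: kernel_op_def)

text \<open>
  A function with zero Cauchy data at all ends satisfies the boundary conditions of \<open>T\<close>, whatever
  these are. In terms of integrals: by the representation of an arbitrary element \<open>p\<close> of the domain,
  \<open>\<langle>(T - \<mu>) p, green f\<rangle> = \<langle>p, f\<rangle>\<close>, because \<open>green f = green_adj f\<close> and the homogeneous part of \<open>p\<close> is
  orthogonal to \<open>f\<close>. So the pair is in the adjoint of \<open>T\<close>.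
\<close>

lemma green_in_domain:
  assumes f: "f \<in> H_space K L"
    and c: "\<And>i. i < K \<Longrightarrow> (LINT x|edge_measure (L i). of_real (cs \<mu> x) * f i x) = 0"
    and s: "\<And>i. i < K \<Longrightarrow> (LINT x|edge_measure (L i). of_real (sn \<mu> x) * f i x) = 0"
  shows "(\<lambda>i. green \<mu> (L i) (f i), fscale (of_real \<mu>) (\<lambda>i. green \<mu> (L i) (f i)) + f) \<in> T"
proof (rule T_max')
  have GL: "green \<mu> (L i) (f i) \<in> L2_interval (L i)" if i: "i < K" for i
  proof -
    obtain B where "bounded_kernel (L i) (green_kernel \<mu>) B" using green_bounded_kernel[OF L_pos[OF i]] .
    then show ?thesis using bounded_kernel.kernel_op_L2 H_spaceD[OF f i] by blast
  qed
  then show H: "(\<lambda>i. green \<mu> (L i) (f i)) \<in> H_space K L" by (simp add: H_space_def)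
  then show "fscale (of_real \<mu>) (\<lambda>i. green \<mu> (L i) (f i)) + f \<in> H_space K L"
    using f by (intro H_add H_scale)
  fix p z assume pz: "(p, z) \<in> T"
  show "H_inner K L z (\<lambda>i. green \<mu> (L i) (f i)) = H_inner K L p (fscale (of_real \<mu>) (\<lambda>i. green \<mu> (L i) (f i)) + f)"
    unfolding H_inner_def
  proof (rule sum.cong[OF refl])
    fix i assume "i \<in> {..<K}"
    then have i: "i < K" by simp
    let ?M = "edge_measure (L i)"
    let ?G = "green \<mu> (L i) (f i)"
    have l: "0 < L i" using L_pos[OF i] .
    have pL: "p i \<in> L2_interval (L i)" and zL: "z i \<in> L2_interval (L i)" and fL: "f i \<in> L2_interval (L i)"
      using T_in_H'[OF pz] H_spaceD[OF _ i] f by auto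
    define g where "g y = z i y - of_real \<mu> * p i y" for y
    have gL: "g \<in> L2_interval (L i)"
      using L2_add[OF zL L2_scale[OF pL, of "- of_real \<mu>"]] by (simp add: g_def[abs_def])
    obtain B where "bounded_kernel (L i) (green_kernel \<mu>) B" using green_bounded_kernel[OF l] .
    then interpret bounded_kernel "L i" "green_kernel \<mu>" B .
    have GgL: "green \<mu> (L i) g \<in> L2_interval (L i)" using kernel_op_L2[OF gL] .
    obtain \<alpha> \<beta> where rep: "AE x in ?M. p i x = green \<mu> (L i) g x + (\<alpha> * of_real (cs \<mu> x) + \<beta> * of_real (sn \<mu> x))"
      using domain_representation[OF pz i, of \<mu>] unfolding g_def[abs_def] by blast
    have ci: "integrable ?M (\<lambda>x. complex_of_real (cs \<mu> x) * f i x)" "integrable ?M (\<lambda>x. complex_of_real (sn \<mu> x) * f i x)"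
      by (intro continuous_mult_integrable[OF _ fL] sn_continuous cs_continuous)+
    have "(LINT x|?M. cnj (g x) * ?G x) = (LINT x|?M. cnj (g x) * green_adj \<mu> (L i) (f i) x)"
      using green_eq_adjoint[OF fL c[OF i] s[OF i]] by simp
    also have "\<dots> = (LINT x|?M. cnj (green \<mu> (L i) g x) * f i x)"
      by (rule kernel_op_adjoint[OF gL fL, symmetric])
    also have "\<dots> = (LINT x|?M. cnj (green \<mu> (L i) g x) * f i x
         + (cnj \<alpha> * (of_real (cs \<mu> x) * f i x) + cnj \<beta> * (of_real (sn \<mu> x) * f i x)))"
      using L2_mult_integrable[OF GgL fL] ci c[OF i] s[OF i] by simp
    also have "\<dots> = (LINT x|?M. cnj (p i x) * f i x)"
    proof (rule integral_cong_AE)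
      show "(\<lambda>x. cnj (green \<mu> (L i) g x) * f i x + (cnj \<alpha> * (of_real (cs \<mu> x) * f i x) + cnj \<beta> * (of_real (sn \<mu> x) * f i x))) \<in> borel_measurable ?M"
        using L2_mult_integrable[OF GgL fL] ci
        by (intro borel_measurable_integrable Bochner_Integration.integrable_add integrable_mult_right) auto
      show "(\<lambda>x. cnj (p i x) * f i x) \<in> borel_measurable ?M"
        using L2_mult_integrable[OF pL fL] by (rule borel_measurable_integrable)
      show "AE x in ?M. cnj (green \<mu> (L i) g x) * f i x + (cnj \<alpha> * (of_real (cs \<mu> x) * f i x) + cnj \<beta> * (of_real (sn \<mu> x) * f i x))
          = cnj (p i x) * f i x"
        using rep by eventually_elim (simp add: algebra_simps)
    qed
    finally have key: "(LINT x|?M. cnj (g x) * ?G x) = (LINT x|?M. cnj (p i x) * f i x)" .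
    have "(LINT x|?M. cnj (z i x) * ?G x) = (LINT x|?M. cnj (g x) * ?G x + of_real \<mu> * (cnj (p i x) * ?G x))"
      by (rule Bochner_Integration.integral_cong) (auto simp: g_def algebra_simps)
    also have "\<dots> = (LINT x|?M. cnj (p i x) * f i x) + of_real \<mu> * (LINT x|?M. cnj (p i x) * ?G x)"
      using L2_mult_integrable[OF gL GL[OF i]] L2_mult_integrable[OF pL GL[OF i]] key by simp
    also have "\<dots> = (LINT x|?M. cnj (p i x) * f i x + of_real \<mu> * (cnj (p i x) * ?G x))"
      using L2_mult_integrable[OF pL fL] L2_mult_integrable[OF pL GL[OF i]] by simp
    also have "\<dots> = (LINT x|?M. cnj (p i x) * (fscale (of_real \<mu>) (\<lambda>i. green \<mu> (L i) (f i)) + f) i x)"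
      by (rule Bochner_Integration.integral_cong) (auto simp: algebra_simps)
    finally show "(LINT x|?M. cnj (z i x) * ?G x) = (LINT x|?M. cnj (p i x) * (fscale (of_real \<mu>) (\<lambda>i. green \<mu> (L i) (f i)) + f) i x)" .
  qed
qed

text \<open>
  The classical solutions on the disjoint edges: even indices give \<open>cs\<close>, odd ones \<open>sn\<close>, on edge
  \<open>j div 2\<close>.
\<close>

definition solution_basis :: "real \<Rightarrow> nat \<Rightarrow> family" where
  "solution_basis \<mu> j = on_edge (j div 2) (\<lambda>x. of_real (if even j then cs \<mu> x else sn \<mu> x))"

lemma solution_basis_in_H: "solution_basis \<mu> j \<in> H_space K L"
  unfolding solution_basis_def
  by (intro on_edge_in_H L2_continuous) (cases "even j"; simp add: cs_continuous sn_continuous continuous_on_of_real)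

lemma solution_basis_orthogonal_iff:
  "(\<forall>j\<in>{..<2*K}. H_inner K L (solution_basis \<mu> j) f = 0) \<longleftrightarrow>
   (\<forall>i<K. (LINT x|edge_measure (L i). of_real (cs \<mu> x) * f i x) = 0 \<and> (LINT x|edge_measure (L i). of_real (sn \<mu> x) * f i x) = 0)"
  (is "?lhs \<longleftrightarrow> ?rhs")
proof
  assume h: ?lhs
  have "H_inner K L (solution_basis \<mu> (2*i)) f = 0" "H_inner K L (solution_basis \<mu> (2*i+1)) f = 0" if "i < K" for i
    using h that by auto
  then show ?rhs by (auto simp: solution_basis_def H_inner_on_edge)
next
  assume h: ?rhs
  show ?lhs
  proof
    fix j assume "j \<in> {..<2*K}"
    then have "j div 2 < K" by auto
    then show "H_inner K L (solution_basis \<mu> j) f = 0"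
      using h by (cases "even j") (auto simp: solution_basis_def H_inner_on_edge)
  qed
qed

lemma sum_pairs: "(\<Sum>j<2*n. h j) = (\<Sum>i<n. h (2*i) + h (2*i+1))" for h :: "nat \<Rightarrow> 'b::comm_monoid_add"
  by (induction n) (auto simp: add.assoc)

lemma solution_basis_sum:
  assumes "i < K"
  shows "(\<Sum>j<2*K. fscale (c j) (solution_basis \<mu> j)) i x = c (2*i) * of_real (cs \<mu> x) + c (2*i+1) * of_real (sn \<mu> x)"
proof -
  have "(\<Sum>j<2*K. fscale (c j) (solution_basis \<mu> j)) i x = (\<Sum>k<K. c (2*k) * solution_basis \<mu> (2*k) i x + c (2*k+1) * solution_basis \<mu> (2*k+1) i x)"
    unfolding family_sum_apply sum_pairs by simp
  also have "\<dots> = (\<Sum>k<K. if k = i then c (2*i) * of_real (cs \<mu> x) + c (2*i+1) * of_real (sn \<mu> x) else 0)"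
    by (rule sum.cong) (auto simp: solution_basis_def on_edge_def)
  finally show ?thesis using assms by simp
qed

lemma green_parametrix:
  "\<exists>(J::nat set) v C. finite J \<and> (\<forall>j\<in>J. v j \<in> H_space K L) \<and>
       (\<forall>f\<in>H_space K L. (\<forall>j\<in>J. H_inner K L (v j) f = 0) \<longrightarrow>
          (\<exists>u. (u, fscale (complex_of_real \<mu>) u + f) \<in> T \<and>
             semi_inner.nrm (H_inner K L) u \<le> C * semi_inner.nrm (H_inner K L) f)) \<and>
       (\<forall>u. (u, fscale (complex_of_real \<mu>) u) \<in> T \<longrightarrow>
          (\<exists>c. semi_inner.null (H_space K L) (H_inner K L) (u - (\<Sum>j\<in>J. fscale (c j) (v j)))))"
proof -
  interpret semi_inner fscale "H_space K L" "H_inner K L" by (rule semi_inner_H)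
  have "\<exists>B. bounded_kernel (L i) (green_kernel \<mu>) B" if "i < K" for i
    using green_bounded_kernel[OF L_pos[OF that]] by blast
  then obtain B where B: "\<And>i. i < K \<Longrightarrow> bounded_kernel (L i) (green_kernel \<mu>) (B i)" by metis
  have Bnn: "0 \<le> B i * L i" if "i < K" for i
    using bounded_kernel.B_nonneg[OF B[OF that]] L_pos[OF that] by simp
  define C where "C = (\<Sum>i<K. B i * L i)"
  have C: "B i * L i \<le> C" if "i < K" for i
    unfolding C_def using Bnn that by (intro member_le_sum) auto
  have Cnn: "0 \<le> C" unfolding C_def using Bnn by (intro sum_nonneg) auto
  have solve: "\<exists>u. (u, fscale (complex_of_real \<mu>) u + f) \<in> T \<and> nrm u \<le> C * nrm f"
    if f: "f \<in> H_space K L" and orth: "\<forall>j\<in>{..<2*K}. H_inner K L (solution_basis \<mu> j) f = 0" for f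
  proof (intro exI conjI)
    let ?u = "\<lambda>i. green \<mu> (L i) (f i)"
    show "(?u, fscale (complex_of_real \<mu>) ?u + f) \<in> T"
      using green_in_domain[OF f] orth solution_basis_orthogonal_iff by blast
    have "Re (H_inner K L ?u ?u) \<le> C\<^sup>2 * Re (H_inner K L f f)"
      unfolding H_inner_self_Re sum_distrib_left
    proof (rule sum_mono)
      fix i assume "i \<in> {..<K}"
      then have i: "i < K" by simp
      have "(LINT x|edge_measure (L i). (cmod (?u i x))\<^sup>2) \<le> (B i * L i)\<^sup>2 * (LINT x|edge_measure (L i). (cmod (f i x))\<^sup>2)"
        by (rule bounded_kernel.kernel_op_norm[OF B[OF i] H_spaceD[OF f i]])
      also have "\<dots> \<le> C\<^sup>2 * (LINT x|edge_measure (L i). (cmod (f i x))\<^sup>2)"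
        using C[OF i] Bnn[OF i] by (intro mult_right_mono power_mono integral_nonneg_AE) auto
      finally show "(LINT x|edge_measure (L i). (cmod (?u i x))\<^sup>2) \<le> C\<^sup>2 * (LINT x|edge_measure (L i). (cmod (f i x))\<^sup>2)" .
    qed
    then have "nrm ?u \<le> sqrt (C\<^sup>2 * Re (H_inner K L f f))" unfolding nrm_def by (rule real_sqrt_le_mono)
    also have "\<dots> = C * nrm f" using Cnn by (simp add: real_sqrt_mult nrm_def)
    finally show "nrm ?u \<le> C * nrm f" .
  qed
  have ker: "\<exists>c. null (u - (\<Sum>j\<in>{..<2*K}. fscale (c j) (solution_basis \<mu> j)))" if u: "(u, fscale (complex_of_real \<mu>) u) \<in> T" for u
  proof -
    have uH: "u \<in> H_space K L" using T_in_H'[OF u] by simp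
    have "\<forall>i. \<exists>\<alpha> \<beta>. i < K \<longrightarrow> (AE x in edge_measure (L i). u i x = \<alpha> * of_real (cs \<mu> x) + \<beta> * of_real (sn \<mu> x))"
      using eigenfunction_representation[OF u] by blast
    then obtain \<alpha> \<beta> where ab: "\<And>i. i < K \<Longrightarrow> AE x in edge_measure (L i). u i x = \<alpha> i * of_real (cs \<mu> x) + \<beta> i * of_real (sn \<mu> x)"
      by metis
    define c where "c j = (if even j then \<alpha> (j div 2) else \<beta> (j div 2))" for j
    have "u - (\<Sum>j\<in>{..<2*K}. fscale (c j) (solution_basis \<mu> j)) \<in> H_space K L"
      using uH solution_basis_in_H by auto
    then have "null (u - (\<Sum>j\<in>{..<2*K}. fscale (c j) (solution_basis \<mu> j)))"
    proof (subst H_null_iff, assumption, intro allI impI)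
      fix i assume i: "i < K"
      show "AE x in edge_measure (L i). (u - (\<Sum>j<2*K. fscale (c j) (solution_basis \<mu> j))) i x = 0"
        using ab[OF i] by eventually_elim (simp add: solution_basis_sum[OF i], simp add: c_def)
    qed
    then show ?thesis by blast
  qed
  show ?thesis
  proof (intro exI[of _ "{..<2*K}"] exI[of _ "solution_basis \<mu>"] exI[of _ C] conjI ballI impI allI)
    show "solution_basis \<mu> j \<in> H_space K L" for j by (rule solution_basis_in_H)
    show "\<exists>u. (u, fscale (complex_of_real \<mu>) u + f) \<in> T \<and> nrm u \<le> C * nrm f"
      if "f \<in> H_space K L" "\<forall>j\<in>{..<2*K}. H_inner K L (solution_basis \<mu> j) f = 0" for f
      using that by (rule solve)
    show "\<exists>c. null (u - (\<Sum>j\<in>{..<2*K}. fscale (c j) (solution_basis \<mu> j)))"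
      if "(u, fscale (complex_of_real \<mu>) u) \<in> T" for u using that by (rule ker)
  qed simp
qed

sublocale selfadjoint_operator fscale "H_space K L" "H_inner K L" T
proof -
  interpret semi_inner fscale "H_space K L" "H_inner K L" by (rule semi_inner_H)
  show "selfadjoint_operator fscale (H_space K L) (H_inner K L) T"
  proof
    show "(0, 0) \<in> T" using T_lin by (simp add: linear_operator_def zero_fun_def)
    show "(u + u', z + z') \<in> T" if "(u, z) \<in> T" "(u', z') \<in> T" for u z u' z'
      using T_lin that by (simp add: linear_operator_def plus_fun_def)
    show "(fscale c u, fscale c z) \<in> T" if "(u, z) \<in> T" for u z c
      using T_lin that by (simp add: linear_operator_def fscale_def)
  qed (fact T_in_H' T_sym' T_max' green_parametrix)+
qed

end

section \<open>Upper bound for the number of eigenfunctions\<close>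

text \<open>
  Since \<open>k * (q - p) < pi\<close>, some solution \<open>sin (\<theta> x)\<close> of \<open>- y'' = k\<^sup>2 y\<close> has no zero in the interval. Its logarithmic
  derivative \<open>\<rho>\<close> satisfies the Riccati equation \<open>\<rho>' = - k\<^sup>2 - \<rho>\<^sup>2\<close>, which turns the integrand into
  \<open>(a' - \<rho> a)\<^sup>2\<close> plus the derivative of \<open>\<rho> a\<^sup>2 - a a'\<close>. The latter vanishes at both ends.
\<close>

lemma picone_inequality:
  fixes a :: "real \<Rightarrow> real"
  assumes a: "\<And>x. (a has_real_derivative a' x) (at x)" "\<And>x. (a' has_real_derivative a'' x) (at x)"
    and cont: "continuous_on UNIV a''"
    and k: "0 < k" "p \<le> q" "k * (q - p) < pi" and zero: "a p = 0" "a q = 0"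
  shows "0 \<le> integral {p..q} (\<lambda>x. - a x * a'' x - k\<^sup>2 * (a x)\<^sup>2)"
proof -
  \<comment> \<open>The phase centres the arc \<open>[\<theta> p, \<theta> q]\<close>, of length less than \<open>pi\<close>, in \<open>(0, pi)\<close>.\<close>
  define \<delta> where "\<delta> = (pi - k * (q - p)) / 2"
  define \<theta> where "\<theta> x = k * (x - p) + \<delta>" for x
  define \<rho> where "\<rho> x = k * cos (\<theta> x) / sin (\<theta> x)" for x
  have sin_pos: "0 < sin (\<theta> x)" if "x \<in> {p..q}" for x
  proof (rule sin_gt_zero)
    have 1: "0 \<le> k * (x - p)" "k * (x - p) \<le> k * (q - p)" using that k by auto
    show "0 < \<theta> x" using 1 k(3) unfolding \<theta>_def \<delta>_def by argo
    show "\<theta> x < pi" using 1 k(3) unfolding \<theta>_def \<delta>_def by argo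
  qed
  have \<rho>: "(\<rho> has_real_derivative - k\<^sup>2 - (\<rho> x)\<^sup>2) (at x)" if "x \<in> {p..q}" for x
  proof -
    have s: "sin (\<theta> x) \<noteq> 0" using sin_pos[OF that] by simp
    have \<theta>: "(\<theta> has_real_derivative k) (at x)"
      unfolding \<theta>_def[abs_def] by (auto intro!: derivative_eq_intros)
    have "(\<rho> has_real_derivative (k * (- sin (\<theta> x) * k) * sin (\<theta> x) - k * cos (\<theta> x) * (cos (\<theta> x) * k)) / (sin (\<theta> x) * sin (\<theta> x))) (at x)"
      unfolding \<rho>_def[abs_def] using s by (auto intro!: derivative_eq_intros DERIV_chain'[OF \<theta>] simp: \<theta>)
    also have "(k * (- sin (\<theta> x) * k) * sin (\<theta> x) - k * cos (\<theta> x) * (cos (\<theta> x) * k)) / (sin (\<theta> x) * sin (\<theta> x)) = - k\<^sup>2 - (\<rho> x)\<^sup>2"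
      using s by (simp add: \<rho>_def field_simps power2_eq_square)
    finally show ?thesis .
  qed
  define A where "A x = \<rho> x * (a x)\<^sup>2 - a x * a' x" for x
  define A' where "A' x = ((- k\<^sup>2 - (\<rho> x)\<^sup>2) * (a x)\<^sup>2 + 2 * \<rho> x * a x * a' x) - (a' x * a' x + a x * a'' x)" for x
  have "(A' has_integral (A q - A p)) {p..q}"
  proof (rule fundamental_theorem_of_calculus[OF k(2)])
    fix x assume x: "x \<in> {p..q}"
    have "(A has_real_derivative A' x) (at x)"
      unfolding A_def[abs_def] A'_def
      by (rule derivative_eq_intros \<rho>[OF x] a refl)+ (simp add: algebra_simps power2_eq_square)
    then show "(A has_vector_derivative A' x) (at x within {p..q})"
      by (simp add: has_real_derivative_iff_has_vector_derivative has_vector_derivative_at_within)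
  qed
  moreover have "A q - A p = 0" using zero by (simp add: A_def)
  ultimately have A': "(A' has_integral 0) {p..q}" by simp
  have ca: "continuous_on UNIV a" using a(1) by (meson DERIV_isCont continuous_at_imp_continuous_on)
  have "(\<lambda>x. - a x * a'' x - k\<^sup>2 * (a x)\<^sup>2) integrable_on {p..q}"
    by (intro integrable_continuous_real continuous_intros continuous_on_subset[OF ca] continuous_on_subset[OF cont]) auto
  then have int: "((\<lambda>x. - a x * a'' x - k\<^sup>2 * (a x)\<^sup>2) has_integral integral {p..q} (\<lambda>x. - a x * a'' x - k\<^sup>2 * (a x)\<^sup>2)) {p..q}"
    by (rule integrable_integral)
  show ?thesis
  proof (rule has_integral_le[OF A' int])
    fix x
    have "- a x * a'' x - k\<^sup>2 * (a x)\<^sup>2 = A' x + (a' x - \<rho> x * a x)\<^sup>2"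
      by (simp add: A'_def power2_eq_square algebra_simps)
    then show "A' x \<le> - a x * a'' x - k\<^sup>2 * (a x)\<^sup>2" by simp
  qed
qed

lemma picone_inequality_partition:
  fixes a :: "real \<Rightarrow> real"
  assumes a: "\<And>x. (a has_real_derivative a' x) (at x)" "\<And>x. (a' has_real_derivative a'' x) (at x)"
    and cont: "continuous_on UNIV a''"
    and k: "0 < k" "0 \<le> h" "k * h < pi" and zero: "\<And>j. j \<le> n \<Longrightarrow> a (real j * h) = 0"
  shows "0 \<le> integral {0..real n * h} (\<lambda>x. - a x * a'' x - k\<^sup>2 * (a x)\<^sup>2)"
  using zero
proof (induction n)
  case (Suc n)
  let ?f = "\<lambda>x. - a x * a'' x - k\<^sup>2 * (a x)\<^sup>2"
  have ca: "continuous_on UNIV a" using a(1) by (meson DERIV_isCont continuous_at_imp_continuous_on)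
  have int: "?f integrable_on {x..y}" for x y
    by (intro integrable_continuous_real continuous_intros continuous_on_subset[OF ca] continuous_on_subset[OF cont]) auto
  have "integral {0..real n * h} ?f + integral {real n * h..real (Suc n) * h} ?f = integral {0..real (Suc n) * h} ?f"
    using k int by (intro Henstock_Kurzweil_Integration.integral_combine) (auto simp: algebra_simps)
  moreover have "0 \<le> integral {0..real n * h} ?f" using Suc by simp
  moreover have "0 \<le> integral {real n * h..real (Suc n) * h} ?f"
    using k Suc.prems[of n] Suc.prems[of "Suc n"]
    by (intro picone_inequality[OF a cont]) (auto simp: algebra_simps)
  ultimately show ?case by linarith
qed simp

lemma ex_between_finite:
  fixes s :: real
  assumes "finite S" "\<And>x. x \<in> S \<Longrightarrow> s < x"
  shows "\<exists>k>s. \<forall>x\<in>S. k < x"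
proof (cases "S = {}")
  case True
  then show ?thesis by (intro exI[of _ "s + 1"]) auto
next
  case False
  then have "s < Min S" using assms by simp
  then obtain k where "s < k" "k < Min S" using dense by blast
  then show ?thesis using assms False by (intro exI[of _ k]) auto
qed

context semi_inner
begin

lemma orthonormal_ip_sums:
  assumes "finite I" "orthonormal e I"
  shows "ip (\<Sum>j\<in>I. b j \<odot> e j) (\<Sum>j\<in>I. c j \<odot> e j) = (\<Sum>j\<in>I. cnj (b j) * c j)"
proof -
  have "(\<Sum>j\<in>I. c j \<odot> e j) \<in> H" using assms by (auto simp: orthonormal_in_H)
  then have "ip (\<Sum>j\<in>I. b j \<odot> e j) (\<Sum>j\<in>I. c j \<odot> e j) = (\<Sum>j\<in>I. cnj (b j) * ip (e j) (\<Sum>j\<in>I. c j \<odot> e j))"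
    using assms by (intro ip_sum_left) (auto simp: orthonormal_in_H)
  then show ?thesis using orthonormal_ip_sum[OF assms] by (simp cong: sum.cong)
qed

end

lemma has_real_derivative_Re_Im:
  assumes "(g has_vector_derivative g') (at x)"
  shows "((\<lambda>x. Re (g x)) has_real_derivative Re g') (at x)" "((\<lambda>x. Im (g x)) has_real_derivative Im g') (at x)"
  using bounded_linear.has_vector_derivative[OF bounded_linear_Re assms]
    bounded_linear.has_vector_derivative[OF bounded_linear_Im assms]
  by (simp_all add: has_real_derivative_iff_has_vector_derivative)

text \<open>
  Picone's inequality for real and imaginary part, on each of the \<open>n\<close> pieces.
\<close>

lemma energy_lower_bound:
  fixes g :: "real \<Rightarrow> complex"
  assumes g: "\<And>x. (g has_vector_derivative g' x) (at x)" "\<And>x. (g' has_vector_derivative g'' x) (at x)"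
    and cont: "continuous_on UNIV g''" and l: "0 < l" "0 < n" and k: "0 < k" "k * l < real n * pi"
    and zero: "\<And>j. j \<le> n \<Longrightarrow> g (real j * (l / real n)) = 0"
  shows "k\<^sup>2 * (LINT x|edge_measure l. (cmod (g x))\<^sup>2) \<le> Re (LINT x|edge_measure l. cnj (g x) * - g'' x)"
proof -
  let ?h = "l / real n"
  have h: "0 \<le> ?h" "k * ?h < pi" using l k by (auto simp: divide_less_eq mult.commute)
  have nl: "real n * ?h = l" using l by simp
  have cg: "continuous_on A g" for A
    using g(1) by (intro continuous_at_imp_continuous_on ballI) (rule has_vector_derivative_continuous)
  have cg'': "continuous_on A g''" for A using cont by (rule continuous_on_subset) simp
  have re: "0 \<le> integral {0..l} (\<lambda>x. - Re (g x) * Re (g'' x) - k\<^sup>2 * (Re (g x))\<^sup>2)"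
    using picone_inequality_partition[OF has_real_derivative_Re_Im(1)[OF g(1)] has_real_derivative_Re_Im(1)[OF g(2)] _ k(1) h, of n]
      zero cont nl by (simp add: continuous_on_Re)
  have im: "0 \<le> integral {0..l} (\<lambda>x. - Im (g x) * Im (g'' x) - k\<^sup>2 * (Im (g x))\<^sup>2)"
    using picone_inequality_partition[OF has_real_derivative_Re_Im(2)[OF g(1)] has_real_derivative_Re_Im(2)[OF g(2)] _ k(1) h, of n]
      zero cont nl by (simp add: continuous_on_Im)
  have "0 \<le> integral {0..l} (\<lambda>x. - Re (g x) * Re (g'' x) - k\<^sup>2 * (Re (g x))\<^sup>2)
      + integral {0..l} (\<lambda>x. - Im (g x) * Im (g'' x) - k\<^sup>2 * (Im (g x))\<^sup>2)" using re im by simp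
  also have "\<dots> = integral {0..l} (\<lambda>x. (- Re (g x) * Re (g'' x) - k\<^sup>2 * (Re (g x))\<^sup>2)
      + (- Im (g x) * Im (g'' x) - k\<^sup>2 * (Im (g x))\<^sup>2))"
    by (intro Henstock_Kurzweil_Integration.integral_add[symmetric] integrable_continuous_real continuous_intros cg cg'')
  also have "\<dots> = integral {0..l} (\<lambda>x. Re (cnj (g x) * - g'' x - of_real (k\<^sup>2) * (cnj (g x) * g x)))"
    by (rule Henstock_Kurzweil_Integration.integral_cong) (simp add: power2_eq_square algebra_simps)
  also have "\<dots> = Re (integral {0..l} (\<lambda>x. cnj (g x) * - g'' x - of_real (k\<^sup>2) * (cnj (g x) * g x)))"
    by (rule integral_linear[OF integrable_continuous_real bounded_linear_Re, unfolded o_def])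
      (intro continuous_intros cg cg'')
  also have "integral {0..l} (\<lambda>x. cnj (g x) * - g'' x - of_real (k\<^sup>2) * (cnj (g x) * g x))
      = (LINT x|edge_measure l. cnj (g x) * - g'' x - of_real (k\<^sup>2) * (cnj (g x) * g x))"
    by (intro LINT_continuous[symmetric] continuous_intros cg cg'')
  also have "\<dots> = (LINT x|edge_measure l. cnj (g x) * - g'' x) - of_real (k\<^sup>2) * (LINT x|edge_measure l. cnj (g x) * g x)"
  proof -
    have "integrable (edge_measure l) (\<lambda>x. cnj (g x) * - g'' x)" "integrable (edge_measure l) (\<lambda>x. cnj (g x) * g x)"
      by (intro L2_mult_integrable L2_continuous continuous_intros cg cg'')+
    then show ?thesis by (subst Bochner_Integration.integral_diff) auto
  qed
  also have "(LINT x|edge_measure l. cnj (g x) * g x) = of_real (LINT x|edge_measure l. (cmod (g x))\<^sup>2)"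
    unfolding integral_complex_of_real[symmetric]
    by (rule Bochner_Integration.integral_cong) (auto simp: complex_norm_square mult.commute simp del: of_real_power)
  finally show ?thesis by (simp del: of_real_power)
qed

lemma Re_cnj_mult_self:
  "Re (cnj z * z) = (cmod z)\<^sup>2" "Re (cnj z * (of_real a * z)) = a * (cmod z)\<^sup>2"
  "Re (cnj (z * of_real a) * z) = a * (cmod z)\<^sup>2"
  unfolding cmod_power2 by (simp_all add: power2_eq_square algebra_simps)

context metric_graph
begin

text \<open>
  The number of Dirichlet eigenvalues \<open>(m * pi / L i)\<^sup>2\<close>, with \<open>m > 0\<close>, up to \<open>E\<close> on the disconnected
  edges.
\<close>

definition dirichlet_count :: "real \<Rightarrow> nat" where
  "dirichlet_count E = (\<Sum>i<K. nat \<lfloor>L i * sqrt (max E 0) / pi\<rfloor>)"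

text \<open>
  With more eigenfunctions than evaluation points there would be a non-trivial combination
  vanishing at all points. By Picone's inequality its Rayleigh quotient is at least \<open>k\<^sup>2\<close>, as a
  combination of the eigenfunctions it is at most \<open>E < k\<^sup>2\<close>.
\<close>

lemma eigenfunction_count_upper:
  fixes E :: real
  assumes fin: "finite I" and on: "orthonormal e I" and ev: "\<And>j. j \<in> I \<Longrightarrow> e j \<in> eig (\<nu> j)" "\<And>j. j \<in> I \<Longrightarrow> \<nu> j \<le> E"
  shows "card I \<le> 2 * K + dirichlet_count E"
proof (rule ccontr)
  assume big: "\<not> ?thesis"
  define n where "n i = nat \<lfloor>L i * sqrt (max E 0) / pi\<rfloor> + 1" for i
  have n_pos: "0 < n i" for i by (simp add: n_def)
  have n_gt: "sqrt (max E 0) < real (n i) * pi / L i" if i: "i < K" for i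
  proof -
    have "0 \<le> L i * sqrt (max E 0) / pi" using L_pos[OF i] by simp
    then have "L i * sqrt (max E 0) / pi < real (n i)" unfolding n_def by linarith
    then show ?thesis using L_pos[OF i] by (simp add: field_simps)
  qed
  obtain k where k: "sqrt (max E 0) < k" "\<And>i. i < K \<Longrightarrow> k < real (n i) * pi / L i"
    using ex_between_finite[of "(\<lambda>i. real (n i) * pi / L i) ` {..<K}" "sqrt (max E 0)"] n_gt by auto
  have k_pos: "0 < k" using k(1) real_sqrt_ge_zero[of "max E 0"] by linarith
  have k_sq: "E < k\<^sup>2"
  proof -
    have "max E 0 = (sqrt (max E 0))\<^sup>2" by simp
    also have "\<dots> < k\<^sup>2" using k(1) by (intro power_strict_mono) auto
    finally show ?thesis by simp
  qed
  have eT: "(e j, fscale (of_real (\<nu> j)) (e j)) \<in> T" if "j \<in> I" for j using ev(1)[OF that] by (simp add: eig_def)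
  have "\<forall>j i. \<exists>\<alpha> \<beta>. j \<in> I \<and> i < K \<longrightarrow> (AE x in edge_measure (L i). e j i x = \<alpha> * of_real (cs (\<nu> j) x) + \<beta> * of_real (sn (\<nu> j) x))"
    using eigenfunction_representation[OF eT] by blast
  then obtain \<alpha> \<beta> where ab: "\<And>j i. j \<in> I \<Longrightarrow> i < K \<Longrightarrow>
      AE x in edge_measure (L i). e j i x = \<alpha> j i * of_real (cs (\<nu> j) x) + \<beta> j i * of_real (sn (\<nu> j) x)" by metis
  define \<psi> where "\<psi> j i x = \<alpha> j i * of_real (cs (\<nu> j) x) + \<beta> j i * of_real (sn (\<nu> j) x)" for j i x
  define \<psi>' where "\<psi>' j i x = \<beta> j i * of_real (cs (\<nu> j) x) + (- of_real (\<nu> j) * \<alpha> j i) * of_real (sn (\<nu> j) x)" for j i x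
  have d1: "(\<psi> j i has_vector_derivative \<psi>' j i x) (at x)" for j i x
    unfolding \<psi>_def[abs_def] \<psi>'_def
    by (rule has_vector_derivative_eq_rhs[OF has_vector_derivative_add[OF
          has_vector_derivative_mult_right[OF cs_vderiv] has_vector_derivative_mult_right[OF sn_vderiv]]]) simp
  have d2: "(\<psi>' j i has_vector_derivative - of_real (\<nu> j) * \<psi> j i x) (at x)" for j i x
    unfolding \<psi>_def \<psi>'_def[abs_def]
    by (rule has_vector_derivative_eq_rhs[OF has_vector_derivative_add[OF
          has_vector_derivative_mult_right[OF cs_vderiv] has_vector_derivative_mult_right[OF sn_vderiv]]])
      (simp add: algebra_simps)
  have \<psi>_cont: "continuous_on A (\<psi> j i)" for A j i
    using d1 by (intro continuous_at_imp_continuous_on ballI) (rule has_vector_derivative_continuous)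
  \<comment> \<open>Edge \<open>i\<close> has \<open>n i + 1\<close> equally spaced points, the two ends included.\<close>
  define J where "J = (SIGMA i:{..<K}. {..n i})"
  have "card J = (\<Sum>i<K. n i + 1)" unfolding J_def by simp
  also have "\<dots> = dirichlet_count E + (\<Sum>i<K. 2)"
    unfolding dirichlet_count_def sum.distrib[symmetric] by (rule sum.cong) (auto simp: n_def)
  also have "\<dots> = 2 * K + dirichlet_count E" by simp
  finally have "card J < card I" using big by simp
  moreover have "finite J" by (simp add: J_def)
  ultimately obtain c where c: "\<exists>j\<in>I. c j \<noteq> 0" and
    c0: "\<And>p. p \<in> J \<Longrightarrow> (\<Sum>j\<in>I. c j * \<psi> j (fst p) (real (snd p) * (L (fst p) / real (n (fst p))))) = 0"
    using homogeneous_system_nontrivial[OF _ fin, of J "\<lambda>p j. \<psi> j (fst p) (real (snd p) * (L (fst p) / real (n (fst p))))"] by blast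
  define u where "u = (\<Sum>j\<in>I. fscale (c j) (e j))"
  define w where "w = (\<Sum>j\<in>I. fscale (of_real (\<nu> j) * c j) (e j))"
  define g where "g i x = (\<Sum>j\<in>I. c j * \<psi> j i x)" for i x
  define g' where "g' i x = (\<Sum>j\<in>I. c j * \<psi>' j i x)" for i x
  define g'' where "g'' i x = (\<Sum>j\<in>I. c j * (- of_real (\<nu> j) * \<psi> j i x))" for i x
  have uH: "u \<in> H_space K L" and wH: "w \<in> H_space K L"
    unfolding u_def w_def using orthonormal_in_H[OF on] by auto
  have u_g: "AE x in edge_measure (L i). u i x = g i x \<and> w i x = - g'' i x" if i: "i < K" for i
  proof -
    have "AE x in edge_measure (L i). \<forall>j\<in>I. e j i x = \<psi> j i x"
      using ab i fin unfolding \<psi>_def by (intro AE_finite_allI) auto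
    then show ?thesis
      by eventually_elim
        (simp add: u_def w_def g_def g''_def family_sum_apply sum_negf[symmetric] mult_ac cong: sum.cong)
  qed
  have edge: "k\<^sup>2 * (LINT x|edge_measure (L i). (cmod (u i x))\<^sup>2) \<le> Re (LINT x|edge_measure (L i). cnj (u i x) * w i x)"
    if i: "i < K" for i
  proof -
    have kl: "k * L i < real (n i) * pi" using k(2)[OF i] L_pos[OF i] by (simp add: field_simps)
    have cg'': "continuous_on UNIV (g'' i)" unfolding g''_def[abs_def] by (intro continuous_intros \<psi>_cont)
    have cg: "continuous_on UNIV (g i)" unfolding g_def[abs_def] by (intro continuous_intros \<psi>_cont)
    have "k\<^sup>2 * (LINT x|edge_measure (L i). (cmod (g i x))\<^sup>2) \<le> Re (LINT x|edge_measure (L i). cnj (g i x) * - g'' i x)"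
    proof (rule energy_lower_bound[OF _ _ cg'' L_pos[OF i] n_pos k_pos kl])
      show "(g i has_vector_derivative g' i x) (at x)" for x
        unfolding g_def[abs_def] g'_def by (intro has_vector_derivative_sum has_vector_derivative_mult_right d1)
      show "(g' i has_vector_derivative g'' i x) (at x)" for x
        unfolding g'_def[abs_def] g''_def by (intro has_vector_derivative_sum has_vector_derivative_mult_right d2)
      show "g i (real j * (L i / real (n i))) = 0" if "j \<le> n i" for j
        using c0[of "(i, j)"] i that by (simp add: J_def g_def)
    qed
    moreover have "(LINT x|edge_measure (L i). (cmod (u i x))\<^sup>2) = (LINT x|edge_measure (L i). (cmod (g i x))\<^sup>2)"
      using u_g[OF i] H_spaceD[OF uH i] L2_continuous[OF continuous_on_subset[OF cg]]
      by (intro integral_cong_AE) (auto simp: L2_iff)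
    moreover have "(LINT x|edge_measure (L i). cnj (u i x) * w i x) = (LINT x|edge_measure (L i). cnj (g i x) * - g'' i x)"
    proof (rule integral_cong_AE)
      show "(\<lambda>x. cnj (u i x) * w i x) \<in> borel_measurable (edge_measure (L i))"
        by (rule borel_measurable_integrable[OF L2_mult_integrable[OF H_spaceD[OF uH i] H_spaceD[OF wH i]]])
      show "(\<lambda>x. cnj (g i x) * - g'' i x) \<in> borel_measurable (edge_measure (L i))"
        by (rule borel_measurable_integrable[OF L2_mult_integrable])
          (intro L2_continuous continuous_on_minus continuous_on_subset[OF cg] continuous_on_subset[OF cg'']; simp)+
      show "AE x in edge_measure (L i). cnj (u i x) * w i x = cnj (g i x) * - g'' i x"
        using u_g[OF i] by eventually_elim simp
    qed
    ultimately show ?thesis by simp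
  qed
  have "k\<^sup>2 * Re (H_inner K L u u) \<le> Re (H_inner K L u w)"
  proof -
    have "k\<^sup>2 * Re (H_inner K L u u) = (\<Sum>i<K. k\<^sup>2 * (LINT x|edge_measure (L i). (cmod (u i x))\<^sup>2))"
      by (simp add: H_inner_self_Re sum_distrib_left)
    also have "\<dots> \<le> (\<Sum>i<K. Re (LINT x|edge_measure (L i). cnj (u i x) * w i x))"
      using edge by (intro sum_mono) auto
    also have "\<dots> = Re (H_inner K L u w)" by (simp add: H_inner_def)
    finally show ?thesis .
  qed
  moreover have "Re (H_inner K L u u) = (\<Sum>j\<in>I. (cmod (c j))\<^sup>2)"
    unfolding u_def orthonormal_ip_sums[OF fin on] Re_sum Re_cnj_mult_self ..
  moreover have "Re (H_inner K L u w) = (\<Sum>j\<in>I. \<nu> j * (cmod (c j))\<^sup>2)"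
    unfolding u_def w_def orthonormal_ip_sums[OF fin on] Re_sum Re_cnj_mult_self ..
  moreover have "(\<Sum>j\<in>I. \<nu> j * (cmod (c j))\<^sup>2) \<le> E * (\<Sum>j\<in>I. (cmod (c j))\<^sup>2)"
    unfolding sum_distrib_left using ev(2) by (intro sum_mono mult_right_mono) auto
  moreover have pos: "0 < (\<Sum>j\<in>I. (cmod (c j))\<^sup>2)"
  proof -
    obtain j where "j \<in> I" "c j \<noteq> 0" using c by blast
    then show ?thesis using fin by (intro sum_pos2[of I j]) auto
  qed
  ultimately have "k\<^sup>2 * (\<Sum>j\<in>I. (cmod (c j))\<^sup>2) \<le> E * (\<Sum>j\<in>I. (cmod (c j))\<^sup>2)"
    by (metis (no_types) order_trans)
  then show False using k_sq pos by simp
qed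

end

section \<open>Lower bound for the number of eigenfunctions\<close>

text \<open>
  For different frequencies the integrand is, up to the factor \<open>b\<^sup>2 - a\<^sup>2\<close>, the derivative of the
  Wronskian, which vanishes at both ends.
\<close>

lemma has_integral_sine_product:
  fixes l :: real
  assumes l: "0 < l" and mn: "0 < m" "0 < n"
  shows "((\<lambda>x. sin (real m * pi / l * x) * sin (real n * pi / l * x)) has_integral (if m = n then l / 2 else 0)) {0..l}"
proof (cases "m = n")
  case True
  define a where "a = real m * pi / l"
  have a: "a > 0" using l mn by (simp add: a_def)
  define F where "F x = x / 2 - sin (2 * (a * x)) / (4 * a)" for x
  have "((\<lambda>x. sin (a * x) * sin (a * x)) has_integral (F l - F 0)) {0..l}"
  proof (rule fundamental_theorem_of_calculus)
    fix x assume "x \<in> {0..l}"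
    have "(F has_real_derivative 1 / 2 - cos (2 * (a * x)) / 2) (at x)"
      unfolding F_def[abs_def] using a by (auto intro!: derivative_eq_intros simp: field_simps)
    moreover have "1 / 2 - cos (2 * (a * x)) / 2 = sin (a * x) * sin (a * x)"
      by (simp add: cos_double_sin power2_eq_square diff_divide_distrib)
    ultimately show "(F has_vector_derivative sin (a * x) * sin (a * x)) (at x within {0..l})"
      by (simp add: has_real_derivative_iff_has_vector_derivative has_vector_derivative_at_within)
  qed (use l in simp)
  moreover have "F l - F 0 = l / 2"
  proof -
    have "2 * (a * l) = 2 * pi * real m" using l by (simp add: a_def)
    then have "sin (2 * (a * l)) = 0" by (metis sin_integer_2pi Ints_of_nat)
    then show ?thesis by (simp add: F_def)
  qed
  ultimately show ?thesis using True by (simp add: a_def)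
next
  case False
  define a b where "a = real m * pi / l" and "b = real n * pi / l"
  have ab: "b\<^sup>2 - a\<^sup>2 \<noteq> 0"
  proof
    assume "b\<^sup>2 - a\<^sup>2 = 0"
    then have "b = a" using l mn by (simp add: a_def b_def power2_eq_iff_nonneg)
    then show False using False l by (simp add: a_def b_def)
  qed
  define F where "F x = (sin (b * x) * (cos (a * x) * a) - sin (a * x) * (cos (b * x) * b)) / (b\<^sup>2 - a\<^sup>2)" for x
  have "((\<lambda>x. sin (a * x) * sin (b * x)) has_integral (F l - F 0)) {0..l}"
  proof (rule fundamental_theorem_of_calculus)
    fix x assume "x \<in> {0..l}"
    have "((\<lambda>x. sin (b * x) * (cos (a * x) * a) - sin (a * x) * (cos (b * x) * b)) has_real_derivative
        (b\<^sup>2 - a\<^sup>2) * (sin (a * x) * sin (b * x))) (at x)"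
      by (auto intro!: derivative_eq_intros simp: algebra_simps power2_eq_square)
    from DERIV_cdivide[OF this, of "b\<^sup>2 - a\<^sup>2"]
    have "(F has_real_derivative sin (a * x) * sin (b * x)) (at x)"
      using ab by (simp add: F_def[abs_def])
    then show "(F has_vector_derivative sin (a * x) * sin (b * x)) (at x within {0..l})"
      by (simp add: has_real_derivative_iff_has_vector_derivative has_vector_derivative_at_within)
  qed (use l in simp)
  moreover have "F l - F 0 = 0"
  proof -
    have "a * l = real m * pi" "b * l = real n * pi" using l by (auto simp: a_def b_def)
    then show ?thesis by (simp add: F_def)
  qed
  ultimately show ?thesis using False by (simp add: a_def b_def)
qed

text \<open>
  For \<open>\<mu> = 0\<close> the classical solutions are the affine functions. Orthogonality of \<open>f = - U''\<close> to them
  forces \<open>U'\<close> to vanish at both ends, so \<open>U\<close> is the solution of the initial value problem.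
\<close>

lemma green_zero_recovers:
  fixes U :: "real \<Rightarrow> complex"
  assumes U: "\<And>x. (U has_vector_derivative U' x) (at x)" "\<And>x. (U' has_vector_derivative - f x) (at x)"
    and cont: "continuous_on UNIV f" and l: "0 < l" and ends: "U 0 = 0" "U l = 0"
    and c: "(LINT x|edge_measure l. of_real (cs 0 x) * f x) = 0"
    and s: "(LINT x|edge_measure l. of_real (sn 0 x) * f x) = 0"
    and x: "0 < x" "x < l"
  shows "green 0 l f x = U x"
proof -
  have cf: "continuous_on A f" for A using cont by (rule continuous_on_subset) simp
  have of: "((\<lambda>t. complex_of_real t) has_vector_derivative 1) (at t)" for t
    using has_vector_derivative_of_real[OF DERIV_ident] by simp
  have I1: "((\<lambda>t. f t) has_integral (- U' l - - U' 0)) {0..l}"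
    using l has_vector_derivative_minus[OF U(2)]
    by (intro fundamental_theorem_of_calculus) (auto intro: has_vector_derivative_at_within)
  have "((\<lambda>t. of_real t * f t) has_integral ((U l - of_real l * U' l) - (U 0 - of_real 0 * U' 0))) {0..l}"
  proof (rule fundamental_theorem_of_calculus)
    fix t assume "t \<in> {0..l}"
    have "((\<lambda>t. U t - of_real t * U' t) has_vector_derivative U' t - (of_real t * - f t + 1 * U' t)) (at t)"
      by (intro has_vector_derivative_diff has_vector_derivative_mult of U)
    then show "((\<lambda>t. U t - of_real t * U' t) has_vector_derivative of_real t * f t) (at t within {0..l})"
      by (simp add: has_vector_derivative_at_within)
  qed (use l in simp)
  then have "of_real l * U' l = 0"
    using s LINT_continuous[of l "\<lambda>t. of_real t * f t"] ends
    by (simp add: sn_def integral_unique continuous_intros cf)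
  moreover have "U' 0 - U' l = 0"
    using c LINT_continuous[OF cf, of l] integral_unique[OF I1] by (simp add: cs_def)
  ultimately have U'0: "U' 0 = 0" using l by simp
  define h where "h t = complex_of_real (max 0 (x - t)) * - f t" for t
  have hc: "continuous_on A h" for A unfolding h_def by (intro continuous_intros cf)
  define F where "F t = of_real (x - t) * U' t + U t" for t
  have "(h has_integral (F x - F 0)) {0..x}"
  proof (rule fundamental_theorem_of_calculus)
    fix t assume t: "t \<in> {0..x}"
    have "((\<lambda>t. complex_of_real (x - t)) has_vector_derivative - 1) (at t)"
      using has_vector_derivative_diff[OF has_vector_derivative_const[of "complex_of_real x"] of[of t]] by simp
    then have "(F has_vector_derivative ((of_real (x - t) * - f t + - 1 * U' t) + U' t)) (at t)"
      unfolding F_def[abs_def] by (intro has_vector_derivative_add has_vector_derivative_mult U)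
    then show "(F has_vector_derivative h t) (at t within {0..x})"
      using t by (simp add: h_def max_def has_vector_derivative_at_within)
  qed (use x in simp)
  moreover have "(h has_integral 0) {x..l}" by (rule has_integral_is_0) (auto simp: h_def max_def)
  ultimately have "(h has_integral ((F x - F 0) + 0)) {0..l}"
    using x by (intro has_integral_combine[of 0 x l]) auto
  then have "(LINT t|edge_measure l. h t) = F x - F 0" using LINT_continuous[OF hc] by (simp add: integral_unique)
  also have "\<dots> = U x" using U'0 ends by (simp add: F_def)
  finally have "(LINT t|edge_measure l. h t) = U x" .
  moreover have "green 0 l f x = (LINT t|edge_measure l. h t)"
    unfolding kernel_op_def h_def green_kernel_def
    by (rule Bochner_Integration.integral_cong) (auto simp: sn_def)
  ultimately show ?thesis by simp
qed

context metric_graph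
begin

definition frequency :: "nat \<times> nat \<Rightarrow> real" where
  "frequency p = real (snd p) * pi / L (fst p)"

definition sine_mode :: "nat \<times> nat \<Rightarrow> family" where
  "sine_mode p = on_edge (fst p) (\<lambda>x. of_real (sqrt (2 / L (fst p)) * sin (frequency p * x)))"

lemma sine_mode_in_H: "sine_mode p \<in> H_space K L"
  unfolding sine_mode_def by (intro on_edge_in_H L2_continuous continuous_intros)

lemma orthonormal_sine_modes:
  assumes J: "\<And>p. p \<in> J \<Longrightarrow> fst p < K \<and> 0 < snd p"
  shows "orthonormal sine_mode J"
  unfolding orthonormal_def
proof (intro conjI ballI)
  fix p q assume p: "p \<in> J" and q: "q \<in> J"
  let ?i = "fst p"
  have i: "?i < K" and l: "0 < L ?i" using J[OF p] L_pos by auto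
  show "H_inner K L (sine_mode p) (sine_mode q) = (if p = q then 1 else 0)"
  proof (cases "fst q = ?i")
    case True
    let ?s = "\<lambda>x. sin (frequency p * x) * sin (frequency q * x)"
    define r where "r = sqrt (2 / L ?i)"
    have rr: "2 / L ?i = r * r" and r0: "0 \<le> r" using l by (simp_all add: r_def)
    have "H_inner K L (sine_mode p) (sine_mode q)
        = (LINT x|edge_measure (L ?i). complex_of_real (2 / L ?i * ?s x))"
      unfolding sine_mode_def[of p] H_inner_on_edge[OF i] rr
      using True by (intro Bochner_Integration.integral_cong) (auto simp: sine_mode_def on_edge_def r_def[symmetric] rr r0)
    also have "\<dots> = integral {0..L ?i} (\<lambda>x. complex_of_real (2 / L ?i * ?s x))"
      by (intro LINT_continuous continuous_intros) (use l in auto)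
    also have "((\<lambda>x. complex_of_real (2 / L ?i * ?s x)) has_integral
        complex_of_real (2 / L ?i * (if snd p = snd q then L ?i / 2 else 0))) {0..L ?i}"
      using J[OF p] J[OF q] l True unfolding frequency_def
      by (intro has_integral_of_real has_integral_mult_right) (use has_integral_sine_product in auto)
    then have "integral {0..L ?i} (\<lambda>x. complex_of_real (2 / L ?i * ?s x))
        = complex_of_real (2 / L ?i * (if snd p = snd q then L ?i / 2 else 0))" by (rule integral_unique)
    also have "\<dots> = (if p = q then 1 else 0)" using l True by (auto simp: prod_eq_iff)
    finally show ?thesis .
  next
    case False
    then show ?thesis
      unfolding sine_mode_def[of p] H_inner_on_edge[OF i] by (auto simp: sine_mode_def on_edge_def)
  qed
qed (rule sine_mode_in_H)

lemma sine_mode_derivatives: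
  defines "d \<equiv> \<lambda>p i x. if i = fst p then complex_of_real (sqrt (2 / L (fst p)) * (cos (frequency p * x) * frequency p)) else 0"
  shows "(sine_mode p i has_vector_derivative d p i x) (at x)"
    and "(d p i has_vector_derivative - of_real ((frequency p)\<^sup>2) * sine_mode p i x) (at x)"
proof -
  show "(sine_mode p i has_vector_derivative d p i x) (at x)"
  proof (cases "i = fst p")
    case True
    have "((\<lambda>x. complex_of_real (sqrt (2 / L (fst p)) * sin (frequency p * x))) has_vector_derivative
       of_real (sqrt (2 / L (fst p)) * (cos (frequency p * x) * frequency p))) (at x)"
      by (intro has_vector_derivative_of_real) (auto intro!: derivative_eq_intros)
    then show ?thesis using True by (simp add: sine_mode_def on_edge_def d_def)
  qed (simp add: sine_mode_def on_edge_def d_def)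
  show "(d p i has_vector_derivative - of_real ((frequency p)\<^sup>2) * sine_mode p i x) (at x)"
  proof (cases "i = fst p")
    case True
    have "((\<lambda>x. complex_of_real (sqrt (2 / L (fst p)) * (cos (frequency p * x) * frequency p))) has_vector_derivative
       of_real (- (frequency p)\<^sup>2 * (sqrt (2 / L (fst p)) * sin (frequency p * x)))) (at x)"
      by (intro has_vector_derivative_of_real) (auto intro!: derivative_eq_intros simp: power2_eq_square)
    then show ?thesis using True by (simp add: sine_mode_def on_edge_def d_def)
  qed (simp add: sine_mode_def on_edge_def d_def)
qed

text \<open>
  If the sine functions below \<open>sqrt E\<close> outnumber the conditions, there is a combination \<open>u\<close> of them that
  is orthogonal to the eigenvectors and whose second derivative is orthogonal to the affine
  functions. Then \<open>u\<close> is in the domain of \<open>T\<close>, and its Rayleigh quotient is less than \<open>E\<close> by construction and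
  at least \<open>E\<close> by \<open>rayleigh_bound_off_eigenvectors\<close>.
\<close>

lemma eigenfunction_count_lower:
  assumes fin: "finite I" and on: "orthonormal e I" and ev: "\<And>j. j \<in> I \<Longrightarrow> e j \<in> eig (\<nu> j)"
    and complete: "\<And>\<mu> k. \<mu> \<le> E \<Longrightarrow> k \<in> eig \<mu> \<Longrightarrow> (\<forall>j\<in>I. H_inner K L (e j) k = 0) \<Longrightarrow> null k"
    and n: "\<And>i. i < K \<Longrightarrow> real (n i) * pi < L i * sqrt E"
  shows "(\<Sum>i<K. n i) \<le> card I + 2 * K"
proof (rule ccontr)
  assume big: "\<not> ?thesis"
  define J where "J = (SIGMA i:{..<K}. {1..n i})"
  have finJ: "finite J" by (simp add: J_def)
  have J: "fst p < K \<and> 0 < snd p" "snd p \<le> n (fst p)" if "p \<in> J" for p using that by (auto simp: J_def)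
  have freq: "(frequency p)\<^sup>2 < E" if p: "p \<in> J" for p
  proof -
    let ?i = "fst p"
    have l: "0 < L ?i" using J[OF p] L_pos by blast
    have "real (snd p) * pi \<le> real (n ?i) * pi" using J(2)[OF p] by (intro mult_right_mono) auto
    then have "real (snd p) * pi < L ?i * sqrt E" using n[of ?i] J(1)[OF p] by linarith
    then have lt: "frequency p < sqrt E" using l by (simp add: frequency_def divide_less_eq mult.commute)
    have nn: "0 \<le> frequency p" using l by (simp add: frequency_def)
    then have "0 < sqrt E" using lt by linarith
    then have "0 \<le> E" by simp
    then show ?thesis using lt nn power_strict_mono[OF lt nn, of 2] by simp
  qed
  have onJ: "orthonormal sine_mode J" using J by (intro orthonormal_sine_modes) blast
  \<comment> \<open>The left summand stands for orthogonality to the eigenvectors, the right one for orthogonality of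
    the second derivative to the affine functions.\<close>
  define a where "a q p = (case q of Inl j \<Rightarrow> H_inner K L (e j) (sine_mode p)
     | Inr j \<Rightarrow> of_real ((frequency p)\<^sup>2) * H_inner K L (solution_basis 0 j) (sine_mode p))" for q p
  have "card (I <+> {..<2 * K}) < card J"
    using big fin by (simp add: card_Plus J_def)
  then obtain c where c: "\<exists>p\<in>J. c p \<noteq> 0" and c0: "\<And>q. q \<in> I <+> {..<2 * K} \<Longrightarrow> (\<Sum>p\<in>J. c p * a q p) = 0"
    using homogeneous_system_nontrivial[of "I <+> {..<2 * K}" J a] fin finJ by auto
  define u where "u = (\<Sum>p\<in>J. fscale (c p) (sine_mode p))"
  define f where "f = (\<Sum>p\<in>J. fscale (c p * of_real ((frequency p)\<^sup>2)) (sine_mode p))"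
  have uH: "u \<in> H_space K L" and fH: "f \<in> H_space K L" unfolding u_def f_def using sine_mode_in_H by auto
  have eu: "H_inner K L (e j) u = 0" if "j \<in> I" for j
    unfolding u_def using c0[OF InlI[OF that]] sine_mode_in_H orthonormal_in_H[OF on that]
    by (simp add: ip_sum_right a_def)
  have "H_inner K L (solution_basis 0 j) f = 0" if "j \<in> {..<2 * K}" for j
    unfolding f_def using c0[OF InrI[OF that]] sine_mode_in_H solution_basis_in_H
    by (simp add: ip_sum_right a_def mult.assoc)
  then have orth: "\<forall>i<K. (LINT x|edge_measure (L i). of_real (cs 0 x) * f i x) = 0 \<and> (LINT x|edge_measure (L i). of_real (sn 0 x) * f i x) = 0"
    using solution_basis_orthogonal_iff by blast
  define y where "y = (\<lambda>i. green 0 (L i) (f i))"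
  have yT: "(y, fscale (of_real 0) y + f) \<in> T"
    unfolding y_def using orth by (intro green_in_domain fH) auto
  have yH: "y \<in> H_space K L" using T_in_H'[OF yT] by simp
  have y_eq: "y i x = u i x" if i: "i < K" and x: "0 < x" "x < L i" for i x
  proof -
    let ?d = "\<lambda>p i x. if i = fst p then complex_of_real (sqrt (2 / L (fst p)) * (cos (frequency p * x) * frequency p)) else 0"
    have ui: "u i = (\<lambda>x. \<Sum>p\<in>J. c p * sine_mode p i x)" by (auto simp: u_def family_sum_apply)
    have fi: "f i = (\<lambda>x. \<Sum>p\<in>J. c p * of_real ((frequency p)\<^sup>2) * sine_mode p i x)" by (auto simp: f_def family_sum_apply)
    have cont: "continuous_on UNIV (sine_mode p i)" for p
      using sine_mode_derivatives(1) by (intro continuous_at_imp_continuous_on ballI) (rule has_vector_derivative_continuous)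
    have "green 0 (L i) (f i) x = u i x"
    proof (rule green_zero_recovers[where U' = "\<lambda>x. \<Sum>p\<in>J. c p * ?d p i x"])
      show "(u i has_vector_derivative (\<Sum>p\<in>J. c p * ?d p i t)) (at t)" for t
        unfolding ui by (intro has_vector_derivative_sum has_vector_derivative_mult_right sine_mode_derivatives(1))
      have "((\<lambda>x. \<Sum>p\<in>J. c p * ?d p i x) has_vector_derivative
          (\<Sum>p\<in>J. c p * (- of_real ((frequency p)\<^sup>2) * sine_mode p i t))) (at t)" for t
        by (intro has_vector_derivative_sum has_vector_derivative_mult_right sine_mode_derivatives(2))
      then show "((\<lambda>x. \<Sum>p\<in>J. c p * ?d p i x) has_vector_derivative - f i t) (at t)" for t
        unfolding fi by (simp add: sum_negf mult.assoc)
      show "continuous_on UNIV (f i)" unfolding fi by (intro continuous_intros cont)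
      show "u i 0 = 0" unfolding ui by (intro sum.neutral) (auto simp: sine_mode_def on_edge_def)
      have "sine_mode p i (L i) = 0" for p
        using L_pos[OF i] by (auto simp: sine_mode_def on_edge_def frequency_def)
      then show "u i (L i) = 0" unfolding ui by simp
    qed (use orth i x L_pos in auto)
    then show ?thesis by (simp add: y_def)
  qed
  have "u - y \<in> H_space K L" using uH yH by simp
  then have "null (u - y)"
    by (subst H_null_iff) (auto intro!: AE_I2 simp: y_eq)
  then have uf: "(u, f) \<in> T" by (rule T_null[OF yT]) (simp add: null_closed(1))
  have "E * (nrm u)\<^sup>2 \<le> Re (H_inner K L f u)"
    by (rule rayleigh_bound_off_eigenvectors[where I = I and e = e and \<nu> = \<nu>])
      (fact fin on ev complete uf eu)+
  moreover have "(nrm u)\<^sup>2 = (\<Sum>p\<in>J. (cmod (c p))\<^sup>2)"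
    unfolding nrm_sq[OF uH] unfolding u_def orthonormal_ip_sums[OF finJ onJ] Re_sum Re_cnj_mult_self ..
  moreover have "Re (H_inner K L f u) = (\<Sum>p\<in>J. (frequency p)\<^sup>2 * (cmod (c p))\<^sup>2)"
    unfolding u_def f_def orthonormal_ip_sums[OF finJ onJ] Re_sum Re_cnj_mult_self ..
  moreover have "(\<Sum>p\<in>J. (frequency p)\<^sup>2 * (cmod (c p))\<^sup>2) < (\<Sum>p\<in>J. E * (cmod (c p))\<^sup>2)"
  proof (rule sum_strict_mono_ex1[OF finJ])
    show "\<forall>p\<in>J. (frequency p)\<^sup>2 * (cmod (c p))\<^sup>2 \<le> E * (cmod (c p))\<^sup>2"
      using freq by (intro ballI mult_right_mono) (auto intro: less_imp_le)
    obtain p where p: "p \<in> J" "c p \<noteq> 0" using c by blast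
    then show "\<exists>p\<in>J. (frequency p)\<^sup>2 * (cmod (c p))\<^sup>2 < E * (cmod (c p))\<^sup>2"
      using freq[OF p(1)] by (intro bexI[of _ p]) auto
  qed
  ultimately show False by (simp add: sum_distrib_left)
qed

end

section \<open>The sequence of eigenvalues\<close>

text \<open>
  If \<open>b n < a n\<close>, then \<open>b\<close> takes its first \<open>n + 1\<close> values on at least \<open>n + 1\<close> indices, but \<open>a\<close> takes these
  values only before \<open>n\<close>.
\<close>

lemma incseq_determined_by_multiplicities_le:
  fixes a b :: "nat \<Rightarrow> 'a::linorder"
  assumes mono: "incseq a" "incseq b"
    and fin: "\<And>x. finite {n. a n = x}" "\<And>x. finite {n. b n = x}"
    and card: "\<And>x. card {n. a n = x} = card {n. b n = x}"
  shows "a n \<le> b n"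
proof (rule ccontr)
  assume "\<not> a n \<le> b n"
  define V where "V = b ` {..n}"
  have count: "finite {k. f k \<in> V} \<and> card {k. f k \<in> V} = (\<Sum>v\<in>V. card {k. f k = v})"
    if "\<And>x. finite {k. f k = x}" for f :: "nat \<Rightarrow> 'a"
  proof -
    have "{k. f k \<in> V} = (\<Union>v\<in>V. {k. f k = v})" by auto
    moreover have "card (\<Union>v\<in>V. {k. f k = v}) = (\<Sum>v\<in>V. card {k. f k = v})"
      using that by (intro card_UN_disjoint) (auto simp: V_def)
    ultimately show ?thesis using that by (simp add: V_def)
  qed
  have "{..n} \<subseteq> {k. b k \<in> V}" by (auto simp: V_def)
  then have "card {..n} \<le> card {k. b k \<in> V}" using count[of b, OF fin(2)] by (intro card_mono) auto
  also have "\<dots> = card {k. a k \<in> V}" using count[of a, OF fin(1)] count[of b, OF fin(2)] card by simp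
  also have "\<dots> \<le> card {..<n}"
  proof (rule card_mono)
    show "{k. a k \<in> V} \<subseteq> {..<n}"
    proof (clarsimp simp: V_def)
      fix k j assume "a k = b j" "j \<le> n"
      then have "a k < a n" using \<open>\<not> a n \<le> b n\<close> incseqD[OF mono(2), of j n] by simp
      then show "k < n" using incseqD[OF mono(1), of n k] by (meson leI leD)
    qed
  qed simp
  finally show False by simp
qed

lemma incseq_determined_by_multiplicities:
  fixes a b :: "nat \<Rightarrow> 'a::linorder"
  assumes "incseq a" "incseq b" "\<And>x. finite {n. a n = x}" "\<And>x. finite {n. b n = x}"
    and "\<And>x. card {n. a n = x} = card {n. b n = x}"
  shows "a = b"
  using incseq_determined_by_multiplicities_le[of a b] incseq_determined_by_multiplicities_le[of b a] assms
  by (intro ext antisym) auto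

text \<open>
  The sequence is the quantile function of \<open>N\<close>: its \<open>n\<close>-th term is the least \<open>x\<close> with
  \<open>n < N x\<close>, which exists because \<open>N\<close> is a step function that jumps on a locally finite set and is continuous from
  the right.
\<close>

lemma exists_sequence_with_multiplicities:
  fixes m :: "real \<Rightarrow> nat"
  defines "S \<equiv> \<lambda>E. {\<mu>. \<mu> \<le> E \<and> 0 < m \<mu>}"
  defines "N \<equiv> \<lambda>E. \<Sum>\<mu>\<in>S E. m \<mu>"
  assumes fin: "\<And>E. finite (S E)" and unbounded: "\<And>n. \<exists>E. n < N E"
  shows "\<exists>ev. incseq ev \<and> (\<forall>\<mu>. finite {n. ev n = \<mu>} \<and> card {n. ev n = \<mu>} = m \<mu>) \<and> (\<forall>E. {n. ev n \<le> E} = {..<N E})"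
proof -
  have N_mono: "N x \<le> N y" if "x \<le> y" for x y
    unfolding N_def using fin that by (intro sum_mono2) (auto simp: S_def)
  have top: "\<exists>\<mu>\<in>S x. N \<mu> = N x" if "0 < N x" for x
  proof -
    have ne: "S x \<noteq> {}" using that by (auto simp: N_def)
    have mx: "Max (S x) \<in> S x" using fin ne by (rule Max_in)
    have "S (Max (S x)) = S x"
    proof (intro equalityI subsetI)
      fix \<mu> assume "\<mu> \<in> S (Max (S x))"
      then show "\<mu> \<in> S x" using mx by (auto simp: S_def)
    next
      fix \<mu> assume "\<mu> \<in> S x"
      then show "\<mu> \<in> S (Max (S x))" using Max_ge[OF fin] by (auto simp: S_def)
    qed
    then show ?thesis using mx by (intro bexI[of _ "Max (S x)"]) (auto simp: N_def)
  qed
  have "\<exists>g. n < N g \<and> (\<forall>x. n < N x \<longrightarrow> g \<le> x)" for n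
  proof -
    obtain E where E: "n < N E" using unbounded by blast
    define A where "A = {\<mu>\<in>S E. n < N \<mu>}"
    have finA: "finite A" using fin by (simp add: A_def)
    have neA: "A \<noteq> {}" using top[of E] E by (auto simp: A_def)
    have "Min A \<le> x" if x: "n < N x" for x
    proof (cases "x \<le> E")
      case True
      obtain \<mu> where \<mu>: "\<mu> \<in> S x" "N \<mu> = N x" using top[of x] x by auto
      then have "\<mu> \<in> A" using True x by (auto simp: A_def S_def)
      then have "Min A \<le> \<mu>" using finA by simp
      then show ?thesis using \<mu> by (auto simp: S_def)
    next
      case False
      have "Min A \<in> A" using finA neA by (rule Min_in)
      then show ?thesis using False by (auto simp: A_def S_def)
    qed
    moreover have "n < N (Min A)" using Min_in[OF finA neA] by (simp add: A_def)
    ultimately show ?thesis by blast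
  qed
  then obtain ev where ev: "\<And>n. n < N (ev n)" "\<And>n x. n < N x \<Longrightarrow> ev n \<le> x" by metis
  have iff: "ev n \<le> x \<longleftrightarrow> n < N x" for n x using ev N_mono by (meson order_less_le_trans)
  have "incseq ev" by (rule incseq_SucI) (use ev iff Suc_lessD in blast)
  moreover have "finite {n. ev n = \<mu>} \<and> card {n. ev n = \<mu>} = m \<mu>" for \<mu>
  proof -
    define N' where "N' = (\<Sum>\<nu>\<in>S \<mu> - {\<mu>}. m \<nu>)"
    have less_iff: "ev n < \<mu> \<longleftrightarrow> n < N'" for n
    proof
      assume "ev n < \<mu>"
      then have "N (ev n) \<le> N'" unfolding N_def N'_def using fin by (intro sum_mono2) (auto simp: S_def)
      then show "n < N'" using ev(1)[of n] by simp
    next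
      assume n: "n < N'"
      have ne: "S \<mu> - {\<mu>} \<noteq> {}"
      proof
        assume "S \<mu> - {\<mu>} = {}"
        then have "N' = 0" unfolding N'_def by (simp only: sum.empty)
        then show False using n by simp
      qed
      let ?x = "Max (S \<mu> - {\<mu>})"
      have x: "?x \<in> S \<mu> - {\<mu>}" using fin ne by (intro Max_in) auto
      have "S \<mu> - {\<mu>} \<subseteq> S ?x"
      proof
        fix \<nu> assume \<nu>: "\<nu> \<in> S \<mu> - {\<mu>}"
        then have "\<nu> \<le> ?x" using fin by (intro Max_ge) auto
        then show "\<nu> \<in> S ?x" using \<nu> by (simp add: S_def)
      qed
      then have "N' \<le> N ?x" unfolding N_def N'_def using fin by (intro sum_mono2) auto
      then have "ev n \<le> ?x" using n iff by simp
      then show "ev n < \<mu>" using x by (auto simp: S_def)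
    qed
    have "{n. ev n = \<mu>} = {N'..<N \<mu>}"
    proof (rule set_eqI)
      fix n
      have "ev n = \<mu> \<longleftrightarrow> ev n \<le> \<mu> \<and> \<not> ev n < \<mu>" by auto
      then have "ev n = \<mu> \<longleftrightarrow> n < N \<mu> \<and> \<not> n < N'" by (simp only: iff less_iff)
      then show "n \<in> {n. ev n = \<mu>} \<longleftrightarrow> n \<in> {N'..<N \<mu>}" by auto
    qed
    moreover have "N \<mu> = N' + m \<mu>"
    proof (cases "\<mu> \<in> S \<mu>")
      case True
      then show ?thesis unfolding N_def N'_def using sum.remove[OF fin True, of m] by simp
    next
      case False
      then have "m \<mu> = 0" unfolding S_def by simp
      moreover have "S \<mu> - {\<mu>} = S \<mu>" using False by (rule Diff_insert0[of _ _ "{}", unfolded Diff_empty])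
      ultimately show ?thesis unfolding N_def N'_def by (simp only: add_0_right)
    qed
    ultimately show ?thesis by simp
  qed
  moreover have "{n. ev n \<le> E} = {..<N E}" for E using iff by auto
  ultimately show ?thesis by blast
qed

context metric_graph
begin

lemma eig_orthogonal:
  assumes k: "k \<in> eig \<mu>" and k': "k' \<in> eig \<mu>'" and ne: "\<mu> \<noteq> \<mu>'"
  shows "H_inner K L k k' = 0"
proof -
  have H: "k \<in> H_space K L" "k' \<in> H_space K L" using k k' eig_in_H by auto
  have "H_inner K L (fscale (of_real \<mu>) k) k' = H_inner K L k (fscale (of_real \<mu>') k')"
    using k k' T_sym by (simp add: eig_def)
  then have "of_real \<mu> * H_inner K L k k' = of_real \<mu>' * H_inner K L k k'"
    using H by (simp add: ip_scale_left ip_scale_right)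
  then show ?thesis using ne by auto
qed

lemma exists_eigenbasis:
  "\<exists>m b. orthonormal b {..<m::nat} \<and> (\<forall>j<m. b j \<in> eig \<mu>) \<and> (\<forall>x\<in>eig \<mu>. null (residual b {..<m} x))"
proof -
  have bound: "m \<le> 2 * K + dirichlet_count \<mu>"
    if "orthonormal e {..<m}" "\<forall>j<m. e j \<in> eig \<mu>" for e :: "nat \<Rightarrow> family" and m
    using eigenfunction_count_upper[OF _ that(1), of "\<lambda>_. \<mu>" \<mu>] that(2) by auto
  have "\<exists>m\<le>2 * K + dirichlet_count \<mu>. \<exists>e. orthonormal e {..<m} \<and> (\<forall>i<m. e i \<in> eig \<mu>) \<and>
      (\<forall>x\<in>eig \<mu>. null (residual e {..<m} x))"
    by (rule exists_orthonormal_basis[OF subspace_eig eig_in_H]) (rule bound)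
  then show ?thesis by blast
qed

definition multiplicity :: "real \<Rightarrow> nat" where
  "multiplicity \<mu> = (SOME m. \<exists>b. orthonormal b {..<m::nat} \<and> (\<forall>j<m. b j \<in> eig \<mu>) \<and> (\<forall>x\<in>eig \<mu>. null (residual b {..<m} x)))"

definition eigenbasis :: "real \<Rightarrow> nat \<Rightarrow> family" where
  "eigenbasis \<mu> = (SOME b. orthonormal b {..<multiplicity \<mu>} \<and> (\<forall>j<multiplicity \<mu>. b j \<in> eig \<mu>) \<and>
     (\<forall>x\<in>eig \<mu>. null (residual b {..<multiplicity \<mu>} x)))"

lemma eigenbasis:
  "orthonormal (eigenbasis \<mu>) {..<multiplicity \<mu>}"
  "j < multiplicity \<mu> \<Longrightarrow> eigenbasis \<mu> j \<in> eig \<mu>"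
  "x \<in> eig \<mu> \<Longrightarrow> null (residual (eigenbasis \<mu>) {..<multiplicity \<mu>} x)"
proof -
  have "\<exists>b. orthonormal b {..<multiplicity \<mu>} \<and> (\<forall>j<multiplicity \<mu>. b j \<in> eig \<mu>) \<and> (\<forall>x\<in>eig \<mu>. null (residual b {..<multiplicity \<mu>} x))"
    unfolding multiplicity_def by (rule someI_ex[OF exists_eigenbasis])
  from someI_ex[OF this, folded eigenbasis_def]
  show "orthonormal (eigenbasis \<mu>) {..<multiplicity \<mu>}"
    "j < multiplicity \<mu> \<Longrightarrow> eigenbasis \<mu> j \<in> eig \<mu>"
    "x \<in> eig \<mu> \<Longrightarrow> null (residual (eigenbasis \<mu>) {..<multiplicity \<mu>} x)" by blast+
qed

lemma eigenspace_eq_eig: "eigenspace K L T \<mu> = eig \<mu>"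
  by (simp add: eigenspace_def eig_def fscale_def)

text \<open>
  An orthonormal basis is a basis in the sense of \<open>has_dimension\<close>, and any two such bases
  have the same size.
\<close>

lemma has_dimension_iff: "has_dimension K L (eigenspace K L T \<mu>) k \<longleftrightarrow> k = multiplicity \<mu>"
proof -
  let ?m = "multiplicity \<mu>" and ?b = "eigenbasis \<mu>"
  have comb: "(\<lambda>i x. \<Sum>j<k. c j * e j i x) = (\<Sum>j<k. fscale (c j) (e j))" for c k and e :: "nat \<Rightarrow> family"
    by (auto simp: fun_eq_iff family_sum_apply)
  have zero: "(\<lambda>i x. 0) = (0 :: family)" by (auto simp: fun_eq_iff)
  have bH: "?b j \<in> H_space K L" if "j < ?m" for j using eigenbasis(2)[OF that] eig_in_H by blast
  have basis_dim: "has_dimension K L (eigenspace K L T \<mu>) ?m"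
    unfolding has_dimension_def eigenspace_eq_eig comb zero
  proof (intro exI[of _ ?b] conjI allI impI ballI)
    fix j assume "j < ?m" then show "?b j \<in> eig \<mu>" by (rule eigenbasis(2))
  next
    fix c j assume h: "H_eq K L (\<Sum>j<?m. fscale (c j) (?b j)) 0" and j: "j < ?m"
    have "null ((\<Sum>j<?m. fscale (c j) (?b j)) - 0)"
      using h by (subst (asm) H_eq_iff_null) (use bH in auto)
    then show "c j = 0" using orthonormal_null_sum[OF _ eigenbasis(1)] j by simp
  next
    fix u assume u: "u \<in> eig \<mu>"
    then have uH: "u \<in> H_space K L" using eig_in_H by blast
    show "\<exists>c. H_eq K L u (\<Sum>j<?m. fscale (c j) (?b j))"
    proof
      show "H_eq K L u (\<Sum>j<?m. fscale (H_inner K L (?b j) u) (?b j))"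
        using eigenbasis(3)[OF u] uH bH by (subst H_eq_iff_null) (auto simp: residual_def)
    qed
  qed
  have "k = ?m" if dim: "has_dimension K L (eigenspace K L T \<mu>) k"
  proof -
    obtain e where e: "\<And>j. j < k \<Longrightarrow> e j \<in> eig \<mu>"
      and indep: "\<And>c. H_eq K L (\<Sum>j<k. fscale (c j) (e j)) 0 \<Longrightarrow> (\<forall>j<k. c j = 0)"
      and span: "\<And>u. u \<in> eig \<mu> \<Longrightarrow> \<exists>c. H_eq K L u (\<Sum>j<k. fscale (c j) (e j))"
      using dim unfolding has_dimension_def eigenspace_eq_eig comb zero by blast
    have eH: "e j \<in> H_space K L" if "j < k" for j using e[OF that] eig_in_H by blast
    have "card {..<k} \<le> card {..<?m}"
    proof (rule independent_card_le[where e = e and v = ?b])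
      fix i assume "i \<in> {..<k}"
      then show "\<exists>c. null (e i - (\<Sum>j<?m. fscale (c j) (?b j)))"
        using eigenbasis(3)[OF e[of i]] by (auto simp: residual_def)
    next
      fix c assume "null (\<Sum>i<k. fscale (c i) (e i))"
      then have "H_eq K L (\<Sum>i<k. fscale (c i) (e i)) 0"
        by (subst H_eq_iff_null) (use eH in auto)
      then show "\<forall>i\<in>{..<k}. c i = 0" using indep by blast
    qed (use eH bH in auto)
    moreover have "card {..<?m} \<le> card {..<k}"
    proof (rule independent_card_le[where e = ?b and v = e])
      fix i assume i: "i \<in> {..<?m}"
      then obtain c where c: "H_eq K L (?b i) (\<Sum>j<k. fscale (c j) (e j))" using span[OF eigenbasis(2)[of i]] by auto
      have "null (?b i - (\<Sum>j<k. fscale (c j) (e j)))"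
        using c by (subst (asm) H_eq_iff_null) (use eH bH i in auto)
      then show "\<exists>c. null (?b i - (\<Sum>j<k. fscale (c j) (e j)))" by blast
    next
      fix c assume "null (\<Sum>i<?m. fscale (c i) (?b i))"
      then show "\<forall>i\<in>{..<?m}. c i = 0" using orthonormal_null_sum[OF _ eigenbasis(1)] by blast
    qed (use eH bH in auto)
    ultimately show ?thesis by simp
  qed
  with basis_dim show ?thesis by blast
qed

definition spectrum_upto :: "real \<Rightarrow> real set" where
  "spectrum_upto E = {\<mu>. \<mu> \<le> E \<and> 0 < multiplicity \<mu>}"

definition eigenvalue_count :: "real \<Rightarrow> nat" where
  "eigenvalue_count E = (\<Sum>\<mu>\<in>spectrum_upto E. multiplicity \<mu>)"

lemma orthonormal_eigenbases:
  "orthonormal (\<lambda>p. eigenbasis (fst p) (snd p)) (SIGMA \<mu>:F. {..<multiplicity \<mu>})"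
  unfolding orthonormal_def
proof (intro conjI ballI)
  fix p q assume p: "p \<in> (SIGMA \<mu>:F. {..<multiplicity \<mu>})" and q: "q \<in> (SIGMA \<mu>:F. {..<multiplicity \<mu>})"
  show "H_inner K L (eigenbasis (fst p) (snd p)) (eigenbasis (fst q) (snd q)) = (if p = q then 1 else 0)"
  proof (cases "fst p = fst q")
    case True
    then show ?thesis using orthonormal_ip[OF eigenbasis(1)[of "fst p"], of "snd p" "snd q"] p q by (auto simp: prod_eq_iff)
  next
    case False
    then show ?thesis using eig_orthogonal[OF eigenbasis(2) eigenbasis(2)] p q by auto
  qed
qed (use eigenbasis(2) eig_in_H in fastforce)

lemma sum_multiplicity_le:
  assumes "finite F" "F \<subseteq> spectrum_upto E"
  shows "(\<Sum>\<mu>\<in>F. multiplicity \<mu>) \<le> 2 * K + dirichlet_count E"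
proof -
  have "card (SIGMA \<mu>:F. {..<multiplicity \<mu>}) \<le> 2 * K + dirichlet_count E"
    using assms eigenbasis(2)
    by (intro eigenfunction_count_upper[OF _ orthonormal_eigenbases, of _ fst]) (auto simp: spectrum_upto_def)
  then show ?thesis using assms by simp
qed

lemma finite_spectrum_upto: "finite (spectrum_upto E)"
proof -
  have "card F \<le> 2 * K + dirichlet_count E" if "F \<subseteq> spectrum_upto E" "finite F" for F
  proof -
    have "card F = (\<Sum>\<mu>\<in>F. 1)" by simp
    also have "\<dots> \<le> (\<Sum>\<mu>\<in>F. multiplicity \<mu>)"
      using that(1) by (intro sum_mono) (auto simp: spectrum_upto_def Suc_le_eq)
    also have "\<dots> \<le> 2 * K + dirichlet_count E" by (rule sum_multiplicity_le[OF that(2,1)])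
    finally show ?thesis .
  qed
  then show ?thesis using finite_if_finite_subsets_card_bdd by blast
qed

lemma eigenvalue_count_upper:
  "eigenvalue_count E \<le> 2 * K + dirichlet_count E"
  unfolding eigenvalue_count_def by (rule sum_multiplicity_le[OF finite_spectrum_upto]) simp

lemma eigenvalue_count_lower:
  assumes n: "\<And>i. i < K \<Longrightarrow> real (n i) * pi < L i * sqrt E"
  shows "(\<Sum>i<K. n i) \<le> eigenvalue_count E + 2 * K"
proof -
  let ?I = "SIGMA \<mu>:spectrum_upto E. {..<multiplicity \<mu>}"
  have "(\<Sum>i<K. n i) \<le> card ?I + 2 * K"
  proof (rule eigenfunction_count_lower[OF _ orthonormal_eigenbases, of _ fst E])
    show "finite ?I" using finite_spectrum_upto by simp
    show "eigenbasis (fst p) (snd p) \<in> eig (fst p)" if "p \<in> ?I" for p using that eigenbasis(2) by auto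
    fix \<mu> k assume \<mu>: "\<mu> \<le> E" and k: "k \<in> eig \<mu>" and orth: "\<forall>p\<in>?I. H_inner K L (eigenbasis (fst p) (snd p)) k = 0"
    have "H_inner K L (eigenbasis \<mu> j) k = 0" if "j < multiplicity \<mu>" for j
      using bspec[OF orth, of "(\<mu>, j)"] that \<mu> by (auto simp: spectrum_upto_def)
    then have "residual (eigenbasis \<mu>) {..<multiplicity \<mu>} k = k" by (simp add: residual_def)
    then show "null k" using eigenbasis(3)[OF k] by simp
  qed (rule n)
  also have "card ?I = eigenvalue_count E" using finite_spectrum_upto by (simp add: eigenvalue_count_def)
  finally show ?thesis .
qed

text \<open>
  An energy is chosen for which the first edge alone carries enough sine functions.
\<close>

lemma eigenvalue_count_unbounded:
  assumes "K \<ge> 1" shows "\<exists>E. k < eigenvalue_count E"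
proof -
  define n where "n i = (if i = 0 then k + 2 * K + 1 else 0)" for i :: nat
  define r where "r = (real (n 0) * pi + 1) / L 0"
  have L0: "0 < L 0" using L_pos[of 0] assms by simp
  have r: "0 < r" "real (n 0) * pi < L 0 * r" using L0 by (auto simp: r_def intro!: divide_pos_pos add_nonneg_pos)
  have "(\<Sum>i<K. n i) \<le> eigenvalue_count (r\<^sup>2) + 2 * K"
  proof (rule eigenvalue_count_lower)
    fix i assume "i < K"
    then show "real (n i) * pi < L i * sqrt (r\<^sup>2)" using r L_pos[of i] by (cases "i = 0") (auto simp: n_def)
  qed
  moreover have "(\<Sum>i<K. n i) = k + 2 * K + 1" using assms by (simp add: n_def)
  ultimately show ?thesis by (intro exI[of _ "r\<^sup>2"]) simp
qed

lemma eigenvalues_upto: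
  assumes "K \<ge> 1" shows "{n. eigenvalues K L T n \<le> E} = {..<eigenvalue_count E}"
proof -
  have "\<exists>ev. incseq ev \<and> (\<forall>\<mu>. finite {n. ev n = \<mu>} \<and> card {n. ev n = \<mu>} = multiplicity \<mu>) \<and>
      (\<forall>E. {n. ev n \<le> E} = {..<eigenvalue_count E})"
    using exists_sequence_with_multiplicities[of multiplicity]
      finite_spectrum_upto eigenvalue_count_unbounded[OF assms]
    unfolding eigenvalue_count_def spectrum_upto_def by blast
  then obtain ev where ev: "incseq ev" "\<And>\<mu>. finite {n. ev n = \<mu>}" "\<And>\<mu>. card {n. ev n = \<mu>} = multiplicity \<mu>"
    "\<And>E. {n. ev n \<le> E} = {..<eigenvalue_count E}" by blast
  have "eigenvalues K L T = ev"
    unfolding eigenvalues_def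
  proof (rule the_equality)
    show "eigenvalue_sequence K L T ev" using ev by (simp add: eigenvalue_sequence_def has_dimension_iff)
    fix ev' assume "eigenvalue_sequence K L T ev'"
    then have "incseq ev'" "\<And>\<mu>. finite {n. ev' n = \<mu>}" "\<And>\<mu>. card {n. ev' n = \<mu>} = multiplicity \<mu>"
      by (auto simp: eigenvalue_sequence_def has_dimension_iff)
    then show "ev' = ev" using ev by (intro incseq_determined_by_multiplicities) auto
  qed
  then show ?thesis using ev(4) by simp
qed

text \<open>
  Of the \<open>3 * K\<close> in the lower bound, \<open>2 * K\<close> are the conditions on the sine functions and \<open>K\<close> is the
  rounding of \<open>L i * sqrt E / pi\<close>; the integers are chosen with the strict inequality
  required by \<open>eigenvalue_count_lower\<close>.
\<close>

lemma weyl_bound: "\<bar>real (eigenvalue_count E) - (\<Sum>i<K. L i) / pi * sqrt (max E 0)\<bar> \<le> 3 * real K"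
proof -
  define x where "x i = L i * sqrt (max E 0) / pi" for i
  have x_nn: "0 \<le> x i" if "i < K" for i using L_pos[OF that] by (simp add: x_def)
  have sum_x: "(\<Sum>i<K. L i) / pi * sqrt (max E 0) = (\<Sum>i<K. x i)"
    by (simp add: x_def sum_divide_distrib sum_distrib_right)
  have "real (eigenvalue_count E) \<le> 2 * real K + (\<Sum>i<K. real (nat \<lfloor>x i\<rfloor>))"
    using eigenvalue_count_upper[of E] unfolding dirichlet_count_def x_def[symmetric]
    by (metis of_nat_add of_nat_le_iff of_nat_mult of_nat_numeral of_nat_sum)
  also have "(\<Sum>i<K. real (nat \<lfloor>x i\<rfloor>)) \<le> (\<Sum>i<K. x i)"
    using x_nn by (intro sum_mono) auto
  finally have upper: "real (eigenvalue_count E) \<le> 2 * real K + (\<Sum>i<K. x i)" by simp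
  have lower: "(\<Sum>i<K. x i) \<le> real (eigenvalue_count E) + 3 * real K"
  proof (cases "E > 0")
    case True
    define n where "n i = nat (\<lceil>x i\<rceil> - 1)" for i
    have x_pos: "0 < x i" if "i < K" for i using L_pos[OF that] True by (simp add: x_def)
    have n: "real (n i) < x i" "x i - 1 \<le> real (n i)" if "i < K" for i
      using x_pos[OF that] unfolding n_def by linarith+
    have "(\<Sum>i<K. n i) \<le> eigenvalue_count E + 2 * K"
    proof (rule eigenvalue_count_lower)
      fix i assume "i < K"
      then show "real (n i) * pi < L i * sqrt E" using n(1)[of i] True by (simp add: x_def field_simps)
    qed
    then have "(\<Sum>i<K. real (n i)) \<le> real (eigenvalue_count E) + 2 * real K"
      by (metis of_nat_add of_nat_le_iff of_nat_mult of_nat_numeral of_nat_sum)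
    moreover have "(\<Sum>i<K. x i - 1) \<le> (\<Sum>i<K. real (n i))" using n(2) by (intro sum_mono) auto
    ultimately show ?thesis by (simp add: sum_subtractf)
  next
    case False
    then show ?thesis by (simp add: x_def)
  qed
  show ?thesis unfolding sum_x using upper lower by linarith
qed

end

theorem theorem4:
  fixes K :: nat and L :: "nat \<Rightarrow> real" and T :: "(family \<times> family) set"
  assumes "K \<ge> 1"
    and "\<And>i. i < K \<Longrightarrow> L i > 0"
    and "quantum_graph K L T"
  shows "\<forall>E::real. finite {n. eigenvalues K L T n \<le> E} \<and>
           \<bar>real (spectral_count K L T E) - (\<Sum>i<K. L i) / pi * sqrt (max E 0)\<bar> \<le> 3 * real K"
proof -
  interpret metric_graph K L T by unfold_locales (use assms in auto)
  show ?thesis using weyl_bound by (simp add: eigenvalues_upto[OF assms(1)] spectral_count_def)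
qed

end
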